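(* Let $u_0\in\mathcal C^{-\alpha_0}$ with $\alpha_0>0$, and assume $\|u_0\|_{\mathcal C^{-\alpha_0}}\le R$ for some $R>0$. Let $\beta,\gamma$ satisfy $\beta>0$ and $\frac{\alpha_0+\beta}2<\gamma<\frac1{2m+1}$, and let $T>0$. Then (for the fixed, sufficiently small $\alpha,\alpha'$ and the fixed $\underline Z$) there exists $T^*\le T$ depending on $R$ and $\|\underline Z\|_{\alpha,\alpha',T}$ such that the equation $$\partial_tv=[(\mathrm i+\mu)\Delta-1]v+\Psi(v,\underline Z),\qquad v(0)=u_0,$$ has a unique mild solution on $[0,T^*]$.
   Context: $\mathbb T^2=\mathbb R^2/\mathbb Z^2$; $\mu>0$, $\nu,\tau\in\mathbb C$ with $\mathrm{Re}\,\nu>0$, $m\ge1$ integer. $\mathcal C^\alpha=\mathcal B^\alpha_{\infty,\infty}$ is the complex-valued Besov–Hölder space on $\mathbb T^2$ (via Littlewood–Paley blocks $\delta_j$, $\|f\|_{\mathcal C^\alpha}=\sup_{j\ge-1}2^{\alpha j}\|\delta_jf\|_{L^\infty}$). $A=(\mathrm i+\mu)\Delta-1$, $P_t=e^{tA}$. Let $L=\{(i,j)\in\mathbb N^2:0\le i\le m+1,\ 0\le j\le m,\ i\ge j,\ i+j>1\}$. For $\alpha,\alpha'\in(0,1)$, $T>0$ and $\underline Z=(Z_t,Z^{(i,j)}_t)_{(i,j)\in L}$ with $Z\in C([0,T];\mathcal C^{-\alpha})$, $Z^{(i,j)}\in C((0,T];\mathcal C^{-\alpha})$, set $\|\underline Z\|_{\alpha,\alpha',T}=\sup_{0\le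 t\le T}\big(\|Z_t\|_{\mathcal C^{-\alpha}}\vee\sup_{(i,j)\in L}t^{(i+j-1)\alpha'}\|Z^{(i,j)}_t\|_{\mathcal C^{-\alpha}}\big)$. Standing assumption: $\alpha,\alpha'\in(0,1)$ are fixed sufficiently small (depending on $\beta,\gamma,m$), and $\underline Z$ is a fixed (deterministic) such family with $\|\underline Z\|_{\alpha,\alpha',T}<\infty$. Extend notation by $Z^{:1,0:}_t=Z_t$, $Z^{:0,1:}_t=\overline{Z_t}$, $Z^{:0,0:}_t=1$, $Z^{:i,j:}_t=Z^{(i,j)}_t$ for $(i,j)\in L$ and $Z^{:j,i:}_t=\overline{Z^{(i,j)}_t}$ for $(i,j)\in L$. For $v$ with $v_t\in\mathcal C^{\beta}$ ($\beta>\alpha$) define $$\Psi(v_t,\underline Z_t)=-\nu\sum_{i=0}^{m+1}\sum_{j=0}^m\binom{m+1}i\binom mj v_t^i\overline{v_t}^{\,j}Z^{:m+1-i,m-j:}_t+(\tau+1)(v_t+Z_t).$$ Given $\alpha_0>0$, $\beta>0$, $\frac{\alpha_0+\beta}2<\gamma<\frac1{2m+1}$ and $u_0\in\mathcal C^{-\alpha_0}$, a mild solution up to time $T$ is $v\in C((0,T];\mathcal C^\beta)$ with $\sup_{0<t\le T}t^\gamma\|v_t\|_{\mathcal C^\beta}<\infty$ and $v_t=P_tu_0+\int_0^tP_{t-s}\Psi(v_s,\underline Z_s)\,ds$ for all $t\le T$. *)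

theory Defs
  imports "HOL-Analysis.Analysis"
begin

text \<open>Distributions on the torus T^2 = R^2/Z^2 are represented by their Fourier
coefficients (a function Z^2 to C).  A function/distribution f has the formal
expansion  sum_k f k * exp(2 pi i k.x).\<close>

type_synonym distr = "int \<times> int \<Rightarrow> complex"

coinductive smooth2 :: "(real \<times> real \<Rightarrow> real) \<Rightarrow> bool" where
  "(\<And>x. f differentiable (at x))
   \<Longrightarrow> smooth2 (\<lambda>x. deriv (\<lambda>s. f (s, snd x)) (fst x))
   \<Longrightarrow> smooth2 (\<lambda>x. deriv (\<lambda>s. f (fst x, s)) (snd x))
   \<Longrightarrow> smooth2 f"

definition dyadic_partition :: "(real \<times> real \<Rightarrow> real) \<Rightarrow> (real \<times> real \<Rightarrow> real) \<Rightarrow> bool" where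
  "dyadic_partition chi \<rho> \<longleftrightarrow>
     smooth2 chi \<and> smooth2 \<rho> \<and>
     (\<forall>\<xi>. 0 \<le> chi \<xi> \<and> chi \<xi> \<le> 1 \<and> 0 \<le> \<rho> \<xi> \<and> \<rho> \<xi> \<le> 1) \<and>
     (\<forall>\<xi>. norm \<xi> > 4/3 \<longrightarrow> chi \<xi> = 0) \<and>
     (\<forall>\<xi>. norm \<xi> < 3/4 \<or> norm \<xi> > 8/3 \<longrightarrow> \<rho> \<xi> = 0) \<and>
     (\<forall>\<xi>. chi \<xi> + (\<Sum>j. \<rho> ((1 / 2 ^ j) *\<^sub>R \<xi>)) = 1)"

text \<open>Block index n :: nat corresponds to j = n - 1 >= -1.\<close>
definition lp_weight :: "(real \<times> real \<Rightarrow> real) \<Rightarrow> (real \<times> real \<Rightarrow> real) \<Rightarrow> nat \<Rightarrow> real \<times> real \<Rightarrow> real" where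
  "lp_weight chi \<rho> n \<xi> = (if n = 0 then chi \<xi> else \<rho> ((1 / 2 ^ (n - 1)) *\<^sub>R \<xi>))"

definition freq :: "int \<times> int \<Rightarrow> real \<times> real" where
  "freq k = (of_int (fst k), of_int (snd k))"

text \<open>A finite box of frequencies containing the support of all blocks with index at most n.\<close>
definition fbox :: "nat \<Rightarrow> (int \<times> int) set" where
  "fbox n = {k. \<bar>fst k\<bar> \<le> 2 ^ (n + 2) \<and> \<bar>snd k\<bar> \<le> 2 ^ (n + 2)}"

definition fourier_mode :: "int \<times> int \<Rightarrow> real \<times> real \<Rightarrow> complex" where
  "fourier_mode k x = exp (2 * of_real pi * \<i> * of_real (of_int (fst k) * fst x + of_int (snd k) * snd x))"

definition lp_block :: "(real \<times> real \<Rightarrow> real) \<Rightarrow> (real \<times> real \<Rightarrow> real) \<Rightarrow> nat \<Rightarrow> distr \<Rightarrow> real \<times> real \<Rightarrow> complex" where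
  "lp_block chi \<rho> n f x = (\<Sum>k\<in>fbox n. of_real (lp_weight chi \<rho> n (freq k)) * f k * fourier_mode k x)"

definition lp_sup :: "(real \<times> real \<Rightarrow> real) \<Rightarrow> (real \<times> real \<Rightarrow> real) \<Rightarrow> nat \<Rightarrow> distr \<Rightarrow> real" where
  "lp_sup chi \<rho> n f = (SUP x. cmod (lp_block chi \<rho> n f x))"

definition besov_member :: "(real \<times> real \<Rightarrow> real) \<Rightarrow> (real \<times> real \<Rightarrow> real) \<Rightarrow> real \<Rightarrow> distr \<Rightarrow> bool" where
  "besov_member chi \<rho> s f \<longleftrightarrow> bdd_above (range (\<lambda>n. 2 powr (s * (real n - 1)) * lp_sup chi \<rho> n f))"

definition besov_norm :: "(real \<times> real \<Rightarrow> real) \<Rightarrow> (real \<times> real \<Rightarrow> real) \<Rightarrow> real \<Rightarrow> distr \<Rightarrow> real" where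
  "besov_norm chi \<rho> s f = (SUP n. 2 powr (s * (real n - 1)) * lp_sup chi \<rho> n f)"

definition besov_cont :: "(real \<times> real \<Rightarrow> real) \<Rightarrow> (real \<times> real \<Rightarrow> real) \<Rightarrow> real \<Rightarrow> real set \<Rightarrow> (real \<Rightarrow> distr) \<Rightarrow> bool" where
  "besov_cont chi \<rho> s S X \<longleftrightarrow>
     (\<forall>t\<in>S. \<forall>\<epsilon>>0. \<exists>\<delta>>0. \<forall>u\<in>S. \<bar>u - t\<bar> < \<delta> \<longrightarrow> besov_norm chi \<rho> s (\<lambda>k. X u k - X t k) < \<epsilon>)"

definition lp_partial :: "(real \<times> real \<Rightarrow> real) \<Rightarrow> (real \<times> real \<Rightarrow> real) \<Rightarrow> nat \<Rightarrow> real \<times> real \<Rightarrow> real" where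
  "lp_partial chi \<rho> N \<xi> = (\<Sum>n\<le>N. lp_weight chi \<rho> n \<xi>)"

text \<open>Product of distributions: limit of the (Fourier coefficients of the) products
  (S_N f)(S_N g) of the Littlewood--Paley truncations (well defined for f in C^beta,
  g in C^{-alpha}, beta > alpha, in which case it agrees with the Bony product).\<close>
definition dprod :: "(real \<times> real \<Rightarrow> real) \<Rightarrow> (real \<times> real \<Rightarrow> real) \<Rightarrow> distr \<Rightarrow> distr \<Rightarrow> distr" where
  "dprod chi \<rho> f g k = lim (\<lambda>N. \<Sum>l\<in>fbox N.
      of_real (lp_partial chi \<rho> N (freq l)) * f l *
      of_real (lp_partial chi \<rho> N (freq (fst k - fst l, snd k - snd l))) * g (fst k - fst l, snd k - snd l))"

definition dconj :: "distr \<Rightarrow> distr" where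
  "dconj f k = cnj (f (- fst k, - snd k))"

definition dunit :: distr where
  "dunit k = (if k = (0, 0) then 1 else 0)"

primrec dpow :: "(real \<times> real \<Rightarrow> real) \<Rightarrow> (real \<times> real \<Rightarrow> real) \<Rightarrow> distr \<Rightarrow> nat \<Rightarrow> distr" where
  "dpow chi \<rho> f 0 = dunit"
| "dpow chi \<rho> f (Suc n) = dprod chi \<rho> f (dpow chi \<rho> f n)"

text \<open>Fourier symbol of A = (i + mu) Laplacian - 1 on R^2/Z^2; P_t has multiplier exp(t * symbol).\<close>
definition heat_symbol :: "real \<Rightarrow> int \<times> int \<Rightarrow> complex" where
  "heat_symbol \<mu> k = - (\<i> + of_real \<mu>) * of_real (4 * pi^2 * (of_int (fst k)^2 + of_int (snd k)^2)) - 1"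

definition Lset :: "nat \<Rightarrow> (nat \<times> nat) set" where
  "Lset m = {(i, j). i \<le> m + 1 \<and> j \<le> m \<and> j \<le> i \<and> i + j > 1}"

definition Zx :: "(real \<Rightarrow> distr) \<Rightarrow> (nat \<Rightarrow> nat \<Rightarrow> real \<Rightarrow> distr) \<Rightarrow> nat \<Rightarrow> nat \<Rightarrow> real \<Rightarrow> distr" where
  "Zx Z Zh a b t =
    (if a = 0 \<and> b = 0 then dunit
     else if a = 1 \<and> b = 0 then Z t
     else if a = 0 \<and> b = 1 then dconj (Z t)
     else if b \<le> a then Zh a b t
     else dconj (Zh b a t))"

definition Psi :: "(real \<times> real \<Rightarrow> real) \<Rightarrow> (real \<times> real \<Rightarrow> real) \<Rightarrow> nat \<Rightarrow> complex \<Rightarrow> complex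
    \<Rightarrow> (real \<Rightarrow> distr) \<Rightarrow> (nat \<Rightarrow> nat \<Rightarrow> real \<Rightarrow> distr) \<Rightarrow> real \<Rightarrow> distr \<Rightarrow> distr" where
  "Psi chi \<rho> m \<nu> \<tau> Z Zh t v k =
     - \<nu> * (\<Sum>i\<le>m + 1. \<Sum>j\<le>m. of_nat ((m + 1) choose i) * of_nat (m choose j) *
          dprod chi \<rho> (dprod chi \<rho> (dpow chi \<rho> v i) (dpow chi \<rho> (dconj v) j)) (Zx Z Zh (m + 1 - i) (m - j) t) k)
     + (\<tau> + 1) * (v k + Z t k)"

definition noise_bound :: "(real \<times> real \<Rightarrow> real) \<Rightarrow> (real \<times> real \<Rightarrow> real) \<Rightarrow> nat \<Rightarrow> real \<Rightarrow> real \<Rightarrow> real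
    \<Rightarrow> (real \<Rightarrow> distr) \<Rightarrow> (nat \<Rightarrow> nat \<Rightarrow> real \<Rightarrow> distr) \<Rightarrow> real \<Rightarrow> bool" where
  "noise_bound chi \<rho> m \<alpha> \<alpha>' T Z Zh K \<longleftrightarrow>
     (\<forall>t\<in>{0..T}. besov_member chi \<rho> (-\<alpha>) (Z t) \<and> besov_norm chi \<rho> (-\<alpha>) (Z t) \<le> K) \<and>
     besov_cont chi \<rho> (-\<alpha>) {0..T} Z \<and>
     (\<forall>(i, j)\<in>Lset m.
        (\<forall>t\<in>{0<..T}. besov_member chi \<rho> (-\<alpha>) (Zh i j t) \<and>
            t powr ((real (i + j) - 1) * \<alpha>') * besov_norm chi \<rho> (-\<alpha>) (Zh i j t) \<le> K) \<and>
        besov_cont chi \<rho> (-\<alpha>) {0<..T} (Zh i j))"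

definition mild_solution :: "(real \<times> real \<Rightarrow> real) \<Rightarrow> (real \<times> real \<Rightarrow> real) \<Rightarrow> nat \<Rightarrow> real \<Rightarrow> complex \<Rightarrow> complex
    \<Rightarrow> real \<Rightarrow> real \<Rightarrow> (real \<Rightarrow> distr) \<Rightarrow> (nat \<Rightarrow> nat \<Rightarrow> real \<Rightarrow> distr) \<Rightarrow> distr \<Rightarrow> real \<Rightarrow> (real \<Rightarrow> distr) \<Rightarrow> bool" where
  "mild_solution chi \<rho> m \<mu> \<nu> \<tau> \<beta> \<gamma> Z Zh u0 T v \<longleftrightarrow>
     (\<forall>t\<in>{0<..T}. besov_member chi \<rho> \<beta> (v t)) \<and>
     besov_cont chi \<rho> \<beta> {0<..T} v \<and>
     (\<exists>C. \<forall>t\<in>{0<..T}. t powr \<gamma> * besov_norm chi \<rho> \<beta> (v t) \<le> C) \<and>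
     (\<forall>t\<in>{0<..T}. \<forall>k.
        set_integrable lborel {0..t}
          (\<lambda>s. exp (of_real (t - s) * heat_symbol \<mu> k) * Psi chi \<rho> m \<nu> \<tau> Z Zh s (v s) k) \<and>
        v t k = exp (of_real t * heat_symbol \<mu> k) * u0 k +
          (LINT s:{0..t}|lborel. exp (of_real (t - s) * heat_symbol \<mu> k) * Psi chi \<rho> m \<nu> \<tau> Z Zh s (v s) k))"

end

theory Submission
  imports Defs
begin

text \<open>Multipliers on the torus are handled by averaging over finite grids, where Parseval and the
  convolution formula are finite sums; a symbol of order zero at scale \<open>2\<^sup>n\<close> then acts boundedly on
  trigonometric polynomials in the sup norm. This yields the smoothing of the heat flow on blocks,
  \<open>|P\<^sub>t f|\<^sub>\<beta>\<^sub>' \<le> C t powr (-(\<beta>' - \<beta>)/2) |f|\<^sub>\<beta>\<close>, and the product estimates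
  \<open>C\<^sup>\<beta> \<times> C\<^sup>\<beta> \<rightarrow> C\<^sup>\<beta>\<close> and \<open>C\<^sup>\<beta> \<times> C\<^sup>-\<^sup>\<alpha> \<rightarrow> C\<^sup>-\<^sup>\<alpha>\<close>. With \<open>|v\<^sub>t|\<^sub>\<beta> \<le> t powr (-\<gamma>)\<close> all terms of \<open>\<Psi>\<close> are of size
  \<open>t powr (-(2m+1)\<gamma>)\<close> in \<open>C\<^sup>-\<^sup>\<alpha>\<close>, which is integrable, so the mild formulation contracts in the unit ball
  of the norm \<open>sup t powr \<gamma> |v\<^sub>t|\<^sub>\<beta>\<close> for short time. Uniqueness outside this ball uses the same estimate
  with an exponential weight in time.\<close>

text \<open>The obstacle is that distributions are bare coefficient families:
  \<open>besov_norm\<close> is a supremum and \<open>dprod\<close> a \<open>lim\<close>, and neither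
  says anything without a boundedness or convergence proof. Hence bounds are carried by the
  predicate \<open>bes\<close>, product bounds come together with \<open>dprod_conv\<close>, and
  limits, measurability and integrals are taken coefficient by coefficient; a block involves
  finitely many coefficients, so bounds pass back to the Besov scale. All summands of
  \<open>Psi\<close> get the same degree in t^(-\<gamma>) because a noise term of order a + b is
  charged (t^(-\<gamma>))^(a+b), which dominates its weight as soon as \<alpha>' \<le> \<gamma> and
  t \<le> 1. The room 1 - (2m+1)\<gamma> left by the integrable singularity is halved to give
  \<kappa>. It pays twice: for a regularity \<beta>' = \<beta> + 2\<kappa> above \<beta>, from which
  continuity in time with values in C^\<beta> is deduced, and for the factor
  \<open>L powr (- \<kappa>)\<close>, which makes uniqueness work for solutions of any size.\<close>

section \<open>Trigonometric polynomials with finitely supported coefficients\<close>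

text \<open>Summing over the support makes the value independent of any enclosing box. For an
  infinite support the sum is 0 by convention, which is why \<open>fin_supp\<close> accompanies
  it.\<close>

definition tp :: "distr \<Rightarrow> real \<times> real \<Rightarrow> complex" where
  "tp f x = (\<Sum>k | f k \<noteq> 0. f k * fourier_mode k x)"

definition fin_supp :: "distr \<Rightarrow> bool" where
  "fin_supp f \<longleftrightarrow> finite {k. f k \<noteq> 0}"

lemma fin_suppI: "finite S \<Longrightarrow> (\<And>k. k \<notin> S \<Longrightarrow> f k = 0) \<Longrightarrow> fin_supp f"
  unfolding fin_supp_def by (rule finite_subset[of _ S]) auto

lemma tp_eq:
  assumes "finite S" "\<And>k. k \<notin> S \<Longrightarrow> f k = 0"
  shows "tp f x = (\<Sum>k\<in>S. f k * fourier_mode k x)"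
  unfolding tp_def by (rule sum.mono_neutral_left) (use assms in auto)

lemma fourier_mode_add: "fourier_mode (k + l) x = fourier_mode k x * fourier_mode l x"
  unfolding fourier_mode_def mult_exp_exp by (simp add: algebra_simps)

lemma fourier_mode_diff: "fourier_mode k (x - y) = fourier_mode k x * fourier_mode (- k) y"
  unfolding fourier_mode_def mult_exp_exp by (simp add: algebra_simps)

lemma fourier_mode_0 [simp]: "fourier_mode 0 x = 1" "fourier_mode (0, 0) x = 1"
  by (simp_all add: fourier_mode_def)

lemma fourier_mode_at_0 [simp]: "fourier_mode k 0 = 1"
  by (simp add: fourier_mode_def)

lemma cmod_fourier_mode [simp]: "cmod (fourier_mode k x) = 1"
proof -
  have "fourier_mode k x = exp (\<i> * of_real (2 * pi * (of_int (fst k) * fst x + of_int (snd k) * snd x)))"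
    unfolding fourier_mode_def by (simp add: algebra_simps)
  then show ?thesis by (simp only: norm_exp_i_times)
qed

lemma cnj_fourier_mode: "cnj (fourier_mode k x) = fourier_mode (- k) x"
  unfolding fourier_mode_def exp_cnj by (simp add: algebra_simps)

lemma fourier_mode_split:
  "fourier_mode (a, b) (x, y) = fourier_mode (a, 0) (x, 0) * fourier_mode (0, b) (0, y)"
  unfolding fourier_mode_def mult_exp_exp by (simp add: algebra_simps)

lemma tp_bdd: "fin_supp f \<Longrightarrow> cmod (tp f x) \<le> (\<Sum>k | f k \<noteq> 0. cmod (f k))"
  unfolding tp_def by (rule sum_norm_le) (simp add: norm_mult)

definition bx :: "nat \<Rightarrow> (int \<times> int) set" where
  "bx N = {- int N..int N} \<times> {- int N..int N}"

lemma finite_bx [simp]: "finite (bx N)" by (simp add: bx_def)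

lemma card_bx: "card (bx N) = (2 * N + 1)\<^sup>2"
proof -
  have "card {- int N..int N} = 2 * N + 1" by simp
  then show ?thesis unfolding bx_def card_cartesian_product power2_eq_square by simp
qed

lemma mem_bx: "k \<in> bx N \<longleftrightarrow> \<bar>fst k\<bar> \<le> int N \<and> \<bar>snd k\<bar> \<le> int N"
  by (cases k) (auto simp: bx_def)

lemma bx_mono: "M \<le> N \<Longrightarrow> bx M \<subseteq> bx N"
  by (auto simp: bx_def)

lemma fin_supp_in_bx:
  assumes "fin_supp f" obtains L where "\<And>k. k \<notin> bx L \<Longrightarrow> f k = 0"
proof -
  define L where "L = Max (insert 0 ((\<lambda>k. nat \<bar>fst k\<bar> + nat \<bar>snd k\<bar>) ` {k. f k \<noteq> 0}))"
  have "k \<in> bx L" if "f k \<noteq> 0" for k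
  proof -
    have "nat \<bar>fst k\<bar> + nat \<bar>snd k\<bar> \<le> L"
      unfolding L_def by (rule Max_ge) (use assms that in \<open>auto simp: fin_supp_def\<close>)
    then show ?thesis by (auto simp: mem_bx)
  qed
  then show ?thesis using that by blast
qed

section \<open>Grid averages: orthogonality of the modes, convolution, Parseval\<close>

definition grid :: "nat \<Rightarrow> (real \<times> real) set" where
  "grid M = (\<lambda>(a, b). (real a / real M, real b / real M)) ` ({..<M} \<times> {..<M})"

lemma sum_grid:
  assumes "M > 0"
  shows "(\<Sum>y\<in>grid M. g y) = (\<Sum>a<M. \<Sum>b<M. g (real a / real M, real b / real M))"
proof -
  have "inj_on (\<lambda>(a, b). (real a / real M, real b / real M)) ({..<M} \<times> {..<M})"
    using assms by (auto simp: inj_on_def)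
  then show ?thesis
    unfolding grid_def by (simp add: sum.reindex sum.cartesian_product case_prod_unfold)
qed

lemma finite_grid [simp]: "finite (grid M)" by (simp add: grid_def)

text \<open>A geometric sum whose ratio is an M-th root of unity; |k| < M leaves k = 0 as the only
  case of ratio 1.\<close>

lemma sum_roots_of_unity_power:
  assumes "M > 0" "\<bar>k\<bar> < int M"
  shows "(\<Sum>a<M. exp (2 * of_real pi * \<i> * of_real (of_int k * (real a / real M)))) = (if k = 0 then of_nat M else 0)"
proof (cases "k = 0")
  case False
  define z where "z = exp (2 * of_real pi * \<i> * of_real (of_int k / real M))"
  have eq: "exp (2 * of_real pi * \<i> * of_real (of_int k * (real a / real M))) = z ^ a" for a
    unfolding z_def exp_of_nat_mult[symmetric] by (simp add: algebra_simps)
  have zM: "z ^ M = 1"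
  proof -
    have "z ^ M = exp (2 * of_int k * of_real pi * \<i>)"
      unfolding z_def exp_of_nat_mult[symmetric] using assms by (simp add: algebra_simps)
    also have "\<dots> = 1" unfolding exp_eq_1 by auto
    finally show ?thesis .
  qed
  have z1: "z \<noteq> 1"
  proof
    assume "z = 1"
    then obtain n :: int where n: "2 * pi * (of_int k / real M) = of_int (2 * n) * pi"
      unfolding z_def exp_eq_1 by auto
    then have "real_of_int k = of_int (n * int M)" using assms by (simp add: field_simps)
    then have "k = n * int M" by linarith
    moreover have "n \<noteq> 0" using calculation False by auto
    ultimately have "1 * int M \<le> \<bar>n\<bar> * int M" by (intro mult_right_mono) auto
    with assms \<open>k = n * int M\<close> show False by (simp add: abs_mult)
  qed
  show ?thesis unfolding eq using z1 zM False by (simp add: sum_gp_strict)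
qed simp

lemma sum_grid_fourier_mode:
  assumes "M > 0" "\<bar>fst k\<bar> < int M" "\<bar>snd k\<bar> < int M"
  shows "(\<Sum>y\<in>grid M. fourier_mode k y) = (if k = 0 then (of_nat M)\<^sup>2 else 0)"
proof -
  obtain a b where k: "k = (a, b)" by force
  have "(\<Sum>y\<in>grid M. fourier_mode k y) =
     (\<Sum>i<M. fourier_mode (a, 0) (real i / real M, 0)) * (\<Sum>j<M. fourier_mode (0, b) (0, real j / real M))"
    unfolding sum_grid[OF assms(1)] sum_product k by (simp only: fourier_mode_split[of a b])
  also have "\<dots> = (if a = 0 then of_nat M else 0) * (if b = 0 then of_nat M else 0)"
    using sum_roots_of_unity_power[of M a] sum_roots_of_unity_power[of M b] assms k
    by (simp add: fourier_mode_def)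
  finally show ?thesis by (auto simp: k power2_eq_square zero_prod_def)
qed

lemma mem_bx_diff:
  assumes "k \<in> bx N" "l \<in> bx L" "N + L < M"
  shows "\<bar>fst (k - l)\<bar> < int M" "\<bar>snd (k - l)\<bar> < int M"
  using assms by (auto simp: mem_bx)

text \<open>The condition N + L < M excludes aliasing: differences of a frequency of
  \<open>m\<close> and one of \<open>f\<close> stay below M, so the grid sum is exact and acts as
  the torus integral would.\<close>

lemma grid_convolution:
  assumes m: "\<And>k. k \<notin> bx N \<Longrightarrow> m k = 0" and f: "\<And>k. k \<notin> bx L \<Longrightarrow> f k = 0" and M: "N + L < M"
  shows "(\<Sum>y\<in>grid M. tp m y * tp f (x - y)) = (of_nat M)\<^sup>2 * tp (\<lambda>k. m k * f k) x"
proof -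
  have "(\<Sum>y\<in>grid M. tp m y * tp f (x - y)) =
     (\<Sum>y\<in>grid M. \<Sum>k\<in>bx N. \<Sum>l\<in>bx L. m k * f l * fourier_mode l x * fourier_mode (k - l) y)"
    by (simp add: tp_eq[OF finite_bx m] tp_eq[OF finite_bx f] sum_product fourier_mode_diff
        fourier_mode_add[of _ "- _", simplified] mult_ac)
  also have "\<dots> = (\<Sum>k\<in>bx N. \<Sum>l\<in>bx L. m k * f l * fourier_mode l x * (\<Sum>y\<in>grid M. fourier_mode (k - l) y))"
    by (subst sum.swap, intro sum.cong refl, subst sum.swap) (simp add: sum_distrib_left)
  also have "\<dots> = (\<Sum>k\<in>bx N. \<Sum>l\<in>bx L. if k = l then (of_nat M)\<^sup>2 * (m k * f k * fourier_mode k x) else 0)"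
  proof (intro sum.cong refl)
    fix k l assume "k \<in> bx N" "l \<in> bx L"
    then show "m k * f l * fourier_mode l x * (\<Sum>y\<in>grid M. fourier_mode (k - l) y) =
        (if k = l then (of_nat M)\<^sup>2 * (m k * f k * fourier_mode k x) else 0)"
      using sum_grid_fourier_mode[of M "k - l"] mem_bx_diff[of k N l L M] M by auto
  qed
  also have "\<dots> = (\<Sum>k\<in>bx N. (of_nat M)\<^sup>2 * (m k * f k * fourier_mode k x))"
    by (intro sum.cong refl) (auto simp: f)
  also have "\<dots> = (of_nat M)\<^sup>2 * tp (\<lambda>k. m k * f k) x"
    by (subst tp_eq[where S = "bx N"]) (auto simp: m sum_distrib_left)
  finally show ?thesis .
qed

text \<open>The convolution formula at x = 0, with the conjugated coefficients as second factor:
  their polynomial at -y is the conjugate of \<open>tp m y\<close>.\<close>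

lemma grid_parseval:
  assumes m: "\<And>k. k \<notin> bx N \<Longrightarrow> m k = 0" and M: "2 * N < M"
  shows "(\<Sum>y\<in>grid M. (cmod (tp m y))\<^sup>2) = (real M)\<^sup>2 * (\<Sum>k\<in>bx N. (cmod (m k))\<^sup>2)"
proof -
  define f where "f k = cnj (m k)" for k
  have f: "\<And>k. k \<notin> bx N \<Longrightarrow> f k = 0" by (simp add: f_def m)
  have c: "tp f (0 - y) = cnj (tp m y)" for y
    by (simp add: tp_eq[OF finite_bx f] tp_eq[OF finite_bx m] f_def cnj_fourier_mode
        fourier_mode_diff[of _ 0, simplified] fourier_mode_at_0)
  have "(\<Sum>y\<in>grid M. tp m y * cnj (tp m y)) = (of_nat M)\<^sup>2 * (\<Sum>k\<in>bx N. m k * cnj (m k))"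
    using grid_convolution[of N m N f M 0] m f M unfolding c
    by (simp add: tp_eq[where S = "bx N"] f_def fourier_mode_def)
  then have "of_real (\<Sum>y\<in>grid M. (cmod (tp m y))\<^sup>2) = (of_real ((real M)\<^sup>2 * (\<Sum>k\<in>bx N. (cmod (m k))\<^sup>2)) :: complex)"
    by (simp add: complex_norm_square del: of_real_power) simp
  then show ?thesis by (simp only: of_real_eq_iff)
qed

text \<open>Convolution with the single mode k, evaluated at 0, extracts the coefficient as a grid
  average of values of modulus at most S.\<close>

lemma cmod_coeff_le:
  assumes "fin_supp f" "\<And>x. cmod (tp f x) \<le> S"
  shows "cmod (f k) \<le> S"
proof -
  obtain L where f: "\<And>k. k \<notin> bx L \<Longrightarrow> f k = 0" using fin_supp_in_bx[OF assms(1)] by blast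
  define N where "N = nat \<bar>fst k\<bar> + nat \<bar>snd k\<bar>"
  define m where "m l = (if l = k then 1 else 0 :: complex)" for l
  have kN: "k \<in> bx N" by (auto simp: mem_bx N_def)
  have m: "l \<notin> bx N \<Longrightarrow> m l = 0" for l using kN by (auto simp: m_def)
  define M where "M = N + L + 1"
  have tpm: "tp m y = fourier_mode k y" for y
    using kN by (subst tp_eq[where S = "{k}"]) (auto simp: m_def)
  have "(of_nat M)\<^sup>2 * f k = (\<Sum>y\<in>grid M. tp m y * tp f (0 - y))"
    by (subst grid_convolution[of N m L f M], use m f in \<open>simp_all add: M_def\<close>)
       (subst tp_eq[where S = "{k}"], auto simp: m_def)
  then have "(real M)\<^sup>2 * cmod (f k) = cmod (\<Sum>y\<in>grid M. tp m y * tp f (0 - y))"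
    by (metis norm_mult norm_power norm_of_nat)
  also have "\<dots> \<le> (\<Sum>y\<in>grid M. S)"
    by (rule sum_norm_le) (use assms in \<open>simp add: norm_mult tpm\<close>)
  also have "\<dots> = (real M)\<^sup>2 * S"
    by (subst sum_grid) (auto simp: M_def power2_eq_square)
  finally show ?thesis by (simp add: M_def)
qed

section \<open>The L1 bound for multiplier kernels\<close>

text \<open>Jordan's inequality: by concavity the sine lies above its chord over [0, pi/2].\<close>

lemma two_div_pi_le_sin:
  assumes "0 \<le> x" "x \<le> pi / 2"
  shows "2 / pi * x \<le> sin x"
proof -
  have "convex_on {0..pi} (\<lambda>x. - sin x)"
    by (rule f''_ge0_imp_convex[where f' = "\<lambda>x. - cos x" and f'' = sin])
       (auto intro!: derivative_eq_intros sin_ge_zero)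
  from convex_onD[OF this, of "2 / pi * x" 0 "pi / 2"] show ?thesis
    using assms by (simp add: field_simps)
qed

text \<open>The chord has length 2 |sin (pi \<theta>)|, and the second half of the circle reduces to
  the first by reflection. The left side is four times the distance of \<theta> to the
  integers.\<close>

lemma cmod_exp_minus_one_ge:
  assumes "0 \<le> \<theta>" "\<theta> \<le> 1"
  shows "4 * min \<theta> (1 - \<theta>) \<le> cmod (exp (2 * of_real pi * \<i> * of_real \<theta>) - 1)"
proof -
  have "cmod (exp (\<i> * of_real (2 * pi * \<theta>)) - 1) = 2 * \<bar>sin (2 * pi * \<theta> / 2)\<bar>"
    using dist_exp_i_1[of "2 * pi * \<theta>"] by simp
  moreover have "4 * min \<theta> (1 - \<theta>) \<le> 2 * \<bar>sin (pi * \<theta>)\<bar>"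
  proof (cases "\<theta> \<le> 1 / 2")
    case True
    then have "2 / pi * (pi * \<theta>) \<le> sin (pi * \<theta>)"
      by (intro two_div_pi_le_sin) (use assms in \<open>auto simp: field_simps\<close>)
    with True show ?thesis by auto
  next
    case False
    then have "2 / pi * (pi * (1 - \<theta>)) \<le> sin (pi * (1 - \<theta>))"
      by (intro two_div_pi_le_sin) (use assms in \<open>auto simp: field_simps\<close>)
    also have "sin (pi * (1 - \<theta>)) = sin (pi * \<theta>)"
      by (simp add: algebra_simps sin_diff)
    finally show ?thesis using False by auto
  qed
  ultimately show ?thesis by (simp add: mult_ac)
qed

text \<open>Telescoping replaces the comparison with an integral: 1/(1 + x^2) \<le> 2/(1 + x)^2, and
  one factor 1 + x is lowered to its predecessor. The correction term 1/(1 + h n) is kept so that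
  the induction closes.\<close>

lemma sum_inverse_one_plus_square_le:
  assumes "h > (0 :: real)"
  shows "(\<Sum>a\<in>{1..n}. 1 / (1 + (h * real a)\<^sup>2)) \<le> 2 / h"
proof -
  have "(\<Sum>a\<in>{1..n}. 1 / (1 + (h * real a)\<^sup>2)) \<le> 2 / h * (1 - 1 / (1 + h * real n))"
  proof (induction n)
    case (Suc n)
    have p: "0 < 1 + h * real n" "0 < 1 + h * real (Suc n)" "0 < 1 + (h * real (Suc n))\<^sup>2"
      using assms by (auto intro!: add_pos_nonneg simp del: of_nat_Suc)
    have "1 / (1 + (h * real (Suc n))\<^sup>2) \<le> 2 / ((1 + h * real n) * (1 + h * real (Suc n)))"
    proof -
      have "(1 + h * real n) * (1 + h * real (Suc n)) \<le> (1 + h * real (Suc n))\<^sup>2"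
        unfolding power2_eq_square using assms p by (intro mult_right_mono) (auto simp: algebra_simps)
      also have "\<dots> \<le> 2 * (1 + (h * real (Suc n))\<^sup>2)"
        using zero_le_power2[of "1 - h * real (Suc n)"] by (simp add: power2_eq_square algebra_simps)
      finally have *: "(1 + h * real n) * (1 + h * real (Suc n)) \<le> 2 * (1 + (h * real (Suc n))\<^sup>2)" .
      have "u > 0 \<Longrightarrow> v > 0 \<Longrightarrow> u \<le> 2 * v \<Longrightarrow> 1 / v \<le> 2 / u" for u v :: real
        by (simp add: field_simps)
      from this[OF mult_pos_pos[OF p(1,2)] p(3) *] show ?thesis .
    qed
    also have "\<dots> = 2 / h * (1 / (1 + h * real n) - 1 / (1 + h * real (Suc n)))"
      using p assms by (simp add: divide_simps) (simp add: algebra_simps)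
    finally have *: "1 / (1 + (h * real (Suc n))\<^sup>2) \<le> 2 / h * (1 / (1 + h * real n) - 1 / (1 + h * real (Suc n)))" .
    have "(\<Sum>a\<in>{1..Suc n}. 1 / (1 + (h * real a)\<^sup>2)) =
        (\<Sum>a\<in>{1..n}. 1 / (1 + (h * real a)\<^sup>2)) + 1 / (1 + (h * real (Suc n))\<^sup>2)"
      by simp
    also have "\<dots> \<le> 2 / h * (1 - 1 / (1 + h * real n)) + 2 / h * (1 / (1 + h * real n) - 1 / (1 + h * real (Suc n)))"
      using Suc.IH * by (rule add_mono)
    finally show ?case by (simp add: algebra_simps del: of_nat_Suc)
  qed simp
  also have "\<dots> \<le> 2 / h" using assms by (simp add: field_simps)
  finally show ?thesis .
qed

text \<open>Only about M/N grid points lie within 1/N of an integer, and the others contribute a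
  convergent tail. The distances to 0 and to M are both charged, so that the second sum is the
  reflection of the first.\<close>

lemma sum_grid_weight_le:
  assumes "N > 0" "N \<le> M"
  shows "(\<Sum>a<M. 1 / (1 + (real N * cmod (exp (2 * of_real pi * \<i> * of_real (real a / real M)) - 1))\<^sup>2))
     \<le> 3 * real M / real N"
proof -
  define h where "h = 4 * real N / real M"
  have h: "h > 0" using assms by (simp add: h_def)
  have le: "1 / (1 + (real N * cmod (exp (2 * of_real pi * \<i> * of_real (real a / real M)) - 1))\<^sup>2) \<le>
     1 / (1 + (h * real a)\<^sup>2) + 1 / (1 + (h * real (M - a))\<^sup>2)" if "a < M" for a
  proof -
    let ?c = "real N * cmod (exp (2 * of_real pi * \<i> * of_real (real a / real M)) - 1)"
    have m: "h * min (real a) (real (M - a)) \<le> ?c"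
    proof -
      have "h * min (real a) (real (M - a)) = real N * (4 * min (real a / real M) (1 - real a / real M))"
        using that by (simp add: h_def of_nat_diff min_def field_simps)
      also have "\<dots> \<le> ?c"
        by (intro mult_left_mono cmod_exp_minus_one_ge) (use that in auto)
      finally show ?thesis .
    qed
    have q: "1 / (1 + ?c\<^sup>2) \<le> 1 / (1 + y\<^sup>2)" if "0 \<le> y" "y \<le> ?c" for y
      using that by (intro divide_left_mono add_left_mono power_mono mult_pos_pos add_pos_nonneg) auto
    have "1 / (1 + ?c\<^sup>2) \<le> 1 / (1 + (h * min (real a) (real (M - a)))\<^sup>2)"
      by (rule q) (use m h in auto)
    also have "\<dots> \<le> 1 / (1 + (h * real a)\<^sup>2) + 1 / (1 + (h * real (M - a))\<^sup>2)"
      unfolding min_def by (auto intro!: divide_nonneg_nonneg add_nonneg_nonneg)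
    finally show ?thesis .
  qed
  have "(\<Sum>a<M. 1 / (1 + (real N * cmod (exp (2 * of_real pi * \<i> * of_real (real a / real M)) - 1))\<^sup>2))
     \<le> (\<Sum>a<M. 1 / (1 + (h * real a)\<^sup>2)) + (\<Sum>a<M. 1 / (1 + (h * real (M - a))\<^sup>2))"
    unfolding sum.distrib[symmetric] by (rule sum_mono) (use le in auto)
  also have "(\<Sum>a<M. 1 / (1 + (h * real (M - a))\<^sup>2)) = (\<Sum>a\<in>{1..M}. 1 / (1 + (h * real a)\<^sup>2))"
    by (rule sum.reindex_bij_witness[of _ "\<lambda>a. M - a" "\<lambda>a. M - a"]) auto
  also have "(\<Sum>a<M. 1 / (1 + (h * real a)\<^sup>2)) \<le> (\<Sum>a\<in>insert 0 {1..M}. 1 / (1 + (h * real a)\<^sup>2))"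
    by (rule sum_mono2) (auto intro!: divide_nonneg_nonneg add_nonneg_nonneg)
  also have "\<dots> = 1 + (\<Sum>a\<in>{1..M}. 1 / (1 + (h * real a)\<^sup>2))" by simp
  finally have "(\<Sum>a<M. 1 / (1 + (real N * cmod (exp (2 * of_real pi * \<i> * of_real (real a / real M)) - 1))\<^sup>2))
     \<le> 1 + 2 / h + 2 / h"
    using sum_inverse_one_plus_square_le[OF h, of M] by linarith
  also have "\<dots> = 1 + real M / real N" using assms by (simp add: h_def)
  also have "\<dots> \<le> 3 * real M / real N" using assms by (simp add: field_simps)
  finally show ?thesis .
qed

text \<open>The discrete counterpart of a symbol of order zero at scale \<open>N\<close>: only differences of order
  one in each variable are needed.\<close>

definition symb :: "real \<Rightarrow> real \<Rightarrow> distr \<Rightarrow> bool" where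
  "symb N A m \<longleftrightarrow> (\<forall>a b. cmod (m (a, b)) \<le> A \<and>
     N * cmod (m (a + 1, b) - m (a, b)) \<le> A \<and>
     N * cmod (m (a, b + 1) - m (a, b)) \<le> A \<and>
     N\<^sup>2 * cmod (m (a + 1, b + 1) - m (a + 1, b) - m (a, b + 1) + m (a, b)) \<le> A)"

lemma tp_shift:
  assumes "fin_supp m"
  shows "fourier_mode k y * tp m y = tp (\<lambda>l. m (l - k)) y"
proof -
  have "tp (\<lambda>l. m (l - k)) y = (\<Sum>l\<in>(\<lambda>l. l + k) ` {l. m l \<noteq> 0}. m (l - k) * fourier_mode l y)"
    by (rule tp_eq) (use assms image_eqI[of l "\<lambda>l. l + k" "l - k" for l] in \<open>force simp: fin_supp_def\<close>)+
  also have "\<dots> = (\<Sum>l | m l \<noteq> 0. m l * fourier_mode (l + k) y)"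
    by (subst sum.reindex) (auto simp: inj_on_def)
  finally show ?thesis by (simp add: tp_def sum_distrib_left fourier_mode_add mult_ac)
qed

lemma tp_diff:
  assumes "fin_supp f" "fin_supp g"
  shows "tp (\<lambda>k. f k - g k) x = tp f x - tp g x"
proof -
  let ?S = "{k. f k \<noteq> 0} \<union> {k. g k \<noteq> 0}"
  have S: "finite ?S" using assms by (auto simp: fin_supp_def)
  show ?thesis
    by (subst (1 2 3) tp_eq[OF S]) (auto simp: sum_subtractf[symmetric] left_diff_distrib)
qed

lemma fin_supp_shift: "fin_supp m \<Longrightarrow> fin_supp (\<lambda>l. m (l - k))"
  by (rule fin_suppI[of "(\<lambda>l. l + k) ` {l. m l \<noteq> 0}"])
     (use image_eqI[of l "\<lambda>l. l + k" "l - k" for l] in \<open>force simp: fin_supp_def\<close>)+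

text \<open>The discrete form of integration by parts: a factor e(y) - 1 on the kernel becomes a
  difference of the symbol.\<close>

lemma tp_difference:
  "fin_supp m \<Longrightarrow> (fourier_mode k y - 1) * tp m y = tp (\<lambda>l. m (l - k) - m l) y"
  by (simp add: tp_diff fin_supp_shift tp_shift[symmetric] algebra_simps)

lemma fin_supp_diff: "fin_supp f \<Longrightarrow> fin_supp g \<Longrightarrow> fin_supp (\<lambda>k. f k - g k)"
  by (rule fin_suppI[of "{k. f k \<noteq> 0} \<union> {k. g k \<noteq> 0}"]) (auto simp: fin_supp_def)

text \<open>The box has (4N + 1)^2 \<le> 25 N^2 points, which is the origin of 25. It will be
  applied to a symbol and to its three differences, with c the power of N that normalises
  each.\<close>

lemma grid_l2_le:
  assumes m: "\<And>k. k \<notin> bx (2 * N) \<Longrightarrow> m k = 0" and M: "4 * N < M" "N \<ge> 1"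
    and c: "0 \<le> c" "\<And>k. c * cmod (m k) \<le> A" "0 \<le> A"
  shows "(\<Sum>y\<in>grid M. (c * cmod (tp m y))\<^sup>2) \<le> 25 * (real M)\<^sup>2 * (A * real N)\<^sup>2"
proof -
  have "(\<Sum>y\<in>grid M. (c * cmod (tp m y))\<^sup>2) = (real M)\<^sup>2 * (\<Sum>k\<in>bx (2 * N). (c * cmod (m k))\<^sup>2)"
    using grid_parseval[of "2 * N" m M] m M
    by (simp add: power_mult_distrib sum_distrib_left[symmetric])
  also have "(\<Sum>k\<in>bx (2 * N). (c * cmod (m k))\<^sup>2) \<le> (\<Sum>k\<in>bx (2 * N). A\<^sup>2)"
    by (intro sum_mono power_mono) (use c in auto)
  also have "\<dots> = (4 * real N + 1)\<^sup>2 * A\<^sup>2" by (simp add: card_bx algebra_simps)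
  also have "\<dots> \<le> (5 * real N)\<^sup>2 * A\<^sup>2"
    by (intro mult_right_mono power_mono) (use M in auto)
  finally have "(\<Sum>y\<in>grid M. (c * cmod (tp m y))\<^sup>2) \<le> (real M)\<^sup>2 * ((5 * real N)\<^sup>2 * A\<^sup>2)"
    by (simp add: mult_left_mono)
  then show ?thesis by (simp add: power_mult_distrib mult_ac)
qed

text \<open>The kernel is bounded in \<open>L\<^sup>1\<close> by the arithmetic-geometric mean inequality
  \<open>2 |K| \<le> A N\<^sup>2 / w + w |K|\<^sup>2 / (A N\<^sup>2)\<close> with the weight
  \<open>w y = (1 + N\<^sup>2 |e(y\<^sub>1) - 1|\<^sup>2) (1 + N\<^sup>2 |e(y\<^sub>2) - 1|\<^sup>2)\<close>; by Parseval, \<open>w |K|\<^sup>2\<close> integrates to an expression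
  in the differences of the symbol.\<close>

lemma grid_l1_kernel:
  assumes m: "\<And>k. k \<notin> bx (2 * N - 1) \<Longrightarrow> m k = 0" and N: "N \<ge> 1" and M: "4 * N < M"
    and s: "symb (real N) A m"
  shows "(\<Sum>y\<in>grid M. cmod (tp m y)) \<le> 55 * A * (real M)\<^sup>2"
proof -
  have A0: "0 \<le> A" using s unfolding symb_def by (meson norm_ge_zero order_trans)
  show ?thesis
  proof (cases "A = 0")
    case True
    then have "m k = 0" for k using s unfolding symb_def by (cases k) auto
    then show ?thesis using True by (simp add: tp_def)
  next
    case False
    then have A: "A > 0" using A0 by simp
    define e1 where "e1 y = cmod (fourier_mode (1, 0) y - 1)" for y
    define e2 where "e2 y = cmod (fourier_mode (0, 1) y - 1)" for y
    define w where "w y = (1 + (real N * e1 y)\<^sup>2) * (1 + (real N * e2 y)\<^sup>2)" for y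
    have w: "w y > 0" for y unfolding w_def by (intro mult_pos_pos add_pos_nonneg) auto
    define l where "l = A * (real N)\<^sup>2"
    have l: "l > 0" using A N by (simp add: l_def)
    have amgm: "cmod (tp m y) \<le> (l / w y + w y * (cmod (tp m y))\<^sup>2 / l) / 2" for y
    proof -
      have "2 * (l * w y * cmod (tp m y)) \<le> l\<^sup>2 + (w y * cmod (tp m y))\<^sup>2"
        using zero_le_power2[of "l - w y * cmod (tp m y)"] by (simp add: power2_eq_square algebra_simps)
      then show ?thesis using l w[of y] by (simp add: field_simps power2_eq_square)
    qed
    have sup_m: "m (a, b) = 0" if "int (2 * N) \<le> \<bar>a\<bar> \<or> int (2 * N) \<le> \<bar>b\<bar>" for a b
      by (rule m) (use that N in \<open>auto simp: mem_bx\<close>)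
    \<comment> \<open>The support has radius 2N - 1, so all unit shifts that occur in the
      differences stay in the box of radius 2N.\<close>
    have z: "m (k - (i, j)) = 0" if "k \<notin> bx (2 * N)" "i \<in> {0, 1}" "j \<in> {0, 1}" for k i j
    proof -
      obtain a b where "k = (a, b)" by force
      then show ?thesis using that by (auto simp: mem_bx intro!: sup_m)
    qed
    have fs: "fin_supp m" using m by (intro fin_suppI[of "bx (2 * N - 1)"]) auto
    define m1 where "m1 k = m (k - (1, 0)) - m k" for k
    define m2 where "m2 k = m (k - (0, 1)) - m k" for k
    define m12 where "m12 k = m1 (k - (0, 1)) - m1 k" for k
    have fs1: "fin_supp m1" unfolding m1_def by (intro fin_supp_diff fin_supp_shift fs)
    have tp1: "e1 y * cmod (tp m y) = cmod (tp m1 y)" for y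
      unfolding m1_def tp_difference[OF fs, symmetric] e1_def norm_mult ..
    have tp2: "e2 y * cmod (tp m y) = cmod (tp m2 y)" for y
      unfolding m2_def tp_difference[OF fs, symmetric] e2_def norm_mult ..
    have tp12: "e2 y * (e1 y * cmod (tp m y)) = cmod (tp m12 y)" for y
      unfolding m12_def tp_difference[OF fs1, symmetric] e2_def norm_mult tp1 ..
    \<comment> \<open>Multiplying out the two factors of the weight gives one square for each of the
      four conditions in \<open>symb\<close>.\<close>
    have expand: "w y * (cmod (tp m y))\<^sup>2 = (1 * cmod (tp m y))\<^sup>2 + (real N * cmod (tp m1 y))\<^sup>2
        + (real N * cmod (tp m2 y))\<^sup>2 + ((real N)\<^sup>2 * cmod (tp m12 y))\<^sup>2" for y
      unfolding w_def tp1[symmetric] tp2[symmetric] tp12[symmetric]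
      by (simp add: power2_eq_square algebra_simps)
    have sb: "cmod (m (a, b)) \<le> A" "real N * cmod (m (a + 1, b) - m (a, b)) \<le> A"
      "real N * cmod (m (a, b + 1) - m (a, b)) \<le> A"
      "(real N)\<^sup>2 * cmod (m (a + 1, b + 1) - m (a + 1, b) - m (a, b + 1) + m (a, b)) \<le> A" for a b
      using s unfolding symb_def by auto
    have "(\<Sum>y\<in>grid M. w y * (cmod (tp m y))\<^sup>2) \<le> 4 * (25 * (real M)\<^sup>2 * (A * real N)\<^sup>2)"
    proof -
      have 0: "(\<Sum>y\<in>grid M. (1 * cmod (tp m y))\<^sup>2) \<le> 25 * (real M)\<^sup>2 * (A * real N)\<^sup>2"
      proof (rule grid_l2_le)
        show "k \<notin> bx (2 * N) \<Longrightarrow> m k = 0" for k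
          using z[of k 0 0] by (simp add: zero_prod_def[symmetric])
        show "1 * cmod (m k) \<le> A" for k using sb by (cases k) auto
      qed (use M N A in auto)
      have 1: "(\<Sum>y\<in>grid M. (real N * cmod (tp m1 y))\<^sup>2) \<le> 25 * (real M)\<^sup>2 * (A * real N)\<^sup>2"
      proof (rule grid_l2_le)
        show "k \<notin> bx (2 * N) \<Longrightarrow> m1 k = 0" for k
          using z[of k 0 0] z[of k 1 0] by (simp add: m1_def zero_prod_def[symmetric])
        show "real N * cmod (m1 k) \<le> A" for k
          using sb(2)[of "fst k - 1" "snd k"] by (cases k) (simp add: m1_def norm_minus_commute)
      qed (use M N A in auto)
      have 2: "(\<Sum>y\<in>grid M. (real N * cmod (tp m2 y))\<^sup>2) \<le> 25 * (real M)\<^sup>2 * (A * real N)\<^sup>2"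
      proof (rule grid_l2_le)
        show "k \<notin> bx (2 * N) \<Longrightarrow> m2 k = 0" for k
          using z[of k 0 0] z[of k 0 1] by (simp add: m2_def zero_prod_def[symmetric])
        show "real N * cmod (m2 k) \<le> A" for k
          using sb(3)[of "fst k" "snd k - 1"] by (cases k) (simp add: m2_def norm_minus_commute)
      qed (use M N A in auto)
      have 3: "(\<Sum>y\<in>grid M. ((real N)\<^sup>2 * cmod (tp m12 y))\<^sup>2) \<le> 25 * (real M)\<^sup>2 * (A * real N)\<^sup>2"
      proof (rule grid_l2_le)
        show "k \<notin> bx (2 * N) \<Longrightarrow> m12 k = 0" for k
          using z[of k 0 0] z[of k 1 0] z[of k 0 1] z[of k 1 1]
          by (simp add: m12_def m1_def diff_diff_eq zero_prod_def[symmetric])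
        show "(real N)\<^sup>2 * cmod (m12 k) \<le> A" for k
        proof -
          obtain a b where k: "k = (a, b)" by force
          have "m12 k = m (a - 1 + 1, b - 1 + 1) - m (a - 1 + 1, b - 1) - m (a - 1, b - 1 + 1) + m (a - 1, b - 1)"
            by (simp add: m12_def m1_def k)
          then show ?thesis using sb(4)[of "a - 1" "b - 1"] by simp
        qed
      qed (use M N A in auto)
      show ?thesis unfolding expand sum.distrib using 0 1 2 3 by linarith
    qed
    moreover have "(\<Sum>y\<in>grid M. 1 / w y) \<le> (3 * real M / real N)\<^sup>2"
    proof -
      define g where "g a = 1 / (1 + (real N * cmod (exp (2 * of_real pi * \<i> * of_real (real a / real M)) - 1))\<^sup>2)" for a
      have g0: "0 \<le> g a" for a unfolding g_def by (intro divide_nonneg_nonneg add_nonneg_nonneg) auto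
      have G: "(\<Sum>a<M. g a) \<le> 3 * real M / real N"
        unfolding g_def by (rule sum_grid_weight_le) (use M N in auto)
      have "(\<Sum>y\<in>grid M. 1 / w y) = (\<Sum>a<M. g a) * (\<Sum>a<M. g a)"
        unfolding sum_product using M
        by (subst sum_grid) (simp_all add: w_def g_def e1_def e2_def fourier_mode_def)
      also have "\<dots> \<le> (3 * real M / real N)\<^sup>2"
        unfolding power2_eq_square by (rule mult_mono[OF G G]) (simp_all add: sum_nonneg g0)
      finally show ?thesis .
    qed
    ultimately have "(\<Sum>y\<in>grid M. (l / w y + w y * (cmod (tp m y))\<^sup>2 / l) / 2)
       \<le> (l * (3 * real M / real N)\<^sup>2 + 4 * (25 * (real M)\<^sup>2 * (A * real N)\<^sup>2) / l) / 2"
      unfolding sum_divide_distrib[symmetric] sum.distrib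
      using l by (intro divide_right_mono add_mono) (simp_all add: sum_divide_distrib[symmetric]
          sum_distrib_left[of l "\<lambda>y. 1 / w y", simplified, symmetric] divide_right_mono mult_left_mono)
    \<comment> \<open>The value \<open>l\<close> balances the two sums: 9 = 3^2 comes from the
      inverse weight, 100 = 4 * 25 from the four Parseval bounds.\<close>
    also have "\<dots> = 109 / 2 * A * (real M)\<^sup>2"
      using A N by (simp add: l_def field_simps power2_eq_square)
    also have "\<dots> \<le> 55 * A * (real M)\<^sup>2" using A by (intro mult_right_mono) auto
    finally show ?thesis by (rule order_trans[OF sum_mono[OF amgm]])
  qed
qed

text \<open>Young's inequality on the grid. The grid is refined according to the support of
  \<open>f\<close>, but the kernel bound does not depend on the grid, hence neither does the
  result.\<close>

lemma multiplier_sup_le: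
  assumes m: "\<And>k. k \<notin> bx (2 * N - 1) \<Longrightarrow> m k = 0" and N: "N \<ge> 1"
    and s: "symb (real N) A m" and f: "fin_supp f" "\<And>x. cmod (tp f x) \<le> S"
  shows "cmod (tp (\<lambda>k. m k * f k) x) \<le> 55 * A * S"
proof -
  obtain L where L: "\<And>k. k \<notin> bx L \<Longrightarrow> f k = 0" using fin_supp_in_bx[OF f(1)] by blast
  define M where "M = 4 * N + L + 1"
  have S: "0 \<le> S" using f(2)[of 0] norm_ge_zero order_trans by blast
  have "(real M)\<^sup>2 * cmod (tp (\<lambda>k. m k * f k) x) = cmod (\<Sum>y\<in>grid M. tp m y * tp f (x - y))"
    by (subst grid_convolution[of "2 * N - 1" m L f M])
       (use m L in \<open>simp_all add: M_def norm_mult norm_power del: of_nat_add of_nat_Suc of_nat_mult\<close>)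
  also have "\<dots> \<le> (\<Sum>y\<in>grid M. cmod (tp m y) * S)"
    by (rule sum_norm_le) (use f in \<open>simp add: norm_mult mult_left_mono\<close>)
  also have "\<dots> \<le> 55 * A * (real M)\<^sup>2 * S"
    unfolding sum_distrib_right[symmetric]
    by (intro mult_right_mono grid_l1_kernel[OF m N _ s] S) (auto simp: M_def)
  finally have "(real M)\<^sup>2 * cmod (tp (\<lambda>k. m k * f k) x) \<le> (real M)\<^sup>2 * (55 * A * S)"
    by (simp add: algebra_simps)
  then show ?thesis by (simp add: M_def mult_le_cancel_left)
qed

section \<open>From smooth cutoffs to symbols of order zero\<close>

text \<open>Increments of arbitrary real step are recorded in place of derivatives, because lattice
  differences of a rescaled cutoff are exactly such increments with step equal to the scale.\<close>

definition diff_bdd :: "real \<Rightarrow> (real \<times> real \<Rightarrow> real) \<Rightarrow> bool" where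
  "diff_bdd B \<phi> \<longleftrightarrow> (\<forall>x y h k. \<bar>\<phi> (x, y)\<bar> \<le> B \<and>
     \<bar>\<phi> (x + h, y) - \<phi> (x, y)\<bar> \<le> B * \<bar>h\<bar> \<and>
     \<bar>\<phi> (x, y + k) - \<phi> (x, y)\<bar> \<le> B * \<bar>k\<bar> \<and>
     \<bar>\<phi> (x + h, y + k) - \<phi> (x + h, y) - \<phi> (x, y + k) + \<phi> (x, y)\<bar> \<le> B * (\<bar>h\<bar> * \<bar>k\<bar>))"

lemma diff_bdd_mono: "diff_bdd B \<phi> \<Longrightarrow> B \<le> B' \<Longrightarrow> diff_bdd B' \<phi>"
  unfolding diff_bdd_def by (meson abs_ge_zero mult_nonneg_nonneg mult_right_mono order_trans)

lemma smooth2D: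
  assumes "smooth2 f"
  shows "f differentiable (at x)" "smooth2 (\<lambda>x. deriv (\<lambda>s. f (s, snd x)) (fst x))"
    "smooth2 (\<lambda>x. deriv (\<lambda>s. f (fst x, s)) (snd x))"
  using assms by (auto elim: smooth2.cases)

lemma smooth2_continuous: "smooth2 f \<Longrightarrow> continuous_on UNIV f"
  by (simp add: smooth2D(1) differentiable_imp_continuous_within continuous_at_imp_continuous_on)

lemma smooth2_partial1:
  assumes "smooth2 f"
  shows "((\<lambda>s. f (s, y)) has_field_derivative deriv (\<lambda>s. f (s, y)) x) (at x)"
proof -
  have "(f \<circ> (\<lambda>s. (s, y))) differentiable (at x)"
    by (intro differentiable_chain_at smooth2D(1)[OF assms])
       (auto intro!: derivative_intros simp: differentiable_def)
  then show ?thesis by (simp add: DERIV_deriv_iff_real_differentiable o_def)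
qed

lemma smooth2_partial2:
  assumes "smooth2 f"
  shows "((\<lambda>s. f (x, s)) has_field_derivative deriv (\<lambda>s. f (x, s)) y) (at y)"
proof -
  have "(f \<circ> (\<lambda>s. (x, s))) differentiable (at y)"
    by (intro differentiable_chain_at smooth2D(1)[OF assms])
       (auto intro!: derivative_intros simp: differentiable_def)
  then show ?thesis by (simp add: DERIV_deriv_iff_real_differentiable o_def)
qed

text \<open>Support is preserved by differentiation, so every derivative of a cutoff is again
  continuous with bounded support, hence bounded.\<close>

lemma deriv_zero_outside:
  fixes f :: "real \<times> real \<Rightarrow> real"
  assumes "\<And>z. norm z > r \<Longrightarrow> f z = 0" "norm (h x) > r" "isCont h x"
  shows "deriv (\<lambda>s. f (h s)) x = 0"
proof -
  have o: "open {z :: real \<times> real. norm z > r}" by (intro open_Collect_less continuous_intros)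
  have "(h \<longlongrightarrow> h x) (nhds x)" using assms(3) by (simp add: isCont_def tendsto_at_iff_tendsto_nhds)
  from topological_tendstoD[OF this o] assms(2)
  have "eventually (\<lambda>s. f (h s) = (\<lambda>_. 0) s) (nhds x)"
    by (auto elim!: eventually_mono simp: assms(1))
  from deriv_cong_ev[OF this refl] show ?thesis by simp
qed

lemma continuous_bounded_of_support:
  fixes f :: "real \<times> real \<Rightarrow> real"
  assumes "continuous_on UNIV f" "\<And>z. norm z > r \<Longrightarrow> f z = 0"
  shows "\<exists>B\<ge>0. \<forall>z. \<bar>f z\<bar> \<le> B"
proof -
  have "bounded (f ` cball 0 r)"
    by (intro compact_imp_bounded compact_continuous_image continuous_on_subset[OF assms(1)]) auto
  then obtain B where "\<forall>z\<in>f ` cball 0 r. norm z \<le> B" unfolding bounded_iff by blast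
  then have B: "\<bar>f z\<bar> \<le> B" if "norm z \<le> r" for z using that by auto
  have "\<bar>f z\<bar> \<le> max B 0" for z
    using B[of z] assms(2)[of z] by (cases "norm z \<le> r") auto
  then show ?thesis by (intro exI[of _ "max B 0"]) auto
qed

text \<open>The mean value inequality in each variable. For the mixed increment it is applied in x
  to f(., y + k) - f(., y), whose derivative is a y-increment of the first partial
  derivative.\<close>

lemma smooth2_diff_bdd:
  assumes f: "smooth2 f" and s: "\<And>z. norm z > r \<Longrightarrow> f z = 0"
  shows "\<exists>B\<ge>0. diff_bdd B f"
proof -
  define f1 where "f1 z = deriv (\<lambda>s. f (s, snd z)) (fst z)" for z
  define f2 where "f2 z = deriv (\<lambda>s. f (fst z, s)) (snd z)" for z
  define f12 where "f12 z = deriv (\<lambda>s. f1 (fst z, s)) (snd z)" for z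
  have s1: "smooth2 f1" and s2: "smooth2 f2"
    using smooth2D(2,3)[OF f] unfolding f1_def[abs_def] f2_def[abs_def] by blast+
  have s12: "smooth2 f12" using smooth2D(3)[OF s1] unfolding f12_def[abs_def] .
  have z1: "norm z > r \<Longrightarrow> f1 z = 0" and z2: "norm z > r \<Longrightarrow> f2 z = 0" for z
    unfolding f1_def f2_def by (intro deriv_zero_outside[of r f] s; simp add: isCont_Pair)+
  have z12: "norm z > r \<Longrightarrow> f12 z = 0" for z
    unfolding f12_def by (intro deriv_zero_outside[of r f1] z1; simp add: isCont_Pair)
  obtain B0 B1 B2 B3 where B: "\<And>z. \<bar>f z\<bar> \<le> B0" "\<And>z. \<bar>f1 z\<bar> \<le> B1" "\<And>z. \<bar>f2 z\<bar> \<le> B2" "\<And>z. \<bar>f12 z\<bar> \<le> B3"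
    and B0: "B0 \<ge> 0" "B1 \<ge> 0" "B2 \<ge> 0" "B3 \<ge> 0"
    using continuous_bounded_of_support[OF smooth2_continuous[OF f] s]
      continuous_bounded_of_support[OF smooth2_continuous[OF s1] z1]
      continuous_bounded_of_support[OF smooth2_continuous[OF s2] z2]
      continuous_bounded_of_support[OF smooth2_continuous[OF s12] z12] by metis
  have d1: "((\<lambda>s. f (s, y)) has_field_derivative f1 (x, y)) (at x)" for x y
    unfolding f1_def using smooth2_partial1[OF f] by simp
  have d2: "((\<lambda>s. f (x, s)) has_field_derivative f2 (x, y)) (at y)" for x y
    unfolding f2_def using smooth2_partial2[OF f] by simp
  have d12: "((\<lambda>s. f1 (x, s)) has_field_derivative f12 (x, y)) (at y)" for x y
    unfolding f12_def using smooth2_partial2[OF s1] by simp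
  have L1: "\<bar>f (x + h, y) - f (x, y)\<bar> \<le> B1 * \<bar>h\<bar>" for x y h
    using field_differentiable_bound[of UNIV "\<lambda>s. f (s, y)" "\<lambda>s. f1 (s, y)" B1 "x + h" x] d1 B by simp
  have L2: "\<bar>f (x, y + h) - f (x, y)\<bar> \<le> B2 * \<bar>h\<bar>" for x y h
    using field_differentiable_bound[of UNIV "\<lambda>s. f (x, s)" "\<lambda>s. f2 (x, s)" B2 "y + h" y] d2 B by simp
  have L12: "\<bar>f1 (x, y + h) - f1 (x, y)\<bar> \<le> B3 * \<bar>h\<bar>" for x y h
    using field_differentiable_bound[of UNIV "\<lambda>s. f1 (x, s)" "\<lambda>s. f12 (x, s)" B3 "y + h" y] d12 B by simp
  have L3: "\<bar>f (x + h, y + k) - f (x + h, y) - f (x, y + k) + f (x, y)\<bar> \<le> B3 * (\<bar>h\<bar> * \<bar>k\<bar>)" for x y h k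
  proof -
    have "((\<lambda>s. f (s, y + k) - f (s, y)) has_field_derivative f1 (z, y + k) - f1 (z, y)) (at z)" for z
      by (intro derivative_intros d1)
    then have "norm ((\<lambda>s. f (s, y + k) - f (s, y)) (x + h) - (\<lambda>s. f (s, y + k) - f (s, y)) x) \<le> B3 * \<bar>k\<bar> * norm (x + h - x)"
      by (intro field_differentiable_bound[of UNIV _ "\<lambda>z. f1 (z, y + k) - f1 (z, y)"]) (use L12 in auto)
    then show ?thesis by (simp add: algebra_simps)
  qed
  have "diff_bdd (B0 + B1 + B2 + B3) f"
    unfolding diff_bdd_def
  proof (intro allI conjI)
    fix x y h k :: real
    show "\<bar>f (x, y)\<bar> \<le> B0 + B1 + B2 + B3" using B(1)[of "(x, y)"] B0 by linarith
    show "\<bar>f (x + h, y) - f (x, y)\<bar> \<le> (B0 + B1 + B2 + B3) * \<bar>h\<bar>"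
      by (rule order_trans[OF L1 mult_right_mono]) (use B0 in auto)
    show "\<bar>f (x, y + k) - f (x, y)\<bar> \<le> (B0 + B1 + B2 + B3) * \<bar>k\<bar>"
      by (rule order_trans[OF L2 mult_right_mono]) (use B0 in auto)
    show "\<bar>f (x + h, y + k) - f (x + h, y) - f (x, y + k) + f (x, y)\<bar> \<le> (B0 + B1 + B2 + B3) * (\<bar>h\<bar> * \<bar>k\<bar>)"
      by (rule order_trans[OF L3 mult_right_mono]) (use B0 in auto)
  qed
  then show ?thesis using B0 by (intro exI[of _ "B0 + B1 + B2 + B3"]) auto
qed

text \<open>Block n rescales by c = 2^(1-n) and is measured at N = 2^n, whence the bound 2; the
  mixed difference contains (|c| N)^2, whence the factor 4.\<close>

lemma symb_of_diff_bdd: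
  assumes "diff_bdd B \<phi>" "B \<ge> 0" "\<bar>c\<bar> * N \<le> 2" "N \<ge> 0"
  shows "symb N (4 * B) (\<lambda>k. of_real (\<phi> (c *\<^sub>R freq k)))"
  unfolding symb_def
proof (intro allI)
  fix a b :: int
  let ?x = "c * of_int a" and ?y = "c * of_int b"
  let ?m = "\<lambda>k. complex_of_real (\<phi> (c *\<^sub>R freq k))"
  have d: "\<bar>\<phi> (?x, ?y)\<bar> \<le> B" "\<bar>\<phi> (?x + c, ?y) - \<phi> (?x, ?y)\<bar> \<le> B * \<bar>c\<bar>"
    "\<bar>\<phi> (?x, ?y + c) - \<phi> (?x, ?y)\<bar> \<le> B * \<bar>c\<bar>"
    "\<bar>\<phi> (?x + c, ?y + c) - \<phi> (?x + c, ?y) - \<phi> (?x, ?y + c) + \<phi> (?x, ?y)\<bar> \<le> B * (\<bar>c\<bar> * \<bar>c\<bar>)"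
    using assms(1) unfolding diff_bdd_def by blast+
  have e: "c *\<^sub>R freq (a, b) = (?x, ?y)" "c *\<^sub>R freq (a + 1, b) = (?x + c, ?y)"
    "c *\<^sub>R freq (a, b + 1) = (?x, ?y + c)" "c *\<^sub>R freq (a + 1, b + 1) = (?x + c, ?y + c)"
    by (simp_all add: freq_def algebra_simps)
  have n: "N * (B * \<bar>c\<bar>) \<le> 4 * B"
    using mult_left_mono[OF assms(3), of B] assms(2) by (simp add: mult_ac)
  have n2: "N\<^sup>2 * (B * (\<bar>c\<bar> * \<bar>c\<bar>)) \<le> 4 * B"
  proof -
    have "(\<bar>c\<bar> * N)\<^sup>2 \<le> 2\<^sup>2" using assms by (intro power_mono) auto
    from mult_left_mono[OF this assms(2)] show ?thesis by (simp add: power2_eq_square mult_ac)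
  qed
  have "cmod (?m (a, b)) \<le> 4 * B" using d(1) assms(2) by (simp add: e)
  moreover have "N * cmod (?m (a + 1, b) - ?m (a, b)) \<le> 4 * B"
    using mult_left_mono[OF d(2) assms(4)] n unfolding e of_real_diff[symmetric] norm_of_real by linarith
  moreover have "N * cmod (?m (a, b + 1) - ?m (a, b)) \<le> 4 * B"
    using mult_left_mono[OF d(3) assms(4)] n unfolding e of_real_diff[symmetric] norm_of_real by linarith
  moreover have "N\<^sup>2 * cmod (?m (a + 1, b + 1) - ?m (a + 1, b) - ?m (a, b + 1) + ?m (a, b)) \<le> 4 * B"
    using mult_left_mono[OF d(4), of "N\<^sup>2"] n2
    unfolding e of_real_diff[symmetric] of_real_add[symmetric] norm_of_real by simp
  ultimately show "cmod (?m (a, b)) \<le> 4 * B \<and> N * cmod (?m (a + 1, b) - ?m (a, b)) \<le> 4 * B \<and>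
      N * cmod (?m (a, b + 1) - ?m (a, b)) \<le> 4 * B \<and>
      N\<^sup>2 * cmod (?m (a + 1, b + 1) - ?m (a + 1, b) - ?m (a, b + 1) + ?m (a, b)) \<le> 4 * B" by blast
qed

lemma tp_sum:
  assumes "finite J" "\<And>j. j \<in> J \<Longrightarrow> fin_supp (g j)"
  shows "tp (\<lambda>k. \<Sum>j\<in>J. g j k) x = (\<Sum>j\<in>J. tp (g j) x)"
proof -
  let ?S = "\<Union>j\<in>J. {k. g j k \<noteq> 0}"
  have S: "finite ?S" using assms by (auto simp: fin_supp_def)
  have "tp (\<lambda>k. \<Sum>j\<in>J. g j k) x = (\<Sum>k\<in>?S. (\<Sum>j\<in>J. g j k) * fourier_mode k x)"
    by (rule tp_eq[OF S]) (auto intro!: sum.neutral)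
  also have "\<dots> = (\<Sum>j\<in>J. \<Sum>k\<in>?S. g j k * fourier_mode k x)"
    by (subst sum.swap) (simp add: sum_distrib_right)
  also have "\<dots> = (\<Sum>j\<in>J. tp (g j) x)"
    by (intro sum.cong refl tp_eq[symmetric] S) auto
  finally show ?thesis .
qed

lemma fin_supp_mult: "fin_supp f \<Longrightarrow> fin_supp (\<lambda>k. m k * f k)"
  by (rule fin_suppI[of "{k. f k \<noteq> 0}"]) (auto simp: fin_supp_def)

section \<open>Littlewood-Paley blocks and Besov bounds\<close>

text \<open>The region that contains the frequencies of block n. Since \<rho> is rescaled by
  2^(n-1), the radii 3/4 and 8/3 appear as 3/8 and 4/3 times 2^n; block 0 is a ball.\<close>

definition Ring :: "nat \<Rightarrow> (int \<times> int) set" where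
  "Ring n = {k. norm (freq k) \<le> 4 / 3 * 2 ^ n \<and> (n \<ge> 1 \<longrightarrow> 3 / 8 * 2 ^ n \<le> norm (freq k))}"

definition near :: "nat \<Rightarrow> nat set" where "near n = {n - 1..n + 1}"

lemma finite_near [simp]: "finite (near n)" by (simp add: near_def)

lemma norm_freq_ge: "\<bar>of_int (fst k)\<bar> \<le> norm (freq k)" "\<bar>of_int (snd k)\<bar> \<le> norm (freq k)"
  using norm_fst_le[of "real_of_int (fst k)" "real_of_int (snd k)"]
    norm_snd_le[of "real_of_int (snd k)" "real_of_int (fst k)"]
  unfolding freq_def real_norm_def by auto

lemma norm_freq_sq: "(norm (freq k))\<^sup>2 = (of_int (fst k))\<^sup>2 + (of_int (snd k))\<^sup>2"
  by (simp add: freq_def norm_prod_def)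

lemma norm_freq_uminus [simp]: "norm (freq (- k)) = norm (freq k)"
  by (simp add: freq_def norm_prod_def)

lemma uminus_mem_Ring [simp]: "- k \<in> Ring n \<longleftrightarrow> k \<in> Ring n"
  by (simp add: Ring_def)

lemma Ring_subset_bx: "Ring n \<subseteq> bx (2 * 2 ^ n - 1)"
proof
  fix k assume "k \<in> Ring n"
  then have "norm (freq k) \<le> 4 / 3 * 2 ^ n" by (simp add: Ring_def)
  also have "(4 / 3 :: real) * 2 ^ n < real_of_int (2 * 2 ^ n)" by simp
  finally have "\<bar>real_of_int (fst k)\<bar> < real_of_int (2 * 2 ^ n)" "\<bar>real_of_int (snd k)\<bar> < real_of_int (2 * 2 ^ n)"
    using norm_freq_ge[of k] by (auto intro: le_less_trans)
  then have "\<bar>fst k\<bar> < 2 * 2 ^ n" "\<bar>snd k\<bar> < 2 * 2 ^ n" by linarith+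
  then show "k \<in> bx (2 * 2 ^ n - 1)" by (simp add: mem_bx of_nat_diff)
qed

lemma fbox_eq: "fbox n = bx (2 ^ (n + 2))"
  by (auto simp: fbox_def mem_bx)

lemma Ring_subset_fbox: "Ring n \<subseteq> fbox n"
  unfolding fbox_eq by (rule order_trans[OF Ring_subset_bx bx_mono]) simp

lemma finite_fbox [simp]: "finite (fbox n)" by (simp add: fbox_eq)

text \<open>Rings whose indices differ by two or more are disjoint, because 4 * 3/8 > 4/3.\<close>

lemma Ring_near:
  assumes "k \<in> Ring n" "k \<in> Ring j"
  shows "j \<in> near n"
proof -
  have *: "b \<le> a + 1" if "k \<in> Ring a" "k \<in> Ring b" for a b
  proof (rule ccontr)
    assume "\<not> b \<le> a + 1"
    then have ba: "a + 2 \<le> b" by simp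
    then have "(3 / 8 :: real) * 2 ^ b \<le> 4 / 3 * 2 ^ a"
      using that by (auto simp: Ring_def)
    moreover have "(2 :: real) ^ (a + 2) \<le> 2 ^ b" using ba by (intro power_increasing) auto
    ultimately have "(3 / 8 :: real) * 2 ^ (a + 2) \<le> 4 / 3 * 2 ^ a" by linarith
    then show False by simp
  qed
  show ?thesis using *[of n j] *[of j n] assms by (auto simp: near_def)
qed

abbreviation blk :: "real \<Rightarrow> nat \<Rightarrow> real" where
  "blk s n \<equiv> 2 powr (- s * (real n - 1))"

text \<open>A single \<open>B\<close> controls the increments of both cutoffs and thereby all
  multiplier constants. It is produced from smoothness in
  \<open>dyadic_partition_imp_lp\<close>.\<close>

locale lp =
  fixes chi \<rho> :: "real \<times> real \<Rightarrow> real" and B :: real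
  assumes part: "dyadic_partition chi \<rho>"
    and Bchi: "diff_bdd B chi" and B\<rho>: "diff_bdd B \<rho>" and B0: "B \<ge> 1"
begin

definition wt :: "nat \<Rightarrow> int \<times> int \<Rightarrow> real" where "wt n k = lp_weight chi \<rho> n (freq k)"

definition Bl :: "nat \<Rightarrow> distr \<Rightarrow> distr" where "Bl n f k = of_real (wt n k) * f k"

lemma wt_nonneg: "0 \<le> wt n k" and wt_le_1: "wt n k \<le> 1"
  using part unfolding wt_def lp_weight_def dyadic_partition_def by presburger+

lemma wt_Ring: "wt n k \<noteq> 0 \<Longrightarrow> k \<in> Ring n"
proof -
  assume a: "wt n k \<noteq> 0"
  show ?thesis
  proof (cases n)
    case 0
    have "norm (freq k) > 4 / 3 \<longrightarrow> chi (freq k) = 0"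
      using part unfolding dyadic_partition_def by blast
    then show ?thesis using a 0 by (auto simp: wt_def lp_weight_def Ring_def)
  next
    case (Suc j)
    have "norm ((1 / 2 ^ j) *\<^sub>R freq k) < 3 / 4 \<or> norm ((1 / 2 ^ j) *\<^sub>R freq k) > 8 / 3 \<longrightarrow> \<rho> ((1 / 2 ^ j) *\<^sub>R freq k) = 0"
      using part unfolding dyadic_partition_def by blast
    then show ?thesis using a Suc by (auto simp: wt_def lp_weight_def Ring_def field_simps not_less)
  qed
qed

lemma symb_wt: "symb (2 ^ n) (4 * B) (\<lambda>k. of_real (wt n k))"
proof (cases n)
  case 0
  then show ?thesis using symb_of_diff_bdd[OF Bchi, of 1 1] B0 by (simp add: wt_def lp_weight_def)
next
  case (Suc j)
  then show ?thesis using symb_of_diff_bdd[OF B\<rho>, of "1 / 2 ^ j" "2 ^ n"] B0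
    by (simp add: wt_def lp_weight_def)
qed

text \<open>Conjugation reflects frequencies, and the cutoffs are not assumed to be even.\<close>

lemma symb_wt_uminus: "symb (2 ^ n) (4 * B) (\<lambda>k. of_real (wt n (- k)))"
proof -
  have e: "c *\<^sub>R freq (- k) = (- c) *\<^sub>R freq k" for c k by (simp add: freq_def)
  show ?thesis
  proof (cases n)
    case 0
    then show ?thesis using symb_of_diff_bdd[OF Bchi, of "- 1" 1] B0 e[of 1] by (simp add: wt_def lp_weight_def)
  next
    case (Suc j)
    then show ?thesis using symb_of_diff_bdd[OF B\<rho>, of "- (1 / 2 ^ j)" "2 ^ n"] B0
      by (simp add: wt_def lp_weight_def e del: scaleR_minus_left)
  qed
qed

lemma sum_wt:
  assumes "finite J" "\<And>j. j \<notin> J \<Longrightarrow> wt j k = 0"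
  shows "(\<Sum>j\<in>J. wt j k) = 1"
proof -
  have "chi (freq k) + (\<Sum>j. \<rho> ((1 / 2 ^ j) *\<^sub>R freq k)) = 1"
    using part unfolding dyadic_partition_def by blast
  moreover have "(\<Sum>j. \<rho> ((1 / 2 ^ j) *\<^sub>R freq k)) = (\<Sum>j | Suc j \<in> J. wt (Suc j) k)"
  proof -
    have "finite {j. Suc j \<in> J}" using finite_vimageI[OF assms(1), of Suc] by (simp add: vimage_def)
    then show ?thesis
      by (subst suminf_finite[of "{j. Suc j \<in> J}"]) (use assms(2)[of "Suc _"] in \<open>auto simp: wt_def lp_weight_def\<close>)
  qed
  \<comment> \<open>If 0 is missing from J, its weight vanishes by assumption, so it may be added to
    separate \<open>chi\<close> from the rescaled copies of \<rho>.\<close>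
  moreover have "(\<Sum>j\<in>J. wt j k) = (\<Sum>j\<in>insert 0 J. wt j k)"
    by (rule sum.mono_neutral_left) (use assms in auto)
  moreover have "insert 0 J = insert 0 (Suc ` {j. Suc j \<in> J})"
    by (auto simp: image_iff) (metis not0_implies_Suc)
  moreover have "(\<Sum>j\<in>insert 0 (Suc ` {j. Suc j \<in> J}). wt j k) = wt 0 k + (\<Sum>j | Suc j \<in> J. wt (Suc j) k)"
    using finite_vimageI[OF assms(1), of Suc]
    by (subst sum.insert) (auto simp: vimage_def sum.reindex)
  ultimately show ?thesis by (simp add: wt_def lp_weight_def)
qed

lemma sum_wt_near: "k \<in> Ring n \<Longrightarrow> (\<Sum>j\<in>near n. wt j k) = 1"
  by (rule sum_wt) (auto simp: near_def[symmetric] dest: Ring_near wt_Ring simp: near_def)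

text \<open>If all weights vanished at k, the empty index set would be admissible in
  \<open>sum_wt\<close> and give 0 = 1.\<close>

lemma ex_wt_nonzero: "\<exists>n. wt n k \<noteq> 0"
  using sum_wt[of "{}" k] by auto

lemma lp_block_tp: "lp_block chi \<rho> n f x = tp (Bl n f) x"
  unfolding lp_block_def
  by (subst tp_eq[of "fbox n"]) (use wt_Ring Ring_subset_fbox in \<open>force simp: Bl_def wt_def\<close>)+

lemma fin_supp_Bl [simp]: "fin_supp (Bl n f)"
  by (rule fin_suppI[of "fbox n"]) (use wt_Ring Ring_subset_fbox in \<open>force simp: Bl_def\<close>)+

text \<open>Membership and a norm bound in one predicate: a real supremum carries no information for
  an unbounded family, whereas this pointwise form is stable under sums, limits and
  integrals.\<close>

definition bes :: "real \<Rightarrow> distr \<Rightarrow> real \<Rightarrow> bool" where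
  "bes s f M \<longleftrightarrow> (\<forall>n x. cmod (tp (Bl n f) x) \<le> M * blk s n)"

lemma besD: "bes s f M \<Longrightarrow> cmod (tp (Bl n f) x) \<le> M * blk s n"
  unfolding bes_def by blast

lemma bes_nonneg: "bes s f M \<Longrightarrow> 0 \<le> M"
proof -
  assume "bes s f M"
  then have "0 \<le> M * 2 powr (- s * (real 0 - 1))"
    unfolding bes_def by (meson norm_ge_zero order_trans)
  then show "0 \<le> M" by (simp add: zero_le_mult_iff not_le)
qed

lemma bes_mono: "bes s f M \<Longrightarrow> M \<le> M' \<Longrightarrow> bes s f M'"
  unfolding bes_def by (meson mult_right_mono order_trans powr_ge_zero)

lemma tp_Bl_add: "tp (Bl n (\<lambda>k. f k + g k)) x = tp (Bl n f) x + tp (Bl n g) x"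
  by (simp add: lp_block_tp[symmetric] lp_block_def algebra_simps sum.distrib)

lemma tp_Bl_diff: "tp (Bl n (\<lambda>k. f k - g k)) x = tp (Bl n f) x - tp (Bl n g) x"
  by (simp add: lp_block_tp[symmetric] lp_block_def algebra_simps sum_subtractf)

lemma tp_Bl_cmult: "tp (Bl n (\<lambda>k. c * f k)) x = c * tp (Bl n f) x"
  by (simp add: lp_block_tp[symmetric] lp_block_def algebra_simps sum_distrib_left)

lemma bes_add: "bes s f F \<Longrightarrow> bes s g G \<Longrightarrow> bes s (\<lambda>k. f k + g k) (F + G)"
  unfolding bes_def tp_Bl_add distrib_right by (meson add_mono norm_triangle_le)

lemma bes_diff: "bes s f F \<Longrightarrow> bes s g G \<Longrightarrow> bes s (\<lambda>k. f k - g k) (F + G)"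
  unfolding bes_def tp_Bl_diff distrib_right by (meson add_mono norm_triangle_le_diff)

lemma bes_cmult: "bes s f F \<Longrightarrow> bes s (\<lambda>k. c * f k) (cmod c * F)"
  unfolding bes_def tp_Bl_cmult norm_mult by (simp add: mult.assoc mult_left_mono)

lemma bes_zero: "bes s (\<lambda>k. 0) 0"
  by (simp add: bes_def tp_def Bl_def)

lemma bes_sum:
  "finite I \<Longrightarrow> (\<And>i. i \<in> I \<Longrightarrow> bes s (f i) (F i)) \<Longrightarrow> bes s (\<lambda>k. \<Sum>i\<in>I. f i k) (\<Sum>i\<in>I. F i)"
  by (induction I rule: finite_induct) (auto simp: bes_zero bes_add)

text \<open>The quotient of the two weights is largest at index 0, which stands for j = -1; this
  costs the factor 2^(s-s').\<close>

lemma bes_weaken: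
  assumes "bes s f F" "s' \<le> s" shows "bes s' f (F * 2 powr (s - s'))"
  unfolding bes_def
proof (intro allI)
  fix n x
  have "cmod (tp (Bl n f) x) \<le> F * blk s n" using besD[OF assms(1)] .
  also have "\<dots> \<le> F * 2 powr (s - s' - s' * (real n - 1))"
  proof (intro mult_left_mono bes_nonneg[OF assms(1)], subst powr_le_cancel_iff)
    have "0 \<le> (s - s') * real n" using assms(2) by simp
    then show "- s * (real n - 1) \<le> s - s' - s' * (real n - 1)" by (simp add: algebra_simps)
  qed simp
  finally show "cmod (tp (Bl n f) x) \<le> F * 2 powr (s - s') * blk s' n"
    by (simp add: powr_add[symmetric] mult.assoc)
qed

lemma besov_imp_bes:
  assumes "besov_member chi \<rho> s f" "besov_norm chi \<rho> s f \<le> K"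
  shows "bes s f K"
  unfolding bes_def
proof (intro allI)
  fix n x
  have "bdd_above (range (\<lambda>x. cmod (lp_block chi \<rho> n f x)))"
    unfolding lp_block_tp by (rule bdd_aboveI2[OF tp_bdd]) simp
  then have "cmod (tp (Bl n f) x) \<le> lp_sup chi \<rho> n f"
    unfolding lp_sup_def lp_block_tp by (rule cSUP_upper[OF UNIV_I])
  moreover have "2 powr (s * (real n - 1)) * lp_sup chi \<rho> n f \<le> K"
    using cSUP_upper[OF UNIV_I assms(1)[unfolded besov_member_def], of n] assms(2)
    unfolding besov_norm_def by linarith
  ultimately have "2 powr (s * (real n - 1)) * cmod (tp (Bl n f) x) \<le> K"
    by (meson mult_left_mono order_trans powr_ge_zero)
  then show "cmod (tp (Bl n f) x) \<le> K * blk s n"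
    by (simp only: mult_minus_left powr_minus) (simp add: field_simps)
qed

lemma bes_imp_besov:
  assumes "bes s f K"
  shows "besov_member chi \<rho> s f" "besov_norm chi \<rho> s f \<le> K"
proof -
  have *: "2 powr (s * (real n - 1)) * lp_sup chi \<rho> n f \<le> K" for n
  proof -
    have "lp_sup chi \<rho> n f \<le> K * blk s n"
      unfolding lp_sup_def lp_block_tp by (rule cSUP_least) (rule UNIV_not_empty, rule besD[OF assms])
    then show ?thesis by (simp only: mult_minus_left powr_minus) (simp add: field_simps)
  qed
  then show "besov_member chi \<rho> s f" unfolding besov_member_def by (auto intro!: bdd_aboveI2)
  show "besov_norm chi \<rho> s f \<le> K" unfolding besov_norm_def by (rule cSUP_least) (auto simp: *)
qed

lemma Bl_decomp: "k \<in> Ring n \<Longrightarrow> f k = (\<Sum>j\<in>near n. Bl j f k)"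
  using sum_wt_near[of k n] unfolding Bl_def sum_distrib_right[symmetric] of_real_sum[symmetric] by simp

lemma near_weight_sum:
  assumes "0 \<le> F"
  shows "(\<Sum>j\<in>near n. F * blk s j) \<le> 3 * 2 powr \<bar>s\<bar> * (F * blk s n)"
proof -
  have c: "card (near n) \<le> 3" by (simp add: near_def)
  have "blk s j \<le> 2 powr \<bar>s\<bar> * blk s n" if "j \<in> near n" for j
  proof -
    have "\<bar>real n - real j\<bar> \<le> 1" using that by (auto simp: near_def)
    then have "\<bar>s\<bar> * \<bar>real n - real j\<bar> \<le> \<bar>s\<bar> * 1" by (intro mult_left_mono) auto
    then have "s * (real n - real j) \<le> \<bar>s\<bar>" unfolding abs_mult[symmetric] by linarith
    then show ?thesis unfolding powr_add[symmetric] by (simp add: algebra_simps)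
  qed
  then have "(\<Sum>j\<in>near n. F * blk s j) \<le> (\<Sum>j\<in>near n. F * (2 powr \<bar>s\<bar> * blk s n))"
    by (intro sum_mono mult_left_mono assms)
  also have "\<dots> = card (near n) * (F * (2 powr \<bar>s\<bar> * blk s n))" by simp
  also have "\<dots> \<le> 3 * (F * (2 powr \<bar>s\<bar> * blk s n))"
    using c assms by (intro mult_right_mono) auto
  finally show ?thesis by (simp add: mult_ac)
qed

text \<open>On ring n the coefficients of \<open>f\<close> are the sum of at most three neighbouring
  blocks, each a trigonometric polynomial to which the sup bound applies: 165 = 3 * 55.\<close>

lemma ring_multiplier:
  assumes m: "\<And>k. m k \<noteq> 0 \<Longrightarrow> k \<in> Ring n" and s: "symb (2 ^ n) A m" and f: "bes s f F"
  shows "cmod (tp (\<lambda>k. m k * f k) x) \<le> 165 * 2 powr \<bar>s\<bar> * A * F * blk s n"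
proof -
  have A: "0 \<le> A" using s unfolding symb_def by (meson norm_ge_zero order_trans)
  have "(\<lambda>k. m k * f k) = (\<lambda>k. \<Sum>j\<in>near n. m k * Bl j f k)"
    using m Bl_decomp[of _ n f] by (force simp: sum_distrib_left[symmetric])
  then have "tp (\<lambda>k. m k * f k) x = (\<Sum>j\<in>near n. tp (\<lambda>k. m k * Bl j f k) x)"
    using finite_near by (simp add: tp_sum fin_supp_mult)
  also have "cmod \<dots> \<le> (\<Sum>j\<in>near n. 55 * A * (F * blk s j))"
    by (intro sum_norm_le multiplier_sup_le[of "2 ^ n"])
       (use m Ring_subset_bx s besD[OF f] in auto)
  also have "\<dots> = 55 * A * (\<Sum>j\<in>near n. F * blk s j)"
    by (rule sum_distrib_left[symmetric])
  also have "\<dots> \<le> 55 * A * (3 * 2 powr \<bar>s\<bar> * (F * blk s n))"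
    using A by (intro mult_left_mono near_weight_sum bes_nonneg[OF f]) simp
  finally show ?thesis by (simp add: mult_ac)
qed

text \<open>Each coefficient is a bounded functional on the Besov scale, with a constant depending
  on k and s. This is the bridge from Besov bounds to convergence and integrability of
  coefficients.\<close>

lemma coeff_le: "\<exists>C\<ge>0. \<forall>f F. bes s f F \<longrightarrow> cmod (f k) \<le> C * F"
proof -
  obtain n where n: "k \<in> Ring n" using ex_wt_nonzero wt_Ring by blast
  show ?thesis
  proof (intro exI[of _ "3 * 2 powr \<bar>s\<bar> * blk s n"] conjI allI impI)
    fix f F assume f: "bes s f F"
    have "cmod (f k) \<le> (\<Sum>j\<in>near n. F * blk s j)"
      unfolding Bl_decomp[OF n, of f]
    proof (rule sum_norm_le)
      fix j
      show "cmod (Bl j f k) \<le> F * blk s j"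
        by (rule cmod_coeff_le[OF fin_supp_Bl besD[OF f]])
    qed
    then show "cmod (f k) \<le> 3 * 2 powr \<bar>s\<bar> * blk s n * F"
      using near_weight_sum[of F s n] bes_nonneg[OF f] by (simp add: mult_ac)
  qed simp
qed

text \<open>Substituting -k for k turns the block of the conjugate into the conjugate of
  \<open>f\<close> multiplied by the reflected weight, which lives on the same ring.\<close>

lemma bes_dconj:
  assumes f: "bes s f F"
  shows "bes s (dconj f) (165 * 2 powr \<bar>s\<bar> * (4 * B) * F)"
  unfolding bes_def
proof (intro allI)
  fix n x
  let ?g = "\<lambda>k. of_real (wt n (- k)) * f k"
  have S: "finite (Ring n)" by (rule finite_subset[OF Ring_subset_fbox]) simp
  have "tp (Bl n (dconj f)) x = (\<Sum>k\<in>Ring n. Bl n (dconj f) k * fourier_mode k x)"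
    by (rule tp_eq[OF S]) (use wt_Ring in \<open>auto simp: Bl_def\<close>)
  also have "\<dots> = (\<Sum>k\<in>Ring n. Bl n (dconj f) (- k) * fourier_mode (- k) x)"
    by (rule sum.reindex_bij_witness[of _ uminus uminus]) auto
  also have "\<dots> = cnj (\<Sum>k\<in>Ring n. ?g k * fourier_mode k x)"
    by (simp add: Bl_def dconj_def cnj_fourier_mode)
  also have "(\<Sum>k\<in>Ring n. ?g k * fourier_mode k x) = tp ?g x"
    by (rule tp_eq[OF S, symmetric]) (use wt_Ring[of n "- _"] in auto)
  finally have "cmod (tp (Bl n (dconj f)) x) = cmod (tp ?g x)" by simp
  also have "\<dots> \<le> 165 * 2 powr \<bar>s\<bar> * (4 * B) * F * blk s n"
    by (rule ring_multiplier[OF _ symb_wt_uminus f]) (use wt_Ring[of n "- _"] in auto)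
  finally show "cmod (tp (Bl n (dconj f)) x) \<le> 165 * 2 powr \<bar>s\<bar> * (4 * B) * F * blk s n" .
qed

end

section \<open>Smoothing by the heat flow\<close>

lemma cmod_exp_diff_le: "cmod (exp z - exp w) \<le> max (exp (Re z)) (exp (Re w)) * cmod (z - w)"
proof (rule field_differentiable_bound[where S = "closed_segment z w" and f' = exp])
  fix u assume "u \<in> closed_segment z w"
  then obtain t where t: "0 \<le> t" "t \<le> 1" "u = (1 - t) *\<^sub>R z + t *\<^sub>R w"
    by (auto simp: closed_segment_def)
  have "Re u \<le> max (Re z) (Re w)"
    unfolding t(3) using t(1,2) by (simp add: convex_bound_le)
  then show "cmod (exp u) \<le> max (exp (Re z)) (exp (Re w))"
    by (auto simp: max_def split: if_splits intro: order_trans)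
qed (auto intro!: derivative_eq_intros)

text \<open>A discrete Leibniz rule. Bounds on \<open>g\<close> are asked only for unit squares that
  meet the support of \<open>m\<close>, since the heat factor is small on a ring but not near the
  origin.\<close>

lemma symb_mult:
  assumes m: "symb N A m" and N: "N \<ge> 0"
    and g: "\<And>a b. (\<exists>i\<in>{0, 1}. \<exists>j\<in>{0, 1}. m (a + i, b + j) \<noteq> 0) \<Longrightarrow> cmod (g (a, b)) \<le> A' \<and>
      N * cmod (g (a + 1, b) - g (a, b)) \<le> A' \<and> N * cmod (g (a, b + 1) - g (a, b)) \<le> A' \<and>
      N\<^sup>2 * cmod (g (a + 1, b + 1) - g (a + 1, b) - g (a, b + 1) + g (a, b)) \<le> A'"
    and A': "0 \<le> A'"
  shows "symb N (4 * (A * A')) (\<lambda>k. m k * g k)"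
  unfolding symb_def
proof (intro allI)
  fix a b
  have A: "0 \<le> A" using m unfolding symb_def by (meson norm_ge_zero order_trans)
  have AA: "0 \<le> A * A'" using A A' by simp
  let ?m = "m (a, b)" and ?m1 = "m (a + 1, b)" and ?m2 = "m (a, b + 1)" and ?m3 = "m (a + 1, b + 1)"
  let ?g = "g (a, b)" and ?g1 = "g (a + 1, b)" and ?g2 = "g (a, b + 1)" and ?g3 = "g (a + 1, b + 1)"
  show "cmod (?m * ?g) \<le> 4 * (A * A') \<and> N * cmod (?m1 * ?g1 - ?m * ?g) \<le> 4 * (A * A') \<and>
    N * cmod (?m2 * ?g2 - ?m * ?g) \<le> 4 * (A * A') \<and>
    N\<^sup>2 * cmod (?m3 * ?g3 - ?m1 * ?g1 - ?m2 * ?g2 + ?m * ?g) \<le> 4 * (A * A')"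
  proof (cases "\<exists>i\<in>{0, 1}. \<exists>j\<in>{0, 1}. m (a + i, b + j) \<noteq> 0")
    case False
    then have "?m = 0" "?m1 = 0" "?m2 = 0" "?m3 = 0" by auto
    then show ?thesis using AA by simp
  next
    case True
    note g = g[OF this]
    have mm: "cmod (m (a', b')) \<le> A" "N * cmod (m (a' + 1, b') - m (a', b')) \<le> A"
      "N * cmod (m (a', b' + 1) - m (a', b')) \<le> A"
      "N\<^sup>2 * cmod (m (a' + 1, b' + 1) - m (a' + 1, b') - m (a', b' + 1) + m (a', b')) \<le> A" for a' b'
      using m unfolding symb_def by auto
    have 1: "cmod (?m * ?g) \<le> A * A'" unfolding norm_mult using mm(1) g A by (intro mult_mono) auto
    have two: "N * cmod (x' * y' - x * y) \<le> A * A' + A * A'"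
      if "cmod x' \<le> A" "N * cmod (x' - x) \<le> A" "N * cmod (y' - y) \<le> A'" "cmod y \<le> A'" for x x' y y'
    proof -
      have "x' * y' - x * y = x' * (y' - y) + (x' - x) * y" by (simp add: algebra_simps)
      then have "N * cmod (x' * y' - x * y) \<le> N * (cmod x' * cmod (y' - y) + cmod (x' - x) * cmod y)"
        unfolding norm_mult[symmetric] using N by (intro mult_left_mono) (simp_all add: norm_triangle_ineq)
      also have "\<dots> = cmod x' * (N * cmod (y' - y)) + (N * cmod (x' - x)) * cmod y"
        by (simp add: algebra_simps)
      also have "\<dots> \<le> A * A' + A * A'" using that A N by (intro add_mono mult_mono) auto
      finally show ?thesis .
    qed
    have 2: "N * cmod (?m1 * ?g1 - ?m * ?g) \<le> A * A' + A * A'"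
      by (rule two) (use mm g in auto)
    have 3: "N * cmod (?m2 * ?g2 - ?m * ?g) \<le> A * A' + A * A'"
      by (rule two) (use mm g in auto)
    have 4: "N\<^sup>2 * cmod (?m3 * ?g3 - ?m1 * ?g1 - ?m2 * ?g2 + ?m * ?g) \<le> A * A' + A * A' + A * A' + A * A'"
    proof -
      let ?D = "?g3 - ?g1 - ?g2 + ?g" and ?E = "?m3 - ?m1 - ?m2 + ?m"
      \<comment> \<open>The mixed difference of a product splits into four products, each carrying
        exactly the two powers of N; hence the factor 4 in the statement.\<close>
      have "?m3 * ?g3 - ?m1 * ?g1 - ?m2 * ?g2 + ?m * ?g =
         ?m3 * ?D + (?m3 - ?m1) * (?g1 - ?g) + (?m3 - ?m2) * (?g2 - ?g) + ?E * ?g"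
        by (simp add: algebra_simps)
      then have "cmod (?m3 * ?g3 - ?m1 * ?g1 - ?m2 * ?g2 + ?m * ?g) \<le>
         cmod ?m3 * cmod ?D + cmod (?m3 - ?m1) * cmod (?g1 - ?g) + cmod (?m3 - ?m2) * cmod (?g2 - ?g) + cmod ?E * cmod ?g"
        unfolding norm_mult[symmetric]
        by (metis (no_types, lifting) add_mono norm_triangle_mono order_refl)
      then have "N\<^sup>2 * cmod (?m3 * ?g3 - ?m1 * ?g1 - ?m2 * ?g2 + ?m * ?g) \<le> N\<^sup>2 *
         (cmod ?m3 * cmod ?D + cmod (?m3 - ?m1) * cmod (?g1 - ?g) + cmod (?m3 - ?m2) * cmod (?g2 - ?g) + cmod ?E * cmod ?g)"
        by (intro mult_left_mono) auto
      also have "\<dots> = cmod ?m3 * (N\<^sup>2 * cmod ?D) + (N * cmod (?m3 - ?m1)) * (N * cmod (?g1 - ?g))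
         + (N * cmod (?m3 - ?m2)) * (N * cmod (?g2 - ?g)) + (N\<^sup>2 * cmod ?E) * cmod ?g"
        by (simp add: algebra_simps power2_eq_square)
      also have "\<dots> \<le> A * A' + A * A' + A * A' + A * A'"
        using mm(1)[of "a + 1" "b + 1"] mm(3)[of "a + 1" b] mm(2)[of a "b + 1"] mm(4)[of a b] g A N
        by (intro add_mono mult_mono) auto
      finally show ?thesis .
    qed
    show ?thesis using 1 2 3 4 AA by linarith
  qed
qed

text \<open>With y = t 4^n this turns Gaussian decay at frequency 2^n into the power law that
  measures the gain of regularity.\<close>

lemma exp_decay_le_powr:
  fixes c1 c2 \<theta> :: real
  assumes "c1 \<ge> 0" "c2 > 0" "\<theta> \<ge> 0"
  shows "\<exists>C\<ge>0. \<forall>y>0. (1 + c1 * y)\<^sup>2 * exp (- c2 * y) \<le> C * y powr (- \<theta>)"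
proof -
  \<comment> \<open>An integer exponent above \<theta> + 2 absorbs both polynomial factors and makes
    (1 + x/p)^p \<le> e^x applicable.\<close>
  obtain p :: nat where p: "\<theta> + 2 \<le> real p" using real_arch_simple by blast
  then have p0: "p > 0" using assms by (cases p) auto
  define C where "C = (1 + c1)\<^sup>2 * (real p ^ p * exp c2 / c2 ^ p)"
  have "(1 + c1 * y)\<^sup>2 * exp (- c2 * y) \<le> C * y powr (- \<theta>)" if y: "y > 0" for y
  proof -
    have "(1 + c1 * y)\<^sup>2 \<le> ((1 + c1) * (1 + y))\<^sup>2"
      using assms y by (intro power_mono) (auto simp: algebra_simps)
    moreover have "y powr \<theta> \<le> (1 + y) powr \<theta>" using assms y by (intro powr_mono2) auto
    ultimately have "(1 + c1 * y)\<^sup>2 * y powr \<theta> \<le> ((1 + c1) * (1 + y))\<^sup>2 * (1 + y) powr \<theta>"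
      by (intro mult_mono) auto
    also have "\<dots> = (1 + c1)\<^sup>2 * (1 + y) powr (\<theta> + 2)"
      using y by (simp add: powr_add power_mult_distrib)
    also have "\<dots> \<le> (1 + c1)\<^sup>2 * (1 + y) ^ p"
      using p y by (intro mult_left_mono) (auto simp: powr_realpow[symmetric] intro!: powr_mono)
    also have "(1 + y) ^ p \<le> real p ^ p * exp (c2 * (1 + y)) / c2 ^ p"
    proof -
      have "(c2 * (1 + y) / real p) ^ p \<le> (1 + c2 * (1 + y) / real p) ^ p"
        using assms y by (intro power_mono) auto
      also have "\<dots> \<le> exp (c2 * (1 + y))"
        using exp_ge_one_plus_x_over_n_power_n[of p "c2 * (1 + y)"] assms y p0
        by (simp add: order_trans[of "- real p" 0])
      finally have "c2 ^ p * (1 + y) ^ p \<le> real p ^ p * exp (c2 * (1 + y))"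
        using p0 by (simp only: power_divide power_mult_distrib) (simp add: field_simps)
      then show ?thesis using assms by (simp add: field_simps)
    qed
    finally have "(1 + c1 * y)\<^sup>2 * y powr \<theta> \<le> (1 + c1)\<^sup>2 * (real p ^ p * exp (c2 * (1 + y)) / c2 ^ p)"
      by (simp add: mult_left_mono)
    also have "\<dots> = C * exp (c2 * y)" by (simp add: C_def distrib_left exp_add)
    finally have "(1 + c1 * y)\<^sup>2 * y powr \<theta> \<le> C * exp (c2 * y)" .
    then show ?thesis
      using y assms by (simp add: powr_minus exp_minus field_simps)
  qed
  moreover have "C \<ge> 0" using assms by (simp add: C_def)
  ultimately show ?thesis by blast
qed

definition heat :: "real \<Rightarrow> real \<Rightarrow> distr \<Rightarrow> distr" where
  "heat \<mu> t f k = exp (of_real t * heat_symbol \<mu> k) * f k"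

text \<open>The factorisation over the coordinates makes the mixed difference of the heat symbol a
  product of two one-dimensional differences.\<close>

lemma heat_symbol_split:
  fixes \<mu> t :: real
  defines "z \<equiv> - (of_real (4 * pi\<^sup>2 * t) * (\<i> + of_real \<mu>))"
  shows "exp (of_real t * heat_symbol \<mu> (a, b)) =
    exp (- of_real t) * (exp (z * of_int (a\<^sup>2)) * exp (z * of_int (b\<^sup>2)))"
  unfolding mult_exp_exp z_def heat_symbol_def
  by (rule arg_cong[where f = exp]) (simp add: algebra_simps)

text \<open>The mean value inequality with (a + 1)^2 - a^2 = 2a + 1; the lower bound
  \<open>m\<close> on both squares keeps the decay.\<close>

lemma gauss_difference:
  fixes z :: complex
  assumes z: "Re z \<le> 0" and a: "\<bar>real_of_int (2 * a + 1)\<bar> \<le> K" and m: "m \<le> (of_int a)\<^sup>2" "m \<le> (of_int (a + 1))\<^sup>2"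
  shows "cmod (exp (z * of_int ((a + 1)\<^sup>2)) - exp (z * of_int (a\<^sup>2))) \<le> exp (Re z * m) * (cmod z * K)"
proof -
  have e: "z * of_int ((a + 1)\<^sup>2) - z * of_int (a\<^sup>2) = z * of_int (2 * a + 1)"
    by (simp add: power2_eq_square algebra_simps)
  have "cmod (exp (z * of_int ((a + 1)\<^sup>2)) - exp (z * of_int (a\<^sup>2))) \<le>
     max (exp (Re (z * of_int ((a + 1)\<^sup>2)))) (exp (Re (z * of_int (a\<^sup>2)))) * cmod (z * of_int (2 * a + 1))"
    using cmod_exp_diff_le[of "z * of_int ((a + 1)\<^sup>2)" "z * of_int (a\<^sup>2)"] unfolding e .
  also have "\<dots> \<le> exp (Re z * m) * (cmod z * K)"
  proof (intro mult_mono)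
    show "max (exp (Re (z * of_int ((a + 1)\<^sup>2)))) (exp (Re (z * of_int (a\<^sup>2)))) \<le> exp (Re z * m)"
      using mult_left_mono_neg[OF m(1) z] mult_left_mono_neg[OF m(2) z] by simp
    show "cmod (z * of_int (2 * a + 1)) \<le> cmod z * K"
      unfolding norm_mult norm_of_int using a by (intro mult_left_mono) auto
  qed auto
  finally show ?thesis .
qed

text \<open>One corner of a unit square in the ring keeps all four corners at comparable distance
  from the origin. From (x + i0)^2 \<le> 2 (x + i)^2 + 2 half of (3/8)^2 = 9/64 survives, with a
  loss of 1 per coordinate.\<close>

lemma Ring_corner:
  assumes "i0 \<in> {0, 1}" "j0 \<in> {0, 1}" "(a + i0, b + j0) \<in> Ring n" "i \<in> {0, 1}" "j \<in> {0, 1}"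
  shows "9 / 128 * 4 ^ n - 2 \<le> (real_of_int (a + i))\<^sup>2 + (real_of_int (b + j))\<^sup>2"
    and "\<bar>real_of_int (2 * a + 1)\<bar> \<le> 6 * 2 ^ n" and "\<bar>real_of_int (2 * b + 1)\<bar> \<le> 6 * 2 ^ n"
proof -
  let ?k = "(a + i0, b + j0)"
  have up: "norm (freq ?k) \<le> 4 / 3 * 2 ^ n" using assms(3) by (simp add: Ring_def)
  have sq: "(x + i)\<^sup>2 \<ge> (x + i0)\<^sup>2 / 2 - 1" if "i \<in> {0, 1}" "i0 \<in> {0, 1}" for x i i0 :: real
  proof -
    have "(x + i0)\<^sup>2 \<le> 2 * (x + i)\<^sup>2 + 2 * (i0 - i)\<^sup>2"
      using zero_le_power2[of "x + i - (i0 - i)"] by (simp add: power2_eq_square algebra_simps)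
    moreover have "(i0 - i)\<^sup>2 \<le> 1" using that by auto
    ultimately show ?thesis by linarith
  qed

  show "9 / 128 * 4 ^ n - 2 \<le> (real_of_int (a + i))\<^sup>2 + (real_of_int (b + j))\<^sup>2"
  proof (cases "n = 0")
    case False
    then have "(3 / 8 * 2 ^ n)\<^sup>2 \<le> (norm (freq ?k))\<^sup>2"
      using assms(3) by (intro power_mono) (auto simp: Ring_def)
    moreover have "(3 / 8 * 2 ^ n :: real)\<^sup>2 = 9 / 64 * 4 ^ n"
      by (simp add: power2_eq_square power_mult_distrib[symmetric])
    ultimately show ?thesis
      using sq[of "of_int i" "of_int i0" "of_int a"] sq[of "of_int j" "of_int j0" "of_int b"] assms(1,2,4,5)
      unfolding norm_freq_sq by auto
  next
    case True
    have "0 \<le> (real_of_int (a + i))\<^sup>2 + (real_of_int (b + j))\<^sup>2" by simp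
    then have "9 / 128 - 2 \<le> (real_of_int (a + i))\<^sup>2 + (real_of_int (b + j))\<^sup>2" by linarith
    then show ?thesis using True by simp
  qed
  have n: "(1 :: real) \<le> 2 ^ n" by simp
  have i01: "0 \<le> real_of_int i0 \<and> real_of_int i0 \<le> 1" "0 \<le> real_of_int j0 \<and> real_of_int j0 \<le> 1"
    using assms(1,2) by auto
  show "\<bar>real_of_int (2 * a + 1)\<bar> \<le> 6 * 2 ^ n"
    using order_trans[OF norm_freq_ge(1)[of ?k] up] n i01(1)
    unfolding fst_conv of_int_add of_int_mult of_int_1 of_int_numeral by linarith
  show "\<bar>real_of_int (2 * b + 1)\<bar> \<le> 6 * 2 ^ n"
    using order_trans[OF norm_freq_ge(2)[of ?k] up] n i01(2)
    unfolding snd_conv of_int_add of_int_mult of_int_1 of_int_numeral by linarith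
qed

text \<open>Each difference costs a factor |z| 2^n from the exponent and is multiplied by 2^n, so
  only |z| 4^n enters, to the power two at most.\<close>

lemma heat_symbol_bounds:
  fixes \<mu> t :: real and n :: nat
  defines "z \<equiv> - (of_real (4 * pi\<^sup>2 * t) * (\<i> + of_real \<mu>))"
  defines "G \<equiv> \<lambda>k. exp (of_real t * heat_symbol \<mu> k)"
  defines "A \<equiv> exp (Re z * (9 / 128 * 4 ^ n - 2)) * (1 + 6 * cmod z * 4 ^ n)\<^sup>2"
  assumes \<mu>: "\<mu> > 0" and t: "t \<ge> 0"
    and ij: "i0 \<in> {0, 1}" "j0 \<in> {0, 1}" "(a + i0, b + j0) \<in> Ring n"
  shows "cmod (G (a, b)) \<le> A \<and> 2 ^ n * cmod (G (a + 1, b) - G (a, b)) \<le> A \<and>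
    2 ^ n * cmod (G (a, b + 1) - G (a, b)) \<le> A \<and>
    (2 ^ n)\<^sup>2 * cmod (G (a + 1, b + 1) - G (a + 1, b) - G (a, b + 1) + G (a, b)) \<le> A"
proof -
  have z: "Re z \<le> 0" using \<mu> t by (simp add: z_def)
  define p where "p a = exp (z * of_int (a\<^sup>2))" for a
  define c where "c = exp (- complex_of_real t)"
  have c: "cmod c \<le> 1" using t by (simp add: c_def)
  have G: "G (a, b) = c * (p a * p b)" for a b
    unfolding G_def p_def c_def z_def by (rule heat_symbol_split)
  \<comment> \<open>The two minima are attained together at some corner of the square, so their sum
    inherits the lower bound for corners.\<close>
  define ma where "ma = min ((real_of_int a)\<^sup>2) ((real_of_int (a + 1))\<^sup>2)"
  define mb where "mb = min ((real_of_int b)\<^sup>2) ((real_of_int (b + 1))\<^sup>2)"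
  define L where "L = 9 / 128 * 4 ^ n - (2 :: real)"
  note corner = Ring_corner(1)[OF ij]
  have mab: "L \<le> ma + mb"
    using corner[of 0 0] corner[of 0 1] corner[of 1 0] corner[of 1 1]
    unfolding ma_def mb_def L_def min_def by auto
  have pa: "cmod (p a) \<le> exp (Re z * ma)" "cmod (p (a + 1)) \<le> exp (Re z * ma)"
    and pb: "cmod (p b) \<le> exp (Re z * mb)" "cmod (p (b + 1)) \<le> exp (Re z * mb)"
    unfolding p_def norm_exp_eq_Re
    using mult_left_mono_neg[OF _ z, of ma] mult_left_mono_neg[OF _ z, of mb] by (auto simp: ma_def mb_def)
  have K: "\<bar>real_of_int (2 * a + 1)\<bar> \<le> 6 * 2 ^ n" "\<bar>real_of_int (2 * b + 1)\<bar> \<le> 6 * 2 ^ n"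
    using Ring_corner(2,3)[OF ij, of 0 0] by auto
  have da: "cmod (p (a + 1) - p a) \<le> exp (Re z * ma) * (cmod z * (6 * 2 ^ n))"
    unfolding p_def by (rule gauss_difference[OF z K(1)]) (auto simp: ma_def)
  have db: "cmod (p (b + 1) - p b) \<le> exp (Re z * mb) * (cmod z * (6 * 2 ^ n))"
    unfolding p_def by (rule gauss_difference[OF z K(2)]) (auto simp: mb_def)
  define E where "E = exp (Re z * L)"
  have E: "exp (Re z * ma) * exp (Re z * mb) \<le> E"
    unfolding E_def mult_exp_exp using mult_left_mono_neg[OF mab z] by (simp add: algebra_simps)
  have E0: "0 < E" by (simp add: E_def)
  define y where "y = 6 * cmod z * 4 ^ n"
  have y: "0 \<le> y" by (simp add: y_def)
  have two: "(2 :: real) ^ n * 2 ^ n = 4 ^ n" by (simp add: power_mult_distrib[symmetric])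
  have y2: "2 ^ n * (cmod z * (6 * 2 ^ n)) = y" unfolding y_def two[symmetric] by simp
  have A: "A = E * (1 + y)\<^sup>2" by (simp add: A_def E_def L_def y_def)
  have le1: "E \<le> A" "E * y \<le> A" "E * y\<^sup>2 \<le> A"
    unfolding A using E0 y
    by (auto simp: power2_eq_square algebra_simps intro: add_nonneg_nonneg)
  have key: "cmod (c * (x * x')) \<le> E * (X * X')"
    if "cmod x \<le> exp (Re z * ma) * X" "cmod x' \<le> exp (Re z * mb) * X'" "0 \<le> X" "0 \<le> X'" for x x' X X'
  proof -
    have "cmod (c * (x * x')) \<le> 1 * ((exp (Re z * ma) * X) * (exp (Re z * mb) * X'))"
      unfolding norm_mult using c that by (intro mult_mono) auto
    also have "\<dots> = (exp (Re z * ma) * exp (Re z * mb)) * (X * X')" by simp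
    also have "\<dots> \<le> E * (X * X')" using E that by (intro mult_right_mono) auto
    finally show ?thesis .
  qed
  let ?w = "cmod z * (6 * 2 ^ n)"
  have 1: "cmod (G (a, b)) \<le> E" using key[of "p a" 1 "p b" 1] pa pb by (simp add: G)
  have 2: "2 ^ n * cmod (G (a + 1, b) - G (a, b)) \<le> E * y"
  proof -
    have "cmod (c * ((p (a + 1) - p a) * p b)) \<le> E * (?w * 1)" using da pb by (intro key) auto
    from mult_left_mono[OF this, of "2 ^ n"] show ?thesis unfolding y2[symmetric] by (simp add: G algebra_simps)
  qed
  have 3: "2 ^ n * cmod (G (a, b + 1) - G (a, b)) \<le> E * y"
  proof -
    have "cmod (c * (p a * (p (b + 1) - p b))) \<le> E * (1 * ?w)" using pa db by (intro key) auto
    from mult_left_mono[OF this, of "2 ^ n"] show ?thesis unfolding y2[symmetric] by (simp add: G algebra_simps)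
  qed
  have 4: "(2 ^ n)\<^sup>2 * cmod (G (a + 1, b + 1) - G (a + 1, b) - G (a, b + 1) + G (a, b)) \<le> E * y\<^sup>2"
  proof -
    have "cmod (c * ((p (a + 1) - p a) * (p (b + 1) - p b))) \<le> E * (?w * ?w)" using da db by (intro key) auto
    from mult_left_mono[OF this, of "(2 ^ n)\<^sup>2"] show ?thesis
      unfolding y2[symmetric] by (simp add: G algebra_simps power2_eq_square)
  qed
  show ?thesis using 1 2 3 4 le1 by linarith
qed

context lp
begin

text \<open>On block n the heat symbol has order zero with constant at most C (t 4^n)^(-\<theta>),
  where 2\<theta> = s1 - s0; the factor 4^(-n \<theta>) converts the weight of s0 into that of
  s1.\<close>

lemma bes_heat:
  assumes \<mu>: "\<mu> > 0" and s: "s0 \<le> s1"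
  shows "\<exists>C\<ge>0. \<forall>f F t. bes s0 f F \<and> 0 < t \<and> t \<le> 1 \<longrightarrow> bes s1 (heat \<mu> t f) (C * t powr (- (s1 - s0) / 2) * F)"
proof -
  define \<theta> where "\<theta> = (s1 - s0) / 2"
  define cz where "cz = 4 * pi\<^sup>2 * cmod (\<i> + of_real \<mu>)"
  define r where "r = 4 * pi\<^sup>2 * \<mu>"
  have r: "r > 0" using \<mu> by (simp add: r_def)
  obtain C where C: "C \<ge> 0" "\<And>y. y > 0 \<Longrightarrow> (1 + 6 * cz * y)\<^sup>2 * exp (- (r * 9 / 128) * y) \<le> C * y powr (- \<theta>)"
    using exp_decay_le_powr[of "6 * cz" "r * 9 / 128" \<theta>] r s by (auto simp: \<theta>_def cz_def)
  define C' where "C' = 165 * 2 powr \<bar>s0\<bar> * (4 * (4 * B)) * exp (2 * r) * C * 2 powr \<bar>s1 - s0\<bar>"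
  show ?thesis
  proof (intro exI[of _ C'] conjI allI impI)
    show "C' \<ge> 0" using C B0 by (simp add: C'_def)
    fix f F and t :: real assume a: "bes s0 f F \<and> 0 < t \<and> t \<le> 1"
    then have f: "bes s0 f F" and t: "0 < t" "t \<le> 1" by auto
    have F: "F \<ge> 0" using bes_nonneg[OF f] .
    show "bes s1 (heat \<mu> t f) (C' * t powr (- (s1 - s0) / 2) * F)"
      unfolding bes_def
    proof (intro allI)
      fix n x
      define z where "z = - (of_real (4 * pi\<^sup>2 * t) * (\<i> + of_real \<mu>))"
      define A where "A = exp (Re z * (9 / 128 * 4 ^ n - 2)) * (1 + 6 * cmod z * 4 ^ n)\<^sup>2"
      define y where "y = t * 4 ^ n"
      have y: "y > 0" using t by (simp add: y_def)
      have Rez: "Re z = - (r * t)" by (simp add: z_def r_def)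
      have cz: "cmod z * 4 ^ n = cz * y"
        unfolding z_def norm_minus_cancel norm_mult norm_of_real using t by (simp add: cz_def y_def)
      have A: "0 \<le> A" by (simp add: A_def)
      have "A \<le> exp (2 * r) * (C * y powr (- \<theta>))"
      proof -
        have "A = exp (2 * (r * t)) * ((1 + 6 * cz * y)\<^sup>2 * exp (- (r * 9 / 128) * y))"
        proof -
          have "exp (Re z * (9 / 128 * 4 ^ n - 2)) = exp (2 * (r * t)) * exp (- (r * 9 / 128) * y)"
            unfolding mult_exp_exp Rez y_def by (simp add: algebra_simps)
          moreover have "6 * cmod z * 4 ^ n = 6 * cz * y" using cz by simp
          ultimately show ?thesis unfolding A_def by (simp only: mult_ac)
        qed
        \<comment> \<open>The exponential prefactor stems from the loss of 2 in
          \<open>Ring_corner\<close> and is bounded because t \<le> 1.\<close>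
        also have "\<dots> \<le> exp (2 * r) * (C * y powr (- \<theta>))"
          by (intro mult_mono C y) (use r t in auto)
        finally show ?thesis .
      qed
      also have "y powr (- \<theta>) = t powr (- \<theta>) * 2 powr (- (s1 - s0) * real n)"
      proof -
        have "(4 :: real) ^ n = 2 powr (2 * real n)"
          using powr_realpow[of 2 "2 * n"] by (simp add: power_mult)
        moreover have "2 * real n * - \<theta> = - (s1 - s0) * real n" by (simp add: \<theta>_def field_simps)
        ultimately show ?thesis using t by (simp only: y_def powr_mult powr_powr)
      qed
      finally have A2: "A \<le> exp (2 * r) * (C * (t powr (- \<theta>) * 2 powr (- (s1 - s0) * real n)))" .
      let ?G = "\<lambda>k. exp (of_real t * heat_symbol \<mu> k)"
      have sy: "symb (2 ^ n) (4 * (4 * B * A)) (\<lambda>k. of_real (wt n k) * ?G k)"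
      proof (rule symb_mult[OF symb_wt _ _ A])
        fix a b assume "\<exists>i\<in>{0, 1}. \<exists>j\<in>{0, 1}. complex_of_real (wt n (a + i, b + j)) \<noteq> 0"
        then obtain i j where ij: "i \<in> {0, 1}" "j \<in> {0, 1}" "(a + i, b + j) \<in> Ring n"
          using wt_Ring by force
        show "cmod (?G (a, b)) \<le> A \<and> 2 ^ n * cmod (?G (a + 1, b) - ?G (a, b)) \<le> A \<and>
          2 ^ n * cmod (?G (a, b + 1) - ?G (a, b)) \<le> A \<and>
          (2 ^ n)\<^sup>2 * cmod (?G (a + 1, b + 1) - ?G (a + 1, b) - ?G (a, b + 1) + ?G (a, b)) \<le> A"
          unfolding A_def z_def by (rule heat_symbol_bounds[OF \<mu> _ ij]) (use t in simp)
      qed simp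
      have "tp (Bl n (heat \<mu> t f)) x = tp (\<lambda>k. (of_real (wt n k) * ?G k) * f k) x"
        unfolding Bl_def heat_def by (simp only: mult.assoc)
      also have "cmod \<dots> \<le> 165 * 2 powr \<bar>s0\<bar> * (4 * (4 * B * A)) * F * blk s0 n"
        by (rule ring_multiplier[OF _ sy f]) (use wt_Ring in auto)
      also have "\<dots> \<le> 165 * 2 powr \<bar>s0\<bar> * (4 * (4 * B * (exp (2 * r) * (C * (t powr (- \<theta>) * 2 powr (- (s1 - s0) * real n)))))) * F * blk s0 n"
        using B0 F by (intro mult_right_mono mult_left_mono A2) auto
      also have "\<dots> = 165 * 2 powr \<bar>s0\<bar> * (4 * (4 * B)) * exp (2 * r) * C * t powr (- \<theta>) * F *
          (2 powr (- (s1 - s0) * real n) * blk s0 n)"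
        by (simp add: mult_ac)
      also have "\<dots> \<le> 165 * 2 powr \<bar>s0\<bar> * (4 * (4 * B)) * exp (2 * r) * C * t powr (- \<theta>) * F *
          (2 powr \<bar>s1 - s0\<bar> * blk s1 n)"
      proof (intro mult_left_mono)
        show "2 powr (- (s1 - s0) * real n) * blk s0 n \<le> 2 powr \<bar>s1 - s0\<bar> * blk s1 n"
          unfolding powr_add[symmetric] using s by (simp add: algebra_simps)
      qed (use B0 F C in auto)
      finally show "cmod (tp (Bl n (heat \<mu> t f)) x) \<le> C' * t powr (- (s1 - s0) / 2) * F * blk s1 n"
        by (simp add: C'_def \<theta>_def mult_ac minus_divide_left)
    qed
  qed
qed

end

section \<open>Products of distributions\<close>

definition conv :: "distr \<Rightarrow> distr \<Rightarrow> distr" where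
  "conv p q k = (\<Sum>l | p l \<noteq> 0. p l * q (k - l))"

lemma conv_eq:
  assumes "finite S" "\<And>l. l \<notin> S \<Longrightarrow> p l = 0"
  shows "conv p q k = (\<Sum>l\<in>S. p l * q (k - l))"
  unfolding conv_def by (rule sum.mono_neutral_left) (use assms in auto)

lemma fin_supp_conv:
  assumes "fin_supp p" "fin_supp q" shows "fin_supp (conv p q)"
proof (rule fin_suppI)
  show "finite ((\<lambda>(l, j). l + j) ` ({k. p k \<noteq> 0} \<times> {k. q k \<noteq> 0}))"
    using assms by (auto simp: fin_supp_def)
  fix k assume k: "k \<notin> (\<lambda>(l, j). l + j) ` ({k. p k \<noteq> 0} \<times> {k. q k \<noteq> 0})"
  have "q (k - l) = 0" if "p l \<noteq> 0" for l
  proof (rule ccontr)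
    assume "q (k - l) \<noteq> 0"
    then have "(l, k - l) \<in> {k. p k \<noteq> 0} \<times> {k. q k \<noteq> 0}" using that by simp
    from imageI[OF this, of "\<lambda>(l, j). l + j"] k show False by simp
  qed
  then show "conv p q k = 0" unfolding conv_def by (intro sum.neutral) auto
qed

lemma tp_cmult:
  assumes "fin_supp f" shows "tp (\<lambda>k. c * f k) x = c * tp f x"
  unfolding tp_def[of f] sum_distrib_left mult.assoc[symmetric]
  by (rule tp_eq) (use assms in \<open>auto simp: fin_supp_def\<close>)

lemma tp_conv:
  assumes "fin_supp p" "fin_supp q"
  shows "tp (conv p q) x = tp p x * tp q x"
proof -
  have s: "fin_supp (\<lambda>k. p l * q (k - l))" for l
    by (intro fin_supp_mult fin_supp_shift assms)
  have "tp (conv p q) x = (\<Sum>l | p l \<noteq> 0. tp (\<lambda>k. p l * q (k - l)) x)"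
    unfolding conv_def[abs_def] by (rule tp_sum[OF assms(1)[unfolded fin_supp_def] s])
  also have "\<dots> = (\<Sum>l | p l \<noteq> 0. p l * (fourier_mode l x * tp q x))"
  proof (intro sum.cong refl)
    fix l
    have f: "fin_supp (\<lambda>k. q (k - l))" by (rule fin_supp_shift[OF assms(2)])
    have "tp (\<lambda>k. p l * q (k - l)) x = p l * tp (\<lambda>k. q (k - l)) x"
      by (rule tp_cmult[OF f])
    then show "tp (\<lambda>k. p l * q (k - l)) x = p l * (fourier_mode l x * tp q x)"
      by (simp add: tp_shift[OF assms(2)])
  qed
  also have "\<dots> = tp p x * tp q x" by (simp add: tp_def[of p] sum_distrib_right mult.assoc)
  finally show ?thesis .
qed

text \<open>Frequency \<open>n\<close> of the product of blocks \<open>i\<close> and \<open>j\<close> vanishes unless \<open>compat n i j\<close>; this is all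
  that is needed of Bony's decomposition.\<close>

definition compat :: "nat \<Rightarrow> nat \<Rightarrow> nat \<Rightarrow> bool" where
  "compat n i j \<longleftrightarrow> (j \<le> n + 4 \<or> j \<le> i + 3) \<and> (n \<le> i + 4 \<or> n \<le> j + 4)"

text \<open>The triangle inequality for k = l + (k - l). If an index exceeds the others too far, the
  left sides add up to at most 4/3 (1/32 + 1/16) = 1/8 of its scale, below 3/8.\<close>

lemma Ring_compat:
  assumes "k \<in> Ring n" "l \<in> Ring i" "k - l \<in> Ring j"
  shows "compat n i j"
proof -
  have tri: "norm (freq k) \<le> norm (freq l) + norm (freq (k - l))"
    "norm (freq (k - l)) \<le> norm (freq k) + norm (freq l)"
  proof -
    have e: "freq (k - l) = freq k - freq l" by (simp add: freq_def)
    show "norm (freq k) \<le> norm (freq l) + norm (freq (k - l))"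
      unfolding e using norm_triangle_sub by blast
    show "norm (freq (k - l)) \<le> norm (freq k) + norm (freq l)"
      unfolding e by (rule norm_triangle_ineq4)
  qed
  have p: "c * (2 :: real) ^ a \<le> 2 ^ b" if "a + e \<le> b" "c = 2 ^ e" for a b e :: nat and c :: real
    using power_increasing[OF that(1), of "2 :: real"] that(2) by (simp add: power_add mult.commute)
  have "j \<le> n + 4 \<or> j \<le> i + 3"
  proof (rule ccontr)
    assume "\<not> ?thesis"
    then have "32 * (2 :: real) ^ n \<le> 2 ^ j" "16 * (2 :: real) ^ i \<le> 2 ^ j" "j \<ge> 1"
      by (auto intro!: p[of n 5] p[of i 4])
    moreover have "(0 :: real) < 2 ^ j" by simp
    moreover have "norm (freq k) \<le> 4 / 3 * 2 ^ n" "norm (freq l) \<le> 4 / 3 * 2 ^ i"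
      "j \<ge> 1 \<Longrightarrow> 3 / 8 * 2 ^ j \<le> norm (freq (k - l))"
      using assms by (auto simp: Ring_def)
    ultimately show False using tri(2) by linarith
  qed
  moreover have "n \<le> i + 4 \<or> n \<le> j + 4"
  proof (rule ccontr)
    assume "\<not> ?thesis"
    then have "32 * (2 :: real) ^ i \<le> 2 ^ n" "32 * (2 :: real) ^ j \<le> 2 ^ n" "n \<ge> 1"
      by (auto intro!: p[of i 5] p[of j 5])
    moreover have "(0 :: real) < 2 ^ n" by simp
    moreover have "norm (freq (k - l)) \<le> 4 / 3 * 2 ^ j" "norm (freq l) \<le> 4 / 3 * 2 ^ i"
      "n \<ge> 1 \<Longrightarrow> 3 / 8 * 2 ^ n \<le> norm (freq k)"
      using assms by (auto simp: Ring_def)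
    ultimately show False using tri(1) by linarith
  qed
  ultimately show ?thesis by (simp add: compat_def)
qed

lemma geometric_sum_le:
  assumes "0 < r" "r < (1 :: real)"
  shows "(\<Sum>i\<le>N. r ^ i) \<le> 1 / (1 - r)"
  using sum_le_suminf[OF summable_geometric, of r "{..N}"] suminf_geometric[of r] assms by simp

lemma geometric_tail_le:
  assumes "0 < r" "r < (1 :: real)"
  shows "(\<Sum>i\<le>N. if n \<le> i + 4 then r ^ i else 0) \<le> 1 / (r ^ 4 * (1 - r)) * r ^ n"
proof -
  \<comment> \<open>The factor r^4 shifts exponents so that i + 4 - n is a genuine natural
    number.\<close>
  have "r ^ 4 * (\<Sum>i\<le>N. if n \<le> i + 4 then r ^ i else 0) = (\<Sum>i\<le>N. if n \<le> i + 4 then r ^ (i + 4) else 0)"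
    unfolding sum_distrib_left by (intro sum.cong) (auto simp: power_add)
  also have "\<dots> = (\<Sum>i\<in>{i. i \<le> N \<and> n \<le> i + 4}. r ^ n * r ^ (i + 4 - n))"
  proof -
    have "r ^ n * r ^ (i + 4 - n) = r ^ (i + 4)" if "n \<le> i + 4" for i
      using that by (simp add: power_add[symmetric])
    then show ?thesis by (simp add: sum.If_cases Collect_conj_eq atMost_def)
  qed
  also have "\<dots> = r ^ n * (\<Sum>j\<in>(\<lambda>i. i + 4 - n) ` {i. i \<le> N \<and> n \<le> i + 4}. r ^ j)"
    by (subst sum.reindex) (auto simp: inj_on_def sum_distrib_left)
  also have "\<dots> \<le> r ^ n * (\<Sum>j\<le>N + 4. r ^ j)"
    using assms by (intro mult_left_mono sum_mono2) auto
  also have "\<dots> \<le> r ^ n * (1 / (1 - r))"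
    using assms by (intro mult_left_mono geometric_sum_le) auto
  finally show ?thesis using assms by (simp add: field_simps)
qed

lemma geometric_growth_le:
  assumes "1 < (R :: real)"
  shows "(\<Sum>j\<le>N. if j \<le> p then R ^ j else 0) \<le> R / (R - 1) * R ^ p"
proof -
  have "(\<Sum>j\<le>N. if j \<le> p then R ^ j else 0) \<le> (\<Sum>j\<le>p. R ^ j)"
    using assms by (subst sum.If_cases) (auto intro!: sum_mono2)
  also have "\<dots> = (R ^ Suc p - 1) / (R - 1)"
    using geometric_sum[of R "Suc p"] assms by (simp add: lessThan_Suc_atMost)
  also have "\<dots> \<le> R / (R - 1) * R ^ p" using assms by (simp add: field_simps)
  finally show ?thesis .
qed

text \<open>Both factors have positive regularity: one of i, j is at least n - 4 and supplies r^n,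
  the other is summed freely.\<close>

lemma compat_sum_pos:
  assumes r: "0 < r" "r < (1 :: real)"
  shows "(\<Sum>i\<le>N. \<Sum>j\<le>N. if compat n i j then r ^ i * r ^ j else 0) \<le> 2 / (r ^ 4 * (1 - r)\<^sup>2) * r ^ n"
proof -
  let ?t = "\<lambda>i. if n \<le> i + 4 then r ^ i else 0"
  have "(\<Sum>i\<le>N. \<Sum>j\<le>N. if compat n i j then r ^ i * r ^ j else 0) \<le>
      (\<Sum>i\<le>N. \<Sum>j\<le>N. ?t i * r ^ j + r ^ i * ?t j)"
    by (intro sum_mono) (use r in \<open>auto simp: compat_def\<close>)
  also have "\<dots> = (\<Sum>i\<le>N. ?t i) * (\<Sum>j\<le>N. r ^ j) + (\<Sum>i\<le>N. r ^ i) * (\<Sum>j\<le>N. ?t j)"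
    by (simp only: sum.distrib sum_product)
  also have "\<dots> \<le> (1 / (r ^ 4 * (1 - r)) * r ^ n) * (1 / (1 - r)) + (1 / (1 - r)) * (1 / (r ^ 4 * (1 - r)) * r ^ n)"
    using r by (intro add_mono mult_mono geometric_sum_le geometric_tail_le sum_nonneg) auto
  also have "\<dots> = 2 / (r ^ 4 * (1 - r)\<^sup>2) * r ^ n" using r by (simp add: field_simps power2_eq_square)
  finally show ?thesis .
qed

text \<open>Here R > 1 encodes negative regularity of the second factor. Either j \<le> n + 4, and
  the growth stops at R^n, or j \<le> i + 3, and r R < 1, that is \<alpha> < \<beta>, makes the sum
  over i converge.\<close>

lemma compat_sum_neg:
  assumes r: "0 < r" "r < (1 :: real)" and R: "1 < R" "r * R < 1"
  shows "(\<Sum>i\<le>N. \<Sum>j\<le>N. if compat n i j then r ^ i * R ^ j else 0) \<le>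
    (1 / (1 - r) * (R / (R - 1) * R ^ 4) + R / (R - 1) * R ^ 3 * (1 / (1 - r * R))) * R ^ n"
proof -
  have rR: "0 < r * R" using r R by simp
  have "(\<Sum>i\<le>N. \<Sum>j\<le>N. if compat n i j then r ^ i * R ^ j else 0) \<le>
      (\<Sum>i\<le>N. \<Sum>j\<le>N. r ^ i * (if j \<le> n + 4 then R ^ j else 0) + r ^ i * (if j \<le> i + 3 then R ^ j else 0))"
    by (intro sum_mono) (use r R in \<open>auto simp: compat_def\<close>)
  also have "\<dots> = (\<Sum>i\<le>N. r ^ i) * (\<Sum>j\<le>N. if j \<le> n + 4 then R ^ j else 0) +
      (\<Sum>i\<le>N. r ^ i * (\<Sum>j\<le>N. if j \<le> i + 3 then R ^ j else 0))"
    by (subst sum_product) (simp only: sum.distrib sum_distrib_left)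
  also have "\<dots> \<le> 1 / (1 - r) * (R / (R - 1) * R ^ (n + 4)) + (\<Sum>i\<le>N. r ^ i * (R / (R - 1) * R ^ (i + 3)))"
  proof (rule add_mono)
    show "(\<Sum>i\<le>N. r ^ i) * (\<Sum>j\<le>N. if j \<le> n + 4 then R ^ j else 0) \<le> 1 / (1 - r) * (R / (R - 1) * R ^ (n + 4))"
      by (rule mult_mono[OF geometric_sum_le[OF r] geometric_growth_le[OF R(1)]])
         (use r R in \<open>auto intro!: sum_nonneg\<close>)
    show "(\<Sum>i\<le>N. r ^ i * (\<Sum>j\<le>N. if j \<le> i + 3 then R ^ j else 0)) \<le> (\<Sum>i\<le>N. r ^ i * (R / (R - 1) * R ^ (i + 3)))"
      using r by (intro sum_mono mult_left_mono geometric_growth_le[OF R(1)]) auto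
  qed
  also have "(\<Sum>i\<le>N. r ^ i * (R / (R - 1) * R ^ (i + 3))) = R / (R - 1) * R ^ 3 * (\<Sum>i\<le>N. (r * R) ^ i)"
    unfolding sum_distrib_left by (intro sum.cong refl) (simp add: power_add power_mult_distrib)
  also have "\<dots> \<le> R / (R - 1) * R ^ 3 * (1 / (1 - r * R)) * R ^ n"
  proof -
    have "(\<Sum>i\<le>N. (r * R) ^ i) \<le> 1 / (1 - r * R) * 1"
      using geometric_sum_le[OF rR R(2)] by simp
    also have "\<dots> \<le> 1 / (1 - r * R) * R ^ n" using R by (intro mult_left_mono one_le_power) auto
    finally show ?thesis unfolding mult.assoc using R by (intro mult_left_mono) (auto simp: mult.assoc)
  qed
  finally show ?thesis by (simp add: algebra_simps power_add)
qed

lemma filterlim_squares: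
  "filterlim (\<lambda>N :: nat. {..N} \<times> {..N}) (finite_subsets_at_top UNIV) sequentially"
  unfolding filterlim_finite_subsets_at_top
proof (intro allI impI)
  fix X :: "(nat \<times> nat) set" assume "finite X \<and> X \<subseteq> UNIV"
  then have X: "finite X" by simp
  define N0 where "N0 = Max (insert 0 ((\<lambda>(i, j). i + j) ` X))"
  have "i + j \<le> N0" if "(i, j) \<in> X" for i j
    unfolding N0_def by (rule Max_ge) (use X that in force)+
  then have X2: "X \<subseteq> {..N} \<times> {..N}" if "N \<ge> N0" for N
    using that by (force dest: order_trans)
  show "\<forall>\<^sub>F N in sequentially. finite ({..N} \<times> {..N}) \<and> X \<subseteq> {..N} \<times> {..N} \<and> {..N} \<times> {..N} \<subseteq> UNIV"
    using eventually_ge_at_top[of N0] by eventually_elim (use X2 in auto)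
qed

text \<open>A uniform bound on squares gives absolute summability over pairs; the squares are
  cofinal among finite sets, and they are the truncation in \<open>dprod\<close>.\<close>

lemma convergent_square_sums:
  fixes a :: "nat \<Rightarrow> nat \<Rightarrow> complex"
  assumes "\<And>N. (\<Sum>i\<le>N. \<Sum>j\<le>N. cmod (a i j)) \<le> H"
  shows "convergent (\<lambda>N. \<Sum>i\<le>N. \<Sum>j\<le>N. a i j)"
proof -
  have "(\<lambda>x. norm (case x of (i, j) \<Rightarrow> a i j)) summable_on UNIV"
  proof (rule nonneg_bdd_above_summable_on)
    show "bdd_above (sum (\<lambda>x. norm (case x of (i, j) \<Rightarrow> a i j)) ` {F. F \<subseteq> UNIV \<and> finite F})"
    proof (rule bdd_aboveI2)
      fix F :: "(nat \<times> nat) set" assume "F \<in> {F. F \<subseteq> UNIV \<and> finite F}"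
      then have F: "finite F" by simp
      define N where "N = Max (insert 0 ((\<lambda>(i, j). i + j) ` F))"
      have "i + j \<le> N" if "(i, j) \<in> F" for i j
        unfolding N_def by (rule Max_ge) (use F that in force)+
      then have "F \<subseteq> {..N} \<times> {..N}" by (force dest: order_trans)
      then have "sum (\<lambda>x. norm (case x of (i, j) \<Rightarrow> a i j)) F \<le> sum (\<lambda>x. norm (case x of (i, j) \<Rightarrow> a i j)) ({..N} \<times> {..N})"
        by (intro sum_mono2) auto
      also have "\<dots> \<le> H" using assms[of N] by (simp add: sum.cartesian_product case_prod_unfold)
      finally show "sum (\<lambda>x. norm (case x of (i, j) \<Rightarrow> a i j)) F \<le> H" .
    qed
  qed auto
  then have "(\<lambda>(i, j). a i j) summable_on UNIV" by (rule abs_summable_summable)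
  then obtain l where "((\<lambda>(i, j). a i j) has_sum l) UNIV" by (auto simp: summable_on_def)
  then have "(sum (\<lambda>(i, j). a i j) \<longlongrightarrow> l) (finite_subsets_at_top UNIV)" by (simp add: has_sum_def)
  from filterlim_compose[OF this filterlim_squares]
  have "(\<lambda>N. \<Sum>i\<le>N. \<Sum>j\<le>N. a i j) \<longlonglongrightarrow> l" by (simp add: sum.cartesian_product case_prod_unfold)
  then show ?thesis by (auto simp: convergent_def)
qed

definition dprod_partial :: "(real \<times> real \<Rightarrow> real) \<Rightarrow> (real \<times> real \<Rightarrow> real) \<Rightarrow> distr \<Rightarrow> distr \<Rightarrow> int \<times> int \<Rightarrow> nat \<Rightarrow> complex" where
  "dprod_partial chi \<rho> f g k N = (\<Sum>l\<in>fbox N.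
      of_real (lp_partial chi \<rho> N (freq l)) * f l *
      of_real (lp_partial chi \<rho> N (freq (fst k - fst l, snd k - snd l))) * g (fst k - fst l, snd k - snd l))"

text \<open>A \<open>lim\<close> has an unspecified value when the sequence diverges, so even
  additivity of \<open>dprod\<close> rests on this predicate.\<close>

definition dprod_conv :: "(real \<times> real \<Rightarrow> real) \<Rightarrow> (real \<times> real \<Rightarrow> real) \<Rightarrow> distr \<Rightarrow> distr \<Rightarrow> bool" where
  "dprod_conv chi \<rho> f g \<longleftrightarrow> (\<forall>k. dprod_partial chi \<rho> f g k \<longlonglongrightarrow> dprod chi \<rho> f g k)"

lemma dprod_eq_lim: "dprod chi \<rho> f g k = lim (dprod_partial chi \<rho> f g k)"
  unfolding dprod_def dprod_partial_def[abs_def] ..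

lemma dprod_diff:
  assumes "dprod_conv chi \<rho> f g" "dprod_conv chi \<rho> f' g'"
    and "\<And>k N. dprod_partial chi \<rho> h h' k N = dprod_partial chi \<rho> f g k N - dprod_partial chi \<rho> f' g' k N"
  shows "dprod chi \<rho> h h' = (\<lambda>k. dprod chi \<rho> f g k - dprod chi \<rho> f' g' k)"
proof
  fix k
  have "(\<lambda>N. dprod_partial chi \<rho> h h' k N) \<longlonglongrightarrow> dprod chi \<rho> f g k - dprod chi \<rho> f' g' k"
    using assms(1,2) unfolding dprod_conv_def assms(3) by (simp only: tendsto_diff)
  then show "dprod chi \<rho> h h' k = dprod chi \<rho> f g k - dprod chi \<rho> f' g' k"
    unfolding dprod_eq_lim[of chi \<rho> h] by (rule limI)
qed

lemma dprod_diff_left: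
  assumes "dprod_conv chi \<rho> f g" "dprod_conv chi \<rho> f' g"
  shows "dprod chi \<rho> (\<lambda>k. f k - f' k) g = (\<lambda>k. dprod chi \<rho> f g k - dprod chi \<rho> f' g k)"
  by (rule dprod_diff[OF assms]) (simp add: dprod_partial_def sum_subtractf[symmetric] algebra_simps)

lemma dprod_diff_right:
  assumes "dprod_conv chi \<rho> f g" "dprod_conv chi \<rho> f g'"
  shows "dprod chi \<rho> f (\<lambda>k. g k - g' k) = (\<lambda>k. dprod chi \<rho> f g k - dprod chi \<rho> f g' k)"
  by (rule dprod_diff[OF assms]) (simp add: dprod_partial_def sum_subtractf[symmetric] algebra_simps)

context lp
begin

lemma dprod_partial_eq:
  "dprod_partial chi \<rho> f g k N = (\<Sum>i\<le>N. \<Sum>j\<le>N. conv (Bl i f) (Bl j g) k)"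
proof -
  have c: "conv (Bl i f) (Bl j g) k = (\<Sum>l\<in>fbox N. Bl i f l * Bl j g (k - l))" if "i \<le> N" for i j
  proof (rule conv_eq)
    show "Bl i f l = 0" if "l \<notin> fbox N" for l
    proof -
      have "fbox i \<subseteq> fbox N" unfolding fbox_eq using \<open>i \<le> N\<close> by (intro bx_mono power_increasing) auto
      then show ?thesis using that wt_Ring[of i l] Ring_subset_fbox[of i] by (auto simp: Bl_def)
    qed
  qed simp
  have "dprod_partial chi \<rho> f g k N = (\<Sum>l\<in>fbox N. \<Sum>i\<le>N. \<Sum>j\<le>N. Bl i f l * Bl j g (k - l))"
    unfolding dprod_partial_def
  proof (intro sum.cong refl)
    fix l
    have e: "(fst k - fst l, snd k - snd l) = k - l" by (simp add: prod_eq_iff)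
    have "of_real (lp_partial chi \<rho> N (freq l)) * f l * of_real (lp_partial chi \<rho> N (freq (k - l))) * g (k - l)
       = (\<Sum>i\<le>N. Bl i f l) * (\<Sum>j\<le>N. Bl j g (k - l))"
      unfolding lp_partial_def Bl_def wt_def of_real_sum sum_distrib_right[symmetric]
      by (simp only: mult.assoc)
    then show "of_real (lp_partial chi \<rho> N (freq l)) * f l *
      of_real (lp_partial chi \<rho> N (freq (fst k - fst l, snd k - snd l))) * g (fst k - fst l, snd k - snd l) =
      (\<Sum>i\<le>N. \<Sum>j\<le>N. Bl i f l * Bl j g (k - l))"
      unfolding e by (simp add: sum_product)
  qed
  also have "\<dots> = (\<Sum>i\<le>N. \<Sum>j\<le>N. \<Sum>l\<in>fbox N. Bl i f l * Bl j g (k - l))"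
    by (subst sum.swap, intro sum.cong refl, subst sum.swap) simp
  also have "\<dots> = (\<Sum>i\<le>N. \<Sum>j\<le>N. conv (Bl i f) (Bl j g) k)"
    by (intro sum.cong refl) (simp add: c)
  finally show ?thesis .
qed

lemma conv_Bl_compat:
  assumes "wt n k \<noteq> 0" "conv (Bl i f) (Bl j g) k \<noteq> 0"
  shows "compat n i j"
proof -
  obtain l where "Bl i f l * Bl j g (k - l) \<noteq> 0"
    using assms(2) unfolding conv_def by (meson sum.neutral)
  then have "wt i l \<noteq> 0" "wt j (k - l) \<noteq> 0" by (auto simp: Bl_def)
  then show ?thesis using assms(1) by (intro Ring_compat[of k n l i j] wt_Ring)
qed

text \<open>Every k has positive weight in some block n, so only pairs compatible with that n
  contribute and H n bounds the double series; this gives convergence. The block bound uses 220 = 55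
  * 4 from the symbol of the block.\<close>

lemma dprod_abstract:
  assumes F: "\<And>i x. cmod (tp (Bl i f) x) \<le> F i" and G: "\<And>i x. cmod (tp (Bl i g) x) \<le> G i"
    and H: "\<And>n N. (\<Sum>i\<le>N. \<Sum>j\<le>N. if compat n i j then F i * G j else 0) \<le> H n"
  shows "dprod_conv chi \<rho> f g" and "cmod (tp (Bl n (dprod chi \<rho> f g)) x) \<le> 220 * B * H n"
proof -
  have F0: "F i \<ge> 0" and G0: "G i \<ge> 0" for i
    using F[of i 0] G[of i 0] norm_ge_zero order_trans by blast+
  let ?c = "\<lambda>i j. conv (Bl i f) (Bl j g)"
  have tpc: "cmod (tp (?c i j) x) \<le> F i * G j" for i j x
    unfolding tp_conv[OF fin_supp_Bl fin_supp_Bl] norm_mult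
    by (intro mult_mono F G F0) simp
  show conv: "dprod_conv chi \<rho> f g"
    unfolding dprod_conv_def
  proof
    fix k
    obtain n where n: "wt n k \<noteq> 0" using ex_wt_nonzero by blast
    have "convergent (\<lambda>N. \<Sum>i\<le>N. \<Sum>j\<le>N. ?c i j k)"
    proof (rule convergent_square_sums)
      fix N
      have "cmod (?c i j k) \<le> (if compat n i j then F i * G j else 0)" for i j
        using cmod_coeff_le[OF fin_supp_conv[OF fin_supp_Bl fin_supp_Bl] tpc, of i j k]
          conv_Bl_compat[OF n, of i f j g] by auto
      then have "(\<Sum>i\<le>N. \<Sum>j\<le>N. cmod (?c i j k)) \<le> (\<Sum>i\<le>N. \<Sum>j\<le>N. if compat n i j then F i * G j else 0)"
        by (intro sum_mono)
      then show "(\<Sum>i\<le>N. \<Sum>j\<le>N. cmod (?c i j k)) \<le> H n" using H order_trans by blast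
    qed
    then have "convergent (dprod_partial chi \<rho> f g k)" by (simp only: dprod_partial_eq[abs_def])
    then show "dprod_partial chi \<rho> f g k \<longlonglongrightarrow> dprod chi \<rho> f g k"
      unfolding dprod_eq_lim by (simp add: convergent_LIMSEQ_iff)
  qed
  have S: "finite (Ring n)" by (rule finite_subset[OF Ring_subset_fbox]) simp
  have tpB: "tp (Bl n h) x = (\<Sum>k\<in>Ring n. of_real (wt n k) * h k * fourier_mode k x)" for h
    by (subst tp_eq[OF S]) (use wt_Ring in \<open>auto simp: Bl_def\<close>)
  have lim: "(\<lambda>N. tp (Bl n (\<lambda>k. dprod_partial chi \<rho> f g k N)) x) \<longlonglongrightarrow> tp (Bl n (dprod chi \<rho> f g)) x"
    unfolding tpB using conv unfolding dprod_conv_def by (intro tendsto_intros) auto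
  have "cmod (tp (Bl n (\<lambda>k. dprod_partial chi \<rho> f g k N)) x) \<le> 220 * B * H n" for N
  proof -
    have "tp (Bl n (\<lambda>k. dprod_partial chi \<rho> f g k N)) x = (\<Sum>i\<le>N. \<Sum>j\<le>N. tp (Bl n (?c i j)) x)"
      unfolding dprod_partial_eq tpB
      by (simp add: sum_distrib_left sum_distrib_right)
         (subst sum.swap, intro sum.cong refl, subst sum.swap, rule refl)
    also have "cmod \<dots> \<le> (\<Sum>i\<le>N. \<Sum>j\<le>N. 220 * B * (if compat n i j then F i * G j else 0))"
    proof (intro sum_norm_le)
      fix i j
      show "cmod (tp (Bl n (?c i j)) x) \<le> 220 * B * (if compat n i j then F i * G j else 0)"
      proof (cases "compat n i j")
        case True
        have "cmod (tp (\<lambda>k. of_real (wt n k) * ?c i j k) x) \<le> 55 * (4 * B) * (F i * G j)"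
        proof (rule multiplier_sup_le[of "2 ^ n"])
          show "complex_of_real (wt n k) = 0" if "k \<notin> bx (2 * 2 ^ n - 1)" for k
            using that wt_Ring[of n k] Ring_subset_bx[of n] by (simp only: of_real_eq_0_iff) blast
        qed (use symb_wt[of n] in \<open>simp_all add: fin_supp_conv tpc\<close>)
        then show ?thesis using True by (simp add: Bl_def[abs_def])
      next
        case False
        then have "Bl n (?c i j) k = 0" for k using conv_Bl_compat[of n k i f j g] by (auto simp: Bl_def)
        then show ?thesis using False by (simp add: tp_def)
      qed
    qed
    also have "\<dots> = 220 * B * (\<Sum>i\<le>N. \<Sum>j\<le>N. if compat n i j then F i * G j else 0)"
      by (simp only: sum_distrib_left)
    also have "\<dots> \<le> 220 * B * H n" using B0 by (intro mult_left_mono H) auto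
    finally show ?thesis .
  qed
  then show "cmod (tp (Bl n (dprod chi \<rho> f g)) x) \<le> 220 * B * H n"
    using Lim_norm_ubound[OF _ lim] by simp
qed

lemma powr_block: "blk s n = 2 powr s * (2 powr (- s)) ^ n"
  by (simp add: powr_realpow[symmetric] powr_powr powr_add[symmetric] algebra_simps)

text \<open>The weights of \<beta> and s are geometric in the index with ratios r and R, so the two
  regularities of the second factor correspond to the two \<open>compat\<close> sums.\<close>

lemma dprod_bes:
  assumes ab: "0 < \<alpha>" "\<alpha> < \<beta>" and s: "s = \<beta> \<or> s = - \<alpha>"
  shows "\<exists>C\<ge>1. \<forall>f g F G. bes \<beta> f F \<and> bes s g G \<longrightarrow>
    bes s (dprod chi \<rho> f g) (C * F * G) \<and> dprod_conv chi \<rho> f g"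
proof -
  define r where "r = 2 powr (- \<beta>)"
  define R where "R = 2 powr (- s)"
  have r: "0 < r" "r < 1" using ab by (auto simp: r_def powr_less_one)
  obtain D where D: "\<And>n N. (\<Sum>i\<le>N. \<Sum>j\<le>N. if compat n i j then r ^ i * R ^ j else 0) \<le> D * R ^ n"
  proof (cases "s = \<beta>")
    case True
    then have "R = r" by (simp add: R_def r_def)
    show ?thesis unfolding \<open>R = r\<close> by (rule that[unfolded \<open>R = r\<close>], rule compat_sum_pos[OF r])
  next
    case False
    then have sa: "s = - \<alpha>" using s by simp
    have "1 < R" "r * R < 1" using ab by (auto simp: R_def r_def sa powr_add[symmetric] powr_less_one)
    from that compat_sum_neg[OF r this] show ?thesis .
  qed
  define C where "C = max 1 (220 * B * (2 powr \<beta> * D))"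
  show ?thesis
  proof (intro exI[of _ C] conjI allI impI)
    show "1 \<le> C" by (simp add: C_def)
    fix f g F G assume "bes \<beta> f F \<and> bes s g G"
    then have f: "bes \<beta> f F" and g: "bes s g G" by auto
    have F0: "0 \<le> F" and G0: "0 \<le> G" using bes_nonneg f g by auto
    define K where "K = F * G * (2 powr \<beta> * 2 powr s)"
    have H: "(\<Sum>i\<le>N. \<Sum>j\<le>N. if compat n i j then F * blk \<beta> i * (G * blk s j) else 0)
       \<le> K * (D * R ^ n)" for n N
    proof -
      have "(\<Sum>i\<le>N. \<Sum>j\<le>N. if compat n i j then F * blk \<beta> i * (G * blk s j) else 0)
        = K * (\<Sum>i\<le>N. \<Sum>j\<le>N. if compat n i j then r ^ i * R ^ j else 0)"
        unfolding sum_distrib_left powr_block r_def[symmetric] R_def[symmetric]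
        by (intro sum.cong refl) (auto simp: K_def mult_ac)
      also have "\<dots> \<le> K * (D * R ^ n)" using F0 G0 by (intro mult_left_mono D) (auto simp: K_def)
      finally show ?thesis .
    qed
    note P = dprod_abstract[of f "\<lambda>i. F * blk \<beta> i" g "\<lambda>j. G * blk s j",
        OF besD[OF f] besD[OF g] H]
    show "dprod_conv chi \<rho> f g" using P(1) .
    show "bes s (dprod chi \<rho> f g) (C * F * G)"
      unfolding bes_def
    proof (intro allI)
      fix n x
      have "cmod (tp (Bl n (dprod chi \<rho> f g)) x) \<le> 220 * B * (K * (D * R ^ n))" by (rule P(2))
      also have "\<dots> = (220 * B * (2 powr \<beta> * D)) * (F * G * blk s n)"
        unfolding powr_block R_def[symmetric] by (simp add: K_def mult_ac)
      also have "\<dots> \<le> C * (F * G * blk s n)"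
        using F0 G0 by (intro mult_right_mono) (auto simp: C_def)
      finally show "cmod (tp (Bl n (dprod chi \<rho> f g)) x) \<le> C * F * G * blk s n"
        by (simp add: mult.assoc)
    qed
  qed
qed

end

section \<open>Size and Lipschitz bounds for the nonlinearity\<close>

lemma dconj_diff: "dconj (\<lambda>k. f k - g k) = (\<lambda>k. dconj f k - dconj g k)"
  by (simp add: dconj_def fun_eq_iff)

definition Psi_term :: "(real \<times> real \<Rightarrow> real) \<Rightarrow> (real \<times> real \<Rightarrow> real) \<Rightarrow> nat \<Rightarrow> nat \<Rightarrow> distr \<Rightarrow> distr \<Rightarrow> distr" where
  "Psi_term chi \<rho> i j v z = dprod chi \<rho> (dprod chi \<rho> (dpow chi \<rho> v i) (dpow chi \<rho> (dconj v) j)) z"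

lemma Psi_eq:
  "Psi chi \<rho> m \<nu> \<tau> Z Zh t v = (\<lambda>k. - \<nu> * (\<Sum>i\<le>m + 1. \<Sum>j\<le>m. of_nat ((m + 1) choose i) * of_nat (m choose j) *
     Psi_term chi \<rho> i j v (Zx Z Zh (m + 1 - i) (m - j) t) k) + (\<tau> + 1) * (v k + Z t k))"
  by (simp add: Psi_def Psi_term_def fun_eq_iff)

context lp
begin

text \<open>Only block 0 sees the zero frequency; the constant compensates its weight 2^s when s is
  negative.\<close>

lemma bes_dunit: "bes s dunit (2 powr \<bar>s\<bar>)"
  unfolding bes_def
proof (intro allI)
  fix n x
  have "tp (Bl n dunit) x = of_real (wt n 0)"
    by (subst tp_eq[where S = "{0}"]) (auto simp: Bl_def dunit_def zero_prod_def)
  moreover have "wt n 0 \<le> 2 powr \<bar>s\<bar> * blk s n"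
  proof (cases "n = 0")
    case True
    have "wt n 0 \<le> 2 powr 0" using wt_le_1[of n 0] by simp
    also have "\<dots> \<le> 2 powr (\<bar>s\<bar> + s)" by (intro powr_mono) auto
    finally show ?thesis using True by (simp add: powr_add)
  next
    case False
    then have "0 \<notin> Ring n" by (simp add: Ring_def freq_def norm_prod_def not_le)
    then have "wt n 0 = 0" using wt_Ring by blast
    then show ?thesis by simp
  qed
  ultimately show "cmod (tp (Bl n dunit) x) \<le> 2 powr \<bar>s\<bar> * blk s n"
    using wt_nonneg[of n 0] by simp
qed

lemma dpow_bes:
  assumes P: "\<And>f g F G. bes \<beta> f F \<Longrightarrow> bes \<beta> g G \<Longrightarrow> bes \<beta> (dprod chi \<rho> f g) (C * F * G)"
    and v: "bes \<beta> v W"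
  shows "bes \<beta> (dpow chi \<rho> v i) (2 powr \<bar>\<beta>\<bar> * (C * W) ^ i)"
proof (induction i)
  case (Suc i)
  show ?case using P[OF v Suc.IH] by (simp add: mult_ac)
qed (simp add: bes_dunit)

text \<open>The identity fg - f'g' = (f - f')g + f'(g - g'). Differences are measured relative to F
  and G, so that the relative sizes a and b simply add.\<close>

lemma dprod_diff_bes:
  assumes P: "\<And>f g F G. bes \<beta> f F \<Longrightarrow> bes s g G \<Longrightarrow> bes s (dprod chi \<rho> f g) (C * F * G) \<and> dprod_conv chi \<rho> f g"
    and f: "bes \<beta> f F" "bes \<beta> f' F" "bes \<beta> (\<lambda>k. f k - f' k) (a * F)"
    and g: "bes s g G" "bes s g' G" "bes s (\<lambda>k. g k - g' k) (b * G)"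
  shows "bes s (\<lambda>k. dprod chi \<rho> f g k - dprod chi \<rho> f' g' k) ((a + b) * (C * F * G))"
proof -
  have "bes s (dprod chi \<rho> (\<lambda>k. f k - f' k) g) (C * (a * F) * G)"
    using P[OF f(3) g(1)] by blast
  moreover have "bes s (dprod chi \<rho> f' (\<lambda>k. g k - g' k)) (C * F * (b * G))"
    using P[OF f(2) g(3)] by blast
  ultimately have "bes s (\<lambda>k. dprod chi \<rho> (\<lambda>k. f k - f' k) g k + dprod chi \<rho> f' (\<lambda>k. g k - g' k) k)
      (C * (a * F) * G + C * F * (b * G))" by (rule bes_add)
  moreover have "dprod chi \<rho> (\<lambda>k. f k - f' k) g k + dprod chi \<rho> f' (\<lambda>k. g k - g' k) k =
      dprod chi \<rho> f g k - dprod chi \<rho> f' g' k" for k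
    using P f g by (simp add: dprod_diff_left[of chi \<rho> f g f'] dprod_diff_right[of chi \<rho> f' g g'])
  ultimately have "bes s (\<lambda>k. dprod chi \<rho> f g k - dprod chi \<rho> f' g' k) (C * (a * F) * G + C * F * (b * G))"
    by (simp only:)
  then show ?thesis by (simp add: algebra_simps)
qed

lemma dpow_diff_bes:
  assumes P: "\<And>f g F G. bes \<beta> f F \<Longrightarrow> bes \<beta> g G \<Longrightarrow> bes \<beta> (dprod chi \<rho> f g) (C * F * G) \<and> dprod_conv chi \<rho> f g"
    and v: "bes \<beta> v W" "bes \<beta> w W" "bes \<beta> (\<lambda>k. v k - w k) (\<delta> * W)"
  shows "bes \<beta> (\<lambda>k. dpow chi \<rho> v i k - dpow chi \<rho> w i k) (real i * \<delta> * (2 powr \<bar>\<beta>\<bar> * (C * W) ^ i))"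
proof (induction i)
  case (Suc i)
  have "bes \<beta> (\<lambda>k. dprod chi \<rho> v (dpow chi \<rho> v i) k - dprod chi \<rho> w (dpow chi \<rho> w i) k)
     ((\<delta> + real i * \<delta>) * (C * W * (2 powr \<bar>\<beta>\<bar> * (C * W) ^ i)))"
    by (rule dprod_diff_bes[OF P v dpow_bes[OF _ v(1)] dpow_bes[OF _ v(2)] Suc.IH]) (use P in blast)+
  then show ?case by (simp add: algebra_simps)
qed (simp add: bes_zero)

text \<open>The noise is charged K W^p, so every summand has degree q = i + j + p in W and one
  constant serves all. The factor q + 1 in D covers both the plain bound and the i + j differences
  of the Lipschitz bound.\<close>

lemma Psi_term_bes:
  assumes P: "\<And>f g F G. bes \<beta> f F \<Longrightarrow> bes \<beta> g G \<Longrightarrow> bes \<beta> (dprod chi \<rho> f g) (C * F * G) \<and> dprod_conv chi \<rho> f g"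
    and P': "\<And>f g F G. bes \<beta> f F \<Longrightarrow> bes s g G \<Longrightarrow> bes s (dprod chi \<rho> f g) (C' * F * G) \<and> dprod_conv chi \<rho> f g"
    and C: "C \<ge> 1" "C' \<ge> 1" and c: "c = max 1 (165 * 2 powr \<bar>\<beta>\<bar> * (4 * B))"
    and W: "W \<ge> 1" and K: "K \<ge> 1" and \<delta>: "\<delta> \<ge> 0"
    and v: "bes \<beta> v W" and z: "bes s z (K * W ^ p)" and ij: "i + j + p = q"
  defines "D \<equiv> C' * C * (2 powr \<bar>\<beta>\<bar>)\<^sup>2 * (C * c) ^ q * (q + 1)"
  shows "bes s (Psi_term chi \<rho> i j v z) (D * K * W ^ q)"
    and "bes \<beta> w W \<Longrightarrow> bes \<beta> (\<lambda>k. v k - w k) (\<delta> * W) \<Longrightarrow>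
      bes s (\<lambda>k. Psi_term chi \<rho> i j v z k - Psi_term chi \<rho> i j w z k) (D * K * \<delta> * W ^ q)"
proof -
  have c1: "c \<ge> 1" by (simp add: c)
  have cW: "W \<le> c * W" using c1 W by simp
  have up: "bes \<beta> f (c * F)" if "bes \<beta> f F" for f F
    by (rule bes_mono[OF that]) (use bes_nonneg[OF that] c1 in \<open>simp add: mult_le_cancel_right1\<close>)
  have cj: "bes \<beta> (dconj f) (c * F)" if "bes \<beta> f F" for f F
    by (rule bes_mono[OF bes_dconj[OF that]]) (use bes_nonneg[OF that] in \<open>simp add: c mult_right_mono\<close>)
  \<comment> \<open>Enlarging by the cost c of conjugation gives \<open>v\<close> and its conjugate
    the same bound.\<close>
  define W' where "W' = c * W"
  define E where "E i = 2 powr \<bar>\<beta>\<bar> * (C * W') ^ i" for i :: nat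
  have pw: "bes \<beta> (dpow chi \<rho> f i) (E i)" if "bes \<beta> f W'" for f i
    unfolding E_def by (rule dpow_bes[OF _ that]) (use P in blast)
  have Q: "bes \<beta> (dprod chi \<rho> (dpow chi \<rho> f i) (dpow chi \<rho> (dconj f) j)) (C * E i * E j)" if "bes \<beta> f W" for f
    using P[OF pw pw] up[OF that] cj[OF that] by (auto simp: W'_def)
  have G: "C' * (C * E i * E j) * (K * W ^ p) * (real i + real j) \<le> D * K * W ^ q"
    "C' * (C * E i * E j) * (K * W ^ p) \<le> D * K * W ^ q"
  proof -
    let ?X = "C' * C * (2 powr \<bar>\<beta>\<bar>)\<^sup>2 * (C * c) ^ (i + j) * K * W ^ q"
    have e: "C' * (C * E i * E j) * (K * W ^ p) = ?X"
      by (simp add: E_def W'_def ij[symmetric] power_add power_mult_distrib power2_eq_square mult_ac)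
    have le: "?X * r \<le> D * K * W ^ q" if "r \<le> real (q + 1)" "0 \<le> r" for r
    proof -
      have "(C * c) ^ (i + j) \<le> (C * c) ^ q"
        using mult_mono[of 1 C 1 c] C(1) c1 ij by (intro power_increasing) auto
      then have "C' * C * (2 powr \<bar>\<beta>\<bar>)\<^sup>2 * (C * c) ^ (i + j) * K * W ^ q * r \<le>
         C' * C * (2 powr \<bar>\<beta>\<bar>)\<^sup>2 * (C * c) ^ q * K * W ^ q * real (q + 1)"
        using that C W K c1 by (intro mult_mono mult_nonneg_nonneg) auto
      then show ?thesis by (simp add: D_def mult_ac)
    qed
    show "C' * (C * E i * E j) * (K * W ^ p) * (real i + real j) \<le> D * K * W ^ q"
      unfolding e by (rule le) (use ij in auto)
    show "C' * (C * E i * E j) * (K * W ^ p) \<le> D * K * W ^ q"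
      using le[of 1] unfolding e by simp
  qed
  show "bes s (Psi_term chi \<rho> i j v z) (D * K * W ^ q)"
    unfolding Psi_term_def using bes_mono[OF _ G(2)] P'[OF Q[OF v] z] by blast
  show "bes s (\<lambda>k. Psi_term chi \<rho> i j v z k - Psi_term chi \<rho> i j w z k) (D * K * \<delta> * W ^ q)"
    if w: "bes \<beta> w W" and d: "bes \<beta> (\<lambda>k. v k - w k) (\<delta> * W)"
  proof -
    have d1: "bes \<beta> (\<lambda>k. v k - w k) (\<delta> * W')" using up[OF d] by (simp add: W'_def mult_ac)
    have d2: "bes \<beta> (\<lambda>k. dconj v k - dconj w k) (\<delta> * W')"
      using cj[OF d] unfolding dconj_diff by (simp add: W'_def mult_ac)
    have vW: "bes \<beta> v W'" "bes \<beta> w W'" "bes \<beta> (dconj v) W'" "bes \<beta> (dconj w) W'"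
      using up cj v w by (auto simp: W'_def)
    have "bes \<beta> (\<lambda>k. dprod chi \<rho> (dpow chi \<rho> v i) (dpow chi \<rho> (dconj v) j) k - dprod chi \<rho> (dpow chi \<rho> w i) (dpow chi \<rho> (dconj w) j) k)
       ((real i * \<delta> + real j * \<delta>) * (C * E i * E j))"
      by (rule dprod_diff_bes[OF P pw pw _ pw pw])
         (use vW dpow_diff_bes[OF P vW(1,2) d1, of i] dpow_diff_bes[OF P vW(3,4) d2, of j] in \<open>simp_all only: E_def\<close>)
    then have "bes s (\<lambda>k. Psi_term chi \<rho> i j v z k - Psi_term chi \<rho> i j w z k)
      ((real i * \<delta> + real j * \<delta> + 0) * (C' * (C * E i * E j) * (K * W ^ p)))"
      unfolding Psi_term_def
      by (intro dprod_diff_bes[where s = s and C = C', OF _ Q[OF v] Q[OF w] _ z z] P') (simp_all add: bes_zero)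
    moreover have "(real i * \<delta> + real j * \<delta> + 0) * (C' * (C * E i * E j) * (K * W ^ p)) \<le> D * K * \<delta> * W ^ q"
      using mult_left_mono[OF G(1) \<delta>] by (simp add: algebra_simps)
    ultimately show ?thesis by (rule bes_mono)
  qed
qed

text \<open>In the application W is a multiple of t^(-\<gamma>) and K bounds the noise; \<delta> is
  the distance of \<open>v\<close> and \<open>w\<close> relative to W. The constant is fixed before
  the noise, the time and the functions.\<close>

definition Psi_bound :: "nat \<Rightarrow> complex \<Rightarrow> complex \<Rightarrow> real \<Rightarrow> real \<Rightarrow> real \<Rightarrow> bool" where
  "Psi_bound m \<nu> \<tau> \<alpha> \<beta> C \<longleftrightarrow> (\<forall>Z Zh t v w K W \<delta>. 1 \<le> W \<and> 1 \<le> K \<and> 0 \<le> \<delta> \<and> bes \<beta> v W \<and>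
     (\<forall>a\<le>m + 1. \<forall>b\<le>m. bes (- \<alpha>) (Zx Z Zh a b t) (K * W ^ (a + b))) \<longrightarrow>
     bes (- \<alpha>) (Psi chi \<rho> m \<nu> \<tau> Z Zh t v) (C * K * W ^ (2 * m + 1)) \<and>
     (bes \<beta> w W \<and> bes \<beta> (\<lambda>k. v k - w k) (\<delta> * W) \<longrightarrow>
       bes (- \<alpha>) (\<lambda>k. Psi chi \<rho> m \<nu> \<tau> Z Zh t v k - Psi chi \<rho> m \<nu> \<tau> Z Zh t w k) (C * K * \<delta> * W ^ (2 * m + 1))))"

lemma Psi_boundD:
  assumes "Psi_bound m \<nu> \<tau> \<alpha> \<beta> C" "1 \<le> W" "1 \<le> K" "0 \<le> \<delta>" "bes \<beta> v W"
    "\<And>a b. a \<le> m + 1 \<Longrightarrow> b \<le> m \<Longrightarrow> bes (- \<alpha>) (Zx Z Zh a b t) (K * W ^ (a + b))"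
  shows "bes (- \<alpha>) (Psi chi \<rho> m \<nu> \<tau> Z Zh t v) (C * K * W ^ (2 * m + 1))"
    "bes \<beta> w W \<Longrightarrow> bes \<beta> (\<lambda>k. v k - w k) (\<delta> * W) \<Longrightarrow>
      bes (- \<alpha>) (\<lambda>k. Psi chi \<rho> m \<nu> \<tau> Z Zh t v k - Psi chi \<rho> m \<nu> \<tau> Z Zh t w k) (C * K * \<delta> * W ^ (2 * m + 1))"
proof -
  have h: "1 \<le> W \<and> 1 \<le> K \<and> 0 \<le> \<delta> \<and> bes \<beta> v W \<and>
     (\<forall>a\<le>m + 1. \<forall>b\<le>m. bes (- \<alpha>) (Zx Z Zh a b t) (K * W ^ (a + b)))"
    using assms(2-6) by blast
  note * = assms(1)[unfolded Psi_bound_def, THEN spec, THEN spec, THEN spec, THEN spec, THEN spec, THEN spec,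
      THEN spec, THEN spec, THEN mp, OF h]
  show "bes (- \<alpha>) (Psi chi \<rho> m \<nu> \<tau> Z Zh t v) (C * K * W ^ (2 * m + 1))"
    by (rule *[THEN conjunct1])
  show "bes (- \<alpha>) (\<lambda>k. Psi chi \<rho> m \<nu> \<tau> Z Zh t v k - Psi chi \<rho> m \<nu> \<tau> Z Zh t w k) (C * K * \<delta> * W ^ (2 * m + 1))"
    if "bes \<beta> w W" "bes \<beta> (\<lambda>k. v k - w k) (\<delta> * W)"
    by (rule *[THEN conjunct2, THEN mp, OF conjI[OF that]])
qed

lemma Psi_bounds:
  assumes ab: "0 < \<alpha>" "\<alpha> < \<beta>"
  shows "\<exists>C\<ge>0. Psi_bound m \<nu> \<tau> \<alpha> \<beta> C"
proof -
  define q where "q = 2 * m + 1"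
  obtain C where C: "C \<ge> 1" "\<And>f g F G. bes \<beta> f F \<Longrightarrow> bes \<beta> g G \<Longrightarrow> bes \<beta> (dprod chi \<rho> f g) (C * F * G) \<and> dprod_conv chi \<rho> f g"
    using dprod_bes[OF ab, of \<beta>] by blast
  obtain C' where C': "C' \<ge> 1" "\<And>f g F G. bes \<beta> f F \<Longrightarrow> bes (- \<alpha>) g G \<Longrightarrow> bes (- \<alpha>) (dprod chi \<rho> f g) (C' * F * G) \<and> dprod_conv chi \<rho> f g"
    using dprod_bes[OF ab, of "- \<alpha>"] by blast
  define c where "c = max 1 (165 * 2 powr \<bar>\<beta>\<bar> * (4 * B))"
  define D where "D = C' * C * (2 powr \<bar>\<beta>\<bar>)\<^sup>2 * (C * c) ^ q * (q + 1)"
  have D0: "D \<ge> 0" using C(1) C'(1) by (simp add: D_def c_def)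
  define b where "b i j = cmod (of_nat ((m + 1) choose i) * of_nat (m choose j))" for i j
  define S where "S = (\<Sum>i\<le>m + 1. \<Sum>j\<le>m. b i j * D)"
  have S0: "S \<ge> 0" unfolding S_def using D0 by (intro sum_nonneg) (auto simp: b_def)
  define A where "A = cmod \<nu> * S + cmod (\<tau> + 1) * (2 powr (\<beta> + \<alpha>) + 1)"
  show ?thesis
    unfolding Psi_bound_def
  proof (intro exI[of _ A] conjI allI impI)
    show "A \<ge> 0" using S0 by (simp add: A_def)
    fix Z :: "real \<Rightarrow> distr" and Zh :: "nat \<Rightarrow> nat \<Rightarrow> real \<Rightarrow> distr" and t v w and K W \<delta> :: real
    assume asm: "1 \<le> W \<and> 1 \<le> K \<and> 0 \<le> \<delta> \<and> bes \<beta> v W \<and>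
      (\<forall>a\<le>m + 1. \<forall>b\<le>m. bes (- \<alpha>) (Zx Z Zh a b t) (K * W ^ (a + b)))"
    then have W: "1 \<le> W" and K: "1 \<le> K" and \<delta>: "0 \<le> \<delta>" and v: "bes \<beta> v W"
      and z: "\<And>a b. a \<le> m + 1 \<Longrightarrow> b \<le> m \<Longrightarrow> bes (- \<alpha>) (Zx Z Zh a b t) (K * W ^ (a + b))" by auto
    let ?z = "\<lambda>i j. Zx Z Zh (m + 1 - i) (m - j) t"
    let ?T = "\<lambda>i j v. Psi_term chi \<rho> i j v (?z i j)"
    have T: "bes (- \<alpha>) (?T i j v) (D * K * W ^ q)"
      and T': "bes \<beta> w W \<Longrightarrow> bes \<beta> (\<lambda>k. v k - w k) (\<delta> * W) \<Longrightarrow> bes (- \<alpha>) (\<lambda>k. ?T i j v k - ?T i j w k) (D * K * \<delta> * W ^ q)"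
      if ij: "i \<le> m + 1" "j \<le> m" for i j
    proof -
      have zz: "bes (- \<alpha>) (?z i j) (K * W ^ (m + 1 - i + (m - j)))" by (rule z) auto
      have q: "i + j + (m + 1 - i + (m - j)) = q" using ij by (simp add: q_def)
      note * = Psi_term_bes[OF C(2) C'(2) C(1) C'(1) c_def W K \<delta> v zz q, folded D_def]
      show "bes (- \<alpha>) (?T i j v) (D * K * W ^ q)" by (rule *(1))
      show "bes (- \<alpha>) (\<lambda>k. ?T i j v k - ?T i j w k) (D * K * \<delta> * W ^ q)"
        if "bes \<beta> w W" "bes \<beta> (\<lambda>k. v k - w k) (\<delta> * W)"
        by (rule *(2); (assumption | rule that))
    qed
    have Wq: "W \<le> K * W ^ q" "W \<le> W ^ q"
    proof -
      show "W \<le> W ^ q" using power_increasing[of 1 q W] W by (simp add: q_def)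
      also have "\<dots> \<le> K * W ^ q" using K W by (simp add: mult_le_cancel_right1)
      finally show "W \<le> K * W ^ q" .
    qed
    have Z1: "Zx Z Zh 1 0 t = Z t" by (simp add: Zx_def)
    have sum1: "bes (- \<alpha>) (\<lambda>k. - \<nu> * (\<Sum>i\<le>m + 1. \<Sum>j\<le>m. of_nat ((m + 1) choose i) * of_nat (m choose j) * g i j k))
        (cmod (- \<nu>) * (\<Sum>i\<le>m + 1. \<Sum>j\<le>m. b i j * (D * X)))"
      if "\<And>i j. i \<le> m + 1 \<Longrightarrow> j \<le> m \<Longrightarrow> bes (- \<alpha>) (g i j) (D * X)" for g X
      unfolding b_def by (intro bes_cmult bes_sum) (use that in auto)
    have sumeq: "cmod (- \<nu>) * (\<Sum>i\<le>m + 1. \<Sum>j\<le>m. b i j * (D * X)) = cmod \<nu> * S * X" for X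
      by (simp only: S_def sum_distrib_right norm_minus_cancel mult.assoc)
    have X1: "bes (- \<alpha>) (\<lambda>k. (\<tau> + 1) * (v k + Z t k)) (cmod (\<tau> + 1) * (2 powr (\<beta> + \<alpha>) + 1) * (K * W ^ q))"
    proof -
      have "bes (- \<alpha>) v (W * 2 powr (\<beta> - (- \<alpha>)))" by (rule bes_weaken[OF v]) (use ab in auto)
      then have 1: "bes (- \<alpha>) v (2 powr (\<beta> + \<alpha>) * (K * W ^ q))"
        by (rule bes_mono) (use Wq(1) in \<open>simp add: mult.commute mult_left_mono\<close>)
      have 2: "bes (- \<alpha>) (Z t) (K * W ^ q)"
        using z[of 1 0] unfolding Z1 by (rule bes_mono) (use Wq(2) K in auto)
      show ?thesis using bes_cmult[OF bes_add[OF 1 2], of "\<tau> + 1"] by (simp add: algebra_simps)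
    qed
    show "bes (- \<alpha>) (Psi chi \<rho> m \<nu> \<tau> Z Zh t v) (A * K * W ^ (2 * m + 1))"
    proof -
      have "bes (- \<alpha>) (Psi chi \<rho> m \<nu> \<tau> Z Zh t v)
         (cmod \<nu> * S * (K * W ^ q) + cmod (\<tau> + 1) * (2 powr (\<beta> + \<alpha>) + 1) * (K * W ^ q))"
        unfolding Psi_eq sumeq[symmetric]
        by (rule bes_add[OF sum1 X1]) (use T in \<open>simp add: mult.assoc\<close>)
      then show ?thesis by (simp add: A_def q_def algebra_simps)
    qed
    show "bes (- \<alpha>) (\<lambda>k. Psi chi \<rho> m \<nu> \<tau> Z Zh t v k - Psi chi \<rho> m \<nu> \<tau> Z Zh t w k) (A * K * \<delta> * W ^ (2 * m + 1))"
      if w: "bes \<beta> w W \<and> bes \<beta> (\<lambda>k. v k - w k) (\<delta> * W)"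
    proof -
      have "bes (- \<alpha>) (\<lambda>k. v k - w k) (\<delta> * W * 2 powr (\<beta> - (- \<alpha>)))"
        by (rule bes_weaken) (use ab w in auto)
      then have "bes (- \<alpha>) (\<lambda>k. v k - w k) ((2 powr (\<beta> + \<alpha>) + 1) * (\<delta> * (K * W ^ q)))"
      proof (rule bes_mono)
        have "\<delta> * W * 2 powr (\<beta> - (- \<alpha>)) \<le> \<delta> * (K * W ^ q) * (2 powr (\<beta> + \<alpha>) + 1)"
          using Wq(1) \<delta> K W by (intro mult_mono) auto
        then show "\<delta> * W * 2 powr (\<beta> - (- \<alpha>)) \<le> (2 powr (\<beta> + \<alpha>) + 1) * (\<delta> * (K * W ^ q))"
          by (simp add: mult.commute)
      qed
      from bes_cmult[OF this, of "\<tau> + 1"]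
      have X2: "bes (- \<alpha>) (\<lambda>k. (\<tau> + 1) * (v k - w k)) (cmod (\<tau> + 1) * (2 powr (\<beta> + \<alpha>) + 1) * (\<delta> * (K * W ^ q)))"
        by (simp add: mult.assoc)
      have e: "Psi chi \<rho> m \<nu> \<tau> Z Zh t v k - Psi chi \<rho> m \<nu> \<tau> Z Zh t w k =
        - \<nu> * (\<Sum>i\<le>m + 1. \<Sum>j\<le>m. of_nat ((m + 1) choose i) * of_nat (m choose j) * (?T i j v k - ?T i j w k)) +
        (\<tau> + 1) * (v k - w k)" for k
        unfolding Psi_eq right_diff_distrib sum_subtractf by (simp add: algebra_simps)
      have "bes (- \<alpha>) (\<lambda>k. Psi chi \<rho> m \<nu> \<tau> Z Zh t v k - Psi chi \<rho> m \<nu> \<tau> Z Zh t w k)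
         (cmod \<nu> * S * (\<delta> * (K * W ^ q)) + cmod (\<tau> + 1) * (2 powr (\<beta> + \<alpha>) + 1) * (\<delta> * (K * W ^ q)))"
        unfolding e sumeq[symmetric]
        by (rule bes_add[OF sum1 X2]) (use T' w in \<open>simp add: mult_ac\<close>)
      then show ?thesis by (simp add: A_def q_def algebra_simps)
    qed
  qed
qed

end

section \<open>Measurability in time\<close>

declare split_paired_All [simp del]

abbreviation bmeas :: "real set \<Rightarrow> (real \<Rightarrow> complex) set" where
  "bmeas S \<equiv> borel_measurable (restrict_space borel S)"

text \<open>Coefficientwise measurability stands in for measurability with values in a Besov space,
  matching the coefficientwise integral in \<open>mild_solution\<close>.\<close>

definition cmeas :: "real set \<Rightarrow> (real \<Rightarrow> distr) \<Rightarrow> bool" where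
  "cmeas S f \<longleftrightarrow> (\<forall>k. (\<lambda>s. f s k) \<in> bmeas S)"

lemma cmeas_subset: "cmeas S f \<Longrightarrow> S' \<subseteq> S \<Longrightarrow> cmeas S' f"
  unfolding cmeas_def using measurable_restrict_mono by blast

lemma cmeas_const: "cmeas S (\<lambda>_. f)"
  by (simp add: cmeas_def)

text \<open>The pointwise \<open>lim\<close> of measurable functions is measurable whether or not it
  converges, so no regularity is asked of the factors.\<close>

lemma cmeas_dprod:
  assumes "cmeas S f" "cmeas S g"
  shows "cmeas S (\<lambda>s. dprod chi \<rho> (f s) (g s))"
  unfolding cmeas_def
proof
  fix k
  have F: "(\<lambda>s. f s l) \<in> bmeas S" for l
    using assms(1) unfolding cmeas_def by blast
  have G: "(\<lambda>s. g s l) \<in> bmeas S" for l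
    using assms(2) unfolding cmeas_def by blast
  have "(\<lambda>s. dprod_partial chi \<rho> (f s) (g s) k N) \<in> bmeas S" for N
    unfolding dprod_partial_def
  proof (rule borel_measurable_sum)
    fix l
    note [measurable] = F[of l] G[of "(fst k - fst l, snd k - snd l)"]
    show "(\<lambda>s. of_real (lp_partial chi \<rho> N (freq l)) * f s l *
        of_real (lp_partial chi \<rho> N (freq (fst k - fst l, snd k - snd l))) * g s (fst k - fst l, snd k - snd l))
      \<in> bmeas S"
      by measurable
  qed
  then show "(\<lambda>s. dprod chi \<rho> (f s) (g s) k) \<in> bmeas S"
    unfolding dprod_eq_lim by (rule borel_measurable_lim_metric)
qed

lemma cmeas_dconj:
  assumes "cmeas S f" shows "cmeas S (\<lambda>s. dconj (f s))"
  unfolding cmeas_def dconj_def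
proof
  fix k :: "int \<times> int"
  have "cnj \<in> borel_measurable borel"
    by (rule borel_measurable_continuous_onI) (rule continuous_on_cnj[OF continuous_on_id])
  moreover have "(\<lambda>s. f s (- fst k, - snd k)) \<in> bmeas S"
    using assms unfolding cmeas_def by blast
  ultimately show "(\<lambda>s. cnj (f s (- fst k, - snd k))) \<in> bmeas S"
    by (rule measurable_compose[rotated])
qed

lemma cmeas_dpow: "cmeas S f \<Longrightarrow> cmeas S (\<lambda>s. dpow chi \<rho> (f s) n)"
  by (induction n) (simp_all add: cmeas_const cmeas_dprod)

lemma cmeas_Psi:
  assumes "cmeas S v" and z: "\<And>a b. a \<le> m + 1 \<Longrightarrow> b \<le> m \<Longrightarrow> cmeas S (Zx Z Zh a b)"
  shows "cmeas S (\<lambda>s. Psi chi \<rho> m \<nu> \<tau> Z Zh s (v s))"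
  unfolding cmeas_def
proof
  fix k
  have Z: "(\<lambda>s. Z s k) \<in> bmeas S"
    using z[of 1 0] by (simp add: cmeas_def Zx_def[abs_def])
  have V: "(\<lambda>s. v s k) \<in> bmeas S"
    using assms(1) by (simp add: cmeas_def)
  have T: "(\<lambda>s. Psi_term chi \<rho> i j (v s) (Zx Z Zh (m + 1 - i) (m - j) s) k) \<in> bmeas S" for i j
  proof -
    have zz: "cmeas S (\<lambda>s. Zx Z Zh (m + 1 - i) (m - j) s)" by (rule z) auto
    have "cmeas S (\<lambda>s. Psi_term chi \<rho> i j (v s) (Zx Z Zh (m + 1 - i) (m - j) s))"
      unfolding Psi_term_def by (intro cmeas_dprod cmeas_dpow cmeas_dconj assms(1) zz)
    then show ?thesis unfolding cmeas_def by blast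
  qed
  show "(\<lambda>s. Psi chi \<rho> m \<nu> \<tau> Z Zh s (v s) k) \<in> bmeas S"
    unfolding Psi_eq
    by (intro borel_measurable_add borel_measurable_times borel_measurable_sum borel_measurable_const Z V T)
qed

section \<open>The Duhamel integral\<close>

text \<open>Substituting s = t x reduces every t to t = 1, where the integral is a Beta function; C
  is that value.\<close>

lemma beta_integral:
  fixes a b :: real
  assumes "a < 1" "b < 1"
  shows "\<exists>C\<ge>0. \<forall>t>0. set_integrable lborel {0<..<t} (\<lambda>s. (t - s) powr (- a) * s powr (- b)) \<and>
     (LINT s:{0<..<t}|lborel. (t - s) powr (- a) * s powr (- b)) = C * t powr (1 - a - b)"
proof -
  let ?J = "\<lambda>t s. (t - s) powr (- a) * s powr (- b)"
  let ?f = "\<lambda>t s. indicat_real {0<..<t} s *\<^sub>R ?J t s"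
  have "set_integrable lborel {0..1} (\<lambda>t. t powr (1 - b - 1) * (1 - t) powr (1 - a - 1))"
    by (rule integrable_Beta) (use assms in auto)
  then have 1: "integrable lborel (?f 1)"
    using set_integrable_subset[of lborel "{0..1}" "?J 1" "{0<..<1}"]
    unfolding set_integrable_def[symmetric] by (simp add: mult.commute subset_iff)
  have sc: "?f t (0 + t * x) = t powr (- a - b) * ?f 1 x" if "t > 0" for t x
  proof (cases "x \<in> {0<..<1}")
    case True
    then have "t - t * x = t * (1 - x)" "0 < 1 - x" by (auto simp: algebra_simps)
    then have "(t - t * x) powr (- a) = t powr (- a) * (1 - x) powr (- a)" "(t * x) powr (- b) = t powr (- b) * x powr (- b)"
      using that True by (simp_all add: powr_mult)
    moreover have "t powr (- a) * t powr (- b) = t powr (- a - b)" by (simp add: powr_add[symmetric])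
    moreover have "0 + t * x \<in> {0<..<t}" using that True by simp
    ultimately show ?thesis using True by simp
  next
    case False
    then have "0 + t * x \<notin> {0<..<t}" using that by (auto simp: zero_less_mult_iff mult_less_cancel_left_pos)
    then show ?thesis using False by simp
  qed
  show ?thesis
  proof (intro exI[of _ "integral\<^sup>L lborel (?f 1)"] conjI allI impI)
    show "0 \<le> integral\<^sup>L lborel (?f 1)" by (intro integral_nonneg_AE) auto
    fix t :: real assume t: "t > 0"
    have "integrable lborel (\<lambda>x. ?f t (0 + t * x))"
      unfolding sc[OF t] by (intro integrable_mult_right 1)
    then have "integrable lborel (?f t)"
      using lborel_integrable_real_affine_iff[of t "?f t" 0] t by simp
    then show "set_integrable lborel {0<..<t} (?J t)" by (simp add: set_integrable_def)
    have "integral\<^sup>L lborel (?f t) = \<bar>t\<bar> *\<^sub>R (LINT x|lborel. ?f t (0 + t * x))"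
      by (rule lborel_integral_real_affine) (use t in auto)
    also have "\<dots> = t * (t powr (- a - b) * integral\<^sup>L lborel (?f 1))"
      unfolding sc[OF t] using t by simp
    also have "\<dots> = integral\<^sup>L lborel (?f 1) * t powr (1 - a - b)"
    proof -
      have "t * t powr (- a - b) = t powr (1 - a - b)" using t powr_add[of t 1 "- a - b"] by (simp add: algebra_simps)
      then show ?thesis by (simp only: mult.assoc[symmetric]) (simp only: mult.commute)
    qed
    finally show "(LINT s:{0<..<t}|lborel. ?J t s) = integral\<^sup>L lborel (?f 1) * t powr (1 - a - b)"
      by (simp add: set_lebesgue_integral_def)
  qed
qed

lemma set_borel_measurable_of_restrict:
  fixes f :: "real \<Rightarrow> complex"
  assumes "f \<in> bmeas S" "S \<in> sets borel"
  shows "set_borel_measurable lborel S f"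
  using assms by (simp add: set_borel_measurable_def borel_measurable_restrict_space_iff)

text \<open>The mild formulation integrates over a closed interval, while bounds are available only
  strictly inside. The endpoints are null, and the value at 0 enters the measurability argument as a
  single-point indicator.\<close>

lemma set_integrable_closed_of_open:
  fixes f :: "real \<Rightarrow> complex" and t :: real
  assumes f: "f \<in> bmeas {0<..t}" and t: "t > 0"
    and g: "set_integrable lborel {0<..<t} g" and b: "\<And>s. 0 < s \<Longrightarrow> s < t \<Longrightarrow> cmod (f s) \<le> g s"
  shows "set_integrable lborel {0<..<t} f" "set_integrable lborel {0..t} f"
    "(LINT s:{0..t}|lborel. f s) = (LINT s:{0<..<t}|lborel. f s)"
proof -
  have "f \<in> borel_measurable (restrict_space borel {0<..<t})"
    by (rule measurable_restrict_mono[OF f]) auto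
  then have m1: "set_borel_measurable lborel {0<..<t} f" by (rule set_borel_measurable_of_restrict) auto
  have m2: "set_borel_measurable lborel {0<..t} f" by (rule set_borel_measurable_of_restrict[OF f]) auto
  have m3: "set_borel_measurable lborel {0..t} f"
  proof -
    have "(\<lambda>x. indicator {0..t} x *\<^sub>R f x) = (\<lambda>x. indicator {0<..t} x *\<^sub>R f x + indicator {0} x *\<^sub>R f 0)"
      using t by (auto simp: fun_eq_iff indicator_def)
    then show ?thesis using m2 unfolding set_borel_measurable_def
      by (auto intro!: borel_measurable_add borel_measurable_scaleR simp del: scaleR_conv_of_real)
  qed
  show 1: "set_integrable lborel {0<..<t} f"
    by (rule set_integrable_bound[OF g m1]) (auto intro!: AE_I2 order_trans[OF b] simp: abs_ge_self)
  have ae: "AE x in lborel. (x \<in> {0..t}) = (x \<in> {0<..<t})"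
    using AE_lborel_singleton[of 0] AE_lborel_singleton[of t] by eventually_elim auto
  have "AE x in lborel. indicator {0..t} x *\<^sub>R f x = indicator {0<..<t} x *\<^sub>R f x"
    using ae by eventually_elim (auto simp: indicator_def)
  then show "set_integrable lborel {0..t} f"
    using 1 m1 m3 unfolding set_integrable_def set_borel_measurable_def
    by (subst integrable_cong_AE) auto
  show "(LINT s:{0..t}|lborel. f s) = (LINT s:{0<..<t}|lborel. f s)"
    by (rule set_integral_cong_set[OF m1 m3]) (use ae in \<open>auto elim!: eventually_mono\<close>)
qed

lemma set_integral_finite_sum:
  fixes f :: "'i \<Rightarrow> 'a \<Rightarrow> complex"
  assumes "finite I" "\<And>i. i \<in> I \<Longrightarrow> set_integrable M A (f i)"
  shows "set_integrable M A (\<lambda>x. \<Sum>i\<in>I. f i x)"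
    "(LINT x:A|M. \<Sum>i\<in>I. f i x) = (\<Sum>i\<in>I. LINT x:A|M. f i x)"
  unfolding set_integrable_def set_lebesgue_integral_def scaleR_sum_right
  by (rule Bochner_Integration.integrable_sum Bochner_Integration.integral_sum,
      rule assms(2)[unfolded set_integrable_def], assumption)+

abbreviation integrand :: "real \<Rightarrow> (real \<Rightarrow> distr) \<Rightarrow> real \<Rightarrow> int \<times> int \<Rightarrow> real \<Rightarrow> complex" where
  "integrand \<mu> \<psi> t k \<equiv> \<lambda>s. exp (of_real (t - s) * heat_symbol \<mu> k) * \<psi> s k"

definition duh :: "real \<Rightarrow> (real \<Rightarrow> distr) \<Rightarrow> real \<Rightarrow> distr" where
  "duh \<mu> \<psi> t k = (LINT s:{0..t}|lborel. exp (of_real (t - s) * heat_symbol \<mu> k) * \<psi> s k)"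

text \<open>Applied to u = L (t - s): writing exp(L s) as exp(L t) exp(-L (t - s)), it trades a
  slightly worse singularity at s = t for the small factor L^(-\<kappa>).\<close>

lemma exp_minus_le_powr:
  fixes u \<kappa> :: real
  assumes "u > 0" "0 \<le> \<kappa>" "\<kappa> \<le> 1"
  shows "exp (- u) \<le> u powr (- \<kappa>)"
proof -
  have "u powr \<kappa> \<le> exp u"
  proof (cases "u \<le> 1")
    case True
    then have "u powr \<kappa> \<le> 1" using powr_le1[of \<kappa> u] assms by simp
    also have "1 \<le> exp u" using assms by simp
    finally show ?thesis .
  next
    case False
    then have "u powr \<kappa> \<le> u powr 1" using assms by (intro powr_mono) auto
    also have "\<dots> \<le> exp u" using exp_ge_add_one_self[of u] assms(1) by (simp only: powr_one less_imp_le)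
    finally show ?thesis .
  qed
  then show ?thesis using assms by (simp add: powr_minus exp_minus le_imp_inverse_le)
qed

context lp
begin

text \<open>In the exponent, (\<beta>' + \<alpha>)/2 is the price of heat smoothing from
  C^(-\<alpha>) to C^\<beta>', \<kappa> the price of the factor in L, and b the singularity of
  \<psi> at time 0.\<close>

definition duhamel_bound :: "real \<Rightarrow> real \<Rightarrow> real \<Rightarrow> real \<Rightarrow> real \<Rightarrow> real \<Rightarrow> bool" where
  "duhamel_bound \<mu> \<alpha> b \<kappa> \<beta>' C \<longleftrightarrow> (\<forall>\<psi> Q L t. 0 < t \<and> t \<le> 1 \<and> 0 < L \<and> 0 \<le> Q \<and> cmeas {0<..t} \<psi> \<and>
      (\<forall>s. 0 < s \<and> s < t \<longrightarrow> bes (- \<alpha>) (\<psi> s) (Q * s powr (- b) * exp (L * s))) \<longrightarrow>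
    (\<forall>k. set_integrable lborel {0..t} (integrand \<mu> \<psi> t k)) \<and>
    bes \<beta>' (duh \<mu> \<psi> t) (C * Q * L powr (- \<kappa>) * exp (L * t) * t powr (1 - ((\<beta>' + \<alpha>) / 2 + \<kappa>) - b)))"

lemma duhamel_boundD:
  assumes "duhamel_bound \<mu> \<alpha> b \<kappa> \<beta>' C" "0 < t" "t \<le> 1" "0 < L" "0 \<le> Q" "cmeas {0<..t} \<psi>"
    "\<And>s. 0 < s \<Longrightarrow> s < t \<Longrightarrow> bes (- \<alpha>) (\<psi> s) (Q * s powr (- b) * exp (L * s))"
  shows "set_integrable lborel {0..t} (integrand \<mu> \<psi> t k)"
    "bes \<beta>' (duh \<mu> \<psi> t) (C * Q * L powr (- \<kappa>) * exp (L * t) * t powr (1 - ((\<beta>' + \<alpha>) / 2 + \<kappa>) - b))"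
proof -
  have h: "0 < t \<and> t \<le> 1 \<and> 0 < L \<and> 0 \<le> Q \<and> cmeas {0<..t} \<psi> \<and>
      (\<forall>s. 0 < s \<and> s < t \<longrightarrow> bes (- \<alpha>) (\<psi> s) (Q * s powr (- b) * exp (L * s)))"
    using assms(2-7) by blast
  show "set_integrable lborel {0..t} (integrand \<mu> \<psi> t k)"
    by (rule assms(1)[unfolded duhamel_bound_def, THEN spec, THEN spec, THEN spec, THEN spec, THEN mp, OF h, THEN conjunct1, THEN spec])
  show "bes \<beta>' (duh \<mu> \<psi> t) (C * Q * L powr (- \<kappa>) * exp (L * t) * t powr (1 - ((\<beta>' + \<alpha>) / 2 + \<kappa>) - b))"
    by (rule assms(1)[unfolded duhamel_bound_def, THEN spec, THEN spec, THEN spec, THEN spec, THEN mp, OF h, THEN conjunct2])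
qed

text \<open>The heat bound and the trade of the exponential leave a Beta integral. A block is a
  finite combination of coefficients, hence commutes with the coefficientwise integral; only then is
  the modulus moved inside.\<close>

lemma duhamel_bes:
  assumes \<mu>: "\<mu> > 0" and p: "- \<alpha> \<le> \<beta>'" "0 \<le> \<kappa>" "\<kappa> \<le> 1" "(\<beta>' + \<alpha>) / 2 + \<kappa> < 1" "b < 1"
  shows "\<exists>C\<ge>0. duhamel_bound \<mu> \<alpha> b \<kappa> \<beta>' C"
proof -
  define \<theta> where "\<theta> = (\<beta>' + \<alpha>) / 2"
  define a where "a = \<theta> + \<kappa>"
  have a: "a < 1" "0 \<le> \<theta>" using p by (auto simp: a_def \<theta>_def)
  obtain J where J: "J \<ge> 0" "\<And>t. t > 0 \<Longrightarrow> set_integrable lborel {0<..<t} (\<lambda>s. (t - s) powr (- a) * s powr (- b))"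
    "\<And>t. t > 0 \<Longrightarrow> (LINT s:{0<..<t}|lborel. (t - s) powr (- a) * s powr (- b)) = J * t powr (1 - a - b)"
    using beta_integral[OF a(1) p(5)] by blast
  obtain C0 where C0: "C0 \<ge> 0" "\<And>f F t. bes (- \<alpha>) f F \<Longrightarrow> 0 < t \<Longrightarrow> t \<le> 1 \<Longrightarrow> bes \<beta>' (heat \<mu> t f) (C0 * t powr (- \<theta>) * F)"
    using bes_heat[OF \<mu> p(1)] by (auto simp: \<theta>_def minus_divide_left)
  have main: "(\<forall>k. set_integrable lborel {0..t} (integrand \<mu> \<psi> t k)) \<and>
     bes \<beta>' (duh \<mu> \<psi> t) (C0 * J * Q * L powr (- \<kappa>) * exp (L * t) * t powr (1 - a - b))"
    if t: "0 < t" "t \<le> 1" and L: "0 < L" and Q: "0 \<le> Q" and meas: "cmeas {0<..t} \<psi>"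
      and \<psi>: "\<And>s. 0 < s \<Longrightarrow> s < t \<Longrightarrow> bes (- \<alpha>) (\<psi> s) (Q * s powr (- b) * exp (L * s))"
    for \<psi> Q L t
  proof -
    let ?e = "\<lambda>k s. exp (of_real (t - s) * heat_symbol \<mu> k) * \<psi> s k"
    have em: "?e k \<in> bmeas {0<..t}" for k
    proof -
      have "(\<lambda>s. exp (complex_of_real (t - s) * heat_symbol \<mu> k)) \<in> bmeas {0<..t}"
        by (intro borel_measurable_continuous_on_restrict continuous_intros)
      then show ?thesis using meas unfolding cmeas_def by (intro borel_measurable_times) auto
    qed
    have pw: "(t - s) powr (- \<theta>) * exp (L * s) \<le> L powr (- \<kappa>) * exp (L * t) * (t - s) powr (- a)"
      if s: "0 < s" "s < t" for s
    proof -
      have "exp (L * s) = exp (L * t) * exp (- (L * (t - s)))" by (simp add: mult_exp_exp algebra_simps)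
      also have "\<dots> \<le> exp (L * t) * (L * (t - s)) powr (- \<kappa>)"
        using L s p by (intro mult_left_mono exp_minus_le_powr) auto
      also have "\<dots> = L powr (- \<kappa>) * exp (L * t) * (t - s) powr (- \<kappa>)"
        using L s by (simp add: powr_mult)
      finally have "(t - s) powr (- \<theta>) * exp (L * s) \<le> (t - s) powr (- \<theta>) * (L powr (- \<kappa>) * exp (L * t) * (t - s) powr (- \<kappa>))"
        by (intro mult_left_mono) auto
      also have "\<dots> = L powr (- \<kappa>) * exp (L * t) * ((t - s) powr (- \<theta>) * (t - s) powr (- \<kappa>))" by simp
      also have "(t - s) powr (- \<theta>) * (t - s) powr (- \<kappa>) = (t - s) powr (- a)"
        by (simp add: a_def powr_add[symmetric])
      finally show ?thesis .
    qed
    define H where "H = Q * L powr (- \<kappa>) * exp (L * t)"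
    have H0: "H \<ge> 0" using Q by (simp add: H_def)
    have hb: "bes \<beta>' (heat \<mu> (t - s) (\<psi> s)) (C0 * H * ((t - s) powr (- a) * s powr (- b)))"
      if s: "0 < s" "s < t" for s
    proof (rule bes_mono[OF C0(2)[OF \<psi>[OF s]]])
      have "C0 * (t - s) powr (- \<theta>) * (Q * s powr (- b) * exp (L * s)) =
         C0 * (Q * s powr (- b)) * ((t - s) powr (- \<theta>) * exp (L * s))" by simp
      also have "\<dots> \<le> C0 * (Q * s powr (- b)) * (L powr (- \<kappa>) * exp (L * t) * (t - s) powr (- a))"
        using C0(1) Q by (intro mult_left_mono pw s) auto
      finally show "C0 * (t - s) powr (- \<theta>) * (Q * s powr (- b) * exp (L * s)) \<le> C0 * H * ((t - s) powr (- a) * s powr (- b))"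
        by (simp add: H_def mult_ac)
    qed (use s t in auto)
    have heat_e: "heat \<mu> (t - s) (\<psi> s) k = ?e k s" for s k by (simp add: heat_def)
    have gi: "set_integrable lborel {0<..<t} (\<lambda>s. c * ((t - s) powr (- a) * s powr (- b)))" for c
      by (intro set_integrable_mult_right impI J(2) t)
    have ints: "set_integrable lborel {0<..<t} (?e k)" "set_integrable lborel {0..t} (?e k)"
      "duh \<mu> \<psi> t k = (LINT s:{0<..<t}|lborel. ?e k s)" for k
    proof -
      obtain Ck where Ck: "Ck \<ge> 0" "\<And>f F. bes \<beta>' f F \<Longrightarrow> cmod (f k) \<le> Ck * F" using coeff_le by blast
      have b: "cmod (?e k s) \<le> Ck * (C0 * H) * ((t - s) powr (- a) * s powr (- b))" if "0 < s" "s < t" for s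
        using Ck(2)[OF hb[OF that]] unfolding heat_e by (simp only: mult.assoc)
      note * = set_integrable_closed_of_open[OF em t(1) gi b]
      show "set_integrable lborel {0<..<t} (?e k)" "set_integrable lborel {0..t} (?e k)"
        "duh \<mu> \<psi> t k = (LINT s:{0<..<t}|lborel. ?e k s)"
        unfolding duh_def by (rule *; simp)+
    qed
    have "bes \<beta>' (duh \<mu> \<psi> t) (C0 * H * (J * t powr (1 - a - b)))"
      unfolding bes_def
    proof (intro allI)
      fix n x
      have S: "finite (Ring n)" by (rule finite_subset[OF Ring_subset_fbox]) simp
      have tpB: "tp (Bl n h) x = (\<Sum>k\<in>Ring n. of_real (wt n k) * fourier_mode k x * h k)" for h
        by (subst tp_eq[OF S]) (use wt_Ring in \<open>auto simp: Bl_def mult_ac\<close>)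
      let ?F = "\<lambda>s. tp (Bl n (heat \<mu> (t - s) (\<psi> s))) x"
      have Fi: "set_integrable lborel {0<..<t} ?F"
        unfolding tpB heat_e by (intro set_integral_finite_sum(1) set_integrable_mult_right impI ints S)
      have "tp (Bl n (duh \<mu> \<psi> t)) x = (\<Sum>k\<in>Ring n. LINT s:{0<..<t}|lborel. of_real (wt n k) * fourier_mode k x * ?e k s)"
        unfolding tpB ints(3) by simp
      also have "\<dots> = (LINT s:{0<..<t}|lborel. ?F s)"
      proof -
        have "set_integrable lborel {0<..<t} (\<lambda>s. of_real (wt n k) * fourier_mode k x * ?e k s)" for k
          by (intro set_integrable_mult_right impI ints(1))
        from set_integral_finite_sum(2)[OF S this] show ?thesis unfolding tpB heat_e ..
      qed
      also have "cmod \<dots> \<le> (LINT s:{0<..<t}|lborel. cmod (?F s))"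
        by (rule set_integral_norm_bound[OF Fi])
      also have "\<dots> \<le> (LINT s:{0<..<t}|lborel. C0 * H * blk \<beta>' n * ((t - s) powr (- a) * s powr (- b)))"
      proof (rule set_integral_mono[OF set_integrable_norm[OF Fi] gi])
        fix s assume "s \<in> {0<..<t}"
        then show "cmod (?F s) \<le> C0 * H * blk \<beta>' n * ((t - s) powr (- a) * s powr (- b))"
          using besD[OF hb, of s n x] by (simp add: mult_ac)
      qed
      also have "\<dots> = C0 * H * blk \<beta>' n * (J * t powr (1 - a - b))"
        by (simp add: J(3)[OF t(1)])
      finally show "cmod (tp (Bl n (duh \<mu> \<psi> t)) x) \<le> C0 * H * (J * t powr (1 - a - b)) * blk \<beta>' n"
        by (simp add: mult_ac)
    qed
    then show ?thesis using ints(2) by (simp add: H_def mult_ac)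
  qed
  show ?thesis
    unfolding duhamel_bound_def \<theta>_def[symmetric] a_def[symmetric]
    by (intro exI[of _ "C0 * J"] conjI allI impI mult_nonneg_nonneg C0 J; (elim conjE)?; rule main[THEN conjunct2] main[THEN conjunct1, rule_format]; blast)
qed

text \<open>Pulling exp(t \<sigma>) out of the integral leaves an indefinite integral of a fixed
  function, and integrability at the final time T suffices.\<close>

lemma duh_continuous:
  assumes "T > 0" "\<And>k. set_integrable lborel {0..T} (integrand \<mu> \<psi> T k)"
  shows "continuous_on {0..T} (\<lambda>t. duh \<mu> \<psi> t k)"
proof -
  let ?\<sigma> = "heat_symbol \<mu> k"
  let ?g = "\<lambda>s. exp (- of_real s * ?\<sigma>) * \<psi> s k"
  have e: "exp (of_real (t - s) * ?\<sigma>) * \<psi> s k = exp (of_real t * ?\<sigma>) * ?g s" for t s :: real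
    unfolding mult.assoc[symmetric] mult_exp_exp by (simp add: algebra_simps)
  have g: "set_integrable lborel {0..T} ?g"
  proof -
    have "set_integrable lborel {0..T} (\<lambda>s. exp (- of_real T * ?\<sigma>) * (exp (of_real (T - s) * ?\<sigma>) * \<psi> s k))"
      by (intro set_integrable_mult_right impI assms)
    moreover have "exp (- of_real T * ?\<sigma>) * (exp (of_real (T - s) * ?\<sigma>) * \<psi> s k) = ?g s" for s
      unfolding mult.assoc[symmetric] mult_exp_exp by (simp add: algebra_simps)
    ultimately show ?thesis by (simp only:)
  qed
  have "continuous_on {0..T} (\<lambda>t. exp (of_real t * ?\<sigma>) * integral {0..t} ?g)"
    by (intro continuous_intros indefinite_integral_continuous_1 set_borel_integral_eq_integral(1) g)
  moreover have "duh \<mu> \<psi> t k = exp (of_real t * ?\<sigma>) * integral {0..t} ?g" if "t \<in> {0..T}" for t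
  proof -
    have "set_integrable lborel {0..t} ?g" by (rule set_integrable_subset[OF g]) (use that in auto)
    from set_borel_integral_eq_integral(2)[OF this] show ?thesis
      unfolding duh_def e by simp
  qed
  ultimately show ?thesis by (subst continuous_on_cong[OF refl]) auto
qed

end

section \<open>Passing between coefficients and Besov bounds\<close>

lemma powr_le_powr_neg_abs:
  fixes t t0 q :: real
  assumes "0 < t0" "t0 \<le> t" "t \<le> 1"
  shows "t powr q \<le> t0 powr (- \<bar>q\<bar>)"
proof -
  have "t powr q \<le> t powr (- \<bar>q\<bar>)" using assms by (intro powr_mono') auto
  also have "\<dots> \<le> t0 powr (- \<bar>q\<bar>)" using assms by (intro powr_mono2') auto
  finally show ?thesis .
qed

context lp
begin

lemma tp_Bl_Ring: "tp (Bl n h) x = (\<Sum>k\<in>Ring n. of_real (wt n k) * h k * fourier_mode k x)"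
proof -
  have S: "finite (Ring n)" by (rule finite_subset[OF Ring_subset_fbox]) simp
  show ?thesis by (subst tp_eq[OF S]) (use wt_Ring in \<open>auto simp: Bl_def\<close>)
qed

text \<open>A block sees finitely many coefficients, so a uniform bound survives coefficientwise
  limits.\<close>

lemma bes_lim:
  assumes "\<And>n. bes s (g n) M" "\<And>k. (\<lambda>n. g n k) \<longlonglongrightarrow> h k"
  shows "bes s h M"
  unfolding bes_def
proof (intro allI)
  fix n x
  have "(\<lambda>j. tp (Bl n (g j)) x) \<longlonglongrightarrow> tp (Bl n h) x"
    unfolding tp_Bl_Ring by (intro tendsto_intros assms(2))
  then show "cmod (tp (Bl n h) x) \<le> M * blk s n"
    using Lim_norm_ubound[OF sequentially_bot _ always_eventually] besD[OF assms(1)] by blast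
qed

lemma bes_small_imp_zero:
  assumes "\<And>n. bes s f (M * (1 / 2) ^ n)"
  shows "f k = 0"
proof -
  obtain C where C: "C \<ge> 0" "\<And>f F. bes s f F \<Longrightarrow> cmod (f k) \<le> C * F" using coeff_le by blast
  have "(\<lambda>n. C * (M * (1 / 2) ^ n)) \<longlonglongrightarrow> C * (M * 0)"
    by (intro tendsto_intros LIMSEQ_realpow_zero) auto
  then have "cmod (f k) \<le> C * (M * 0)"
    by (rule LIMSEQ_le_const) (auto intro: C(2)[OF assms])
  then show ?thesis by simp
qed

lemma besov_cont_coeff:
  assumes X: "\<And>t. t \<in> S \<Longrightarrow> besov_member chi \<rho> s (X t)" and c: "besov_cont chi \<rho> s S X"
  shows "continuous_on S (\<lambda>t. X t k)"
  unfolding continuous_on_iff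
proof (intro ballI allI impI)
  fix t e :: real assume t: "t \<in> S" and e: "0 < e"
  obtain C where C: "C \<ge> 0" "\<And>f F. bes s f F \<Longrightarrow> cmod (f k) \<le> C * F" using coeff_le by blast
  define e' where "e' = e / (C + 1)"
  have e': "e' > 0" "C * e' < e" using e C(1) by (auto simp: e'_def field_simps)
  obtain d where d: "d > 0" "\<And>u. u \<in> S \<Longrightarrow> \<bar>u - t\<bar> < d \<Longrightarrow> besov_norm chi \<rho> s (\<lambda>k. X u k - X t k) < e'"
    using c t e' unfolding besov_cont_def by meson
  have "dist (X u k) (X t k) < e" if u: "u \<in> S" "dist u t < d" for u
  proof -
    \<comment> \<open>A small \<open>besov_norm\<close> of the difference is informative only
      together with membership, which this crude bound provides.\<close>
    have "bes s (\<lambda>k. X u k - X t k) (besov_norm chi \<rho> s (X u) + besov_norm chi \<rho> s (X t))"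
      by (intro bes_diff besov_imp_bes X u t order_refl)
    from bes_imp_besov(1)[OF this] have "bes s (\<lambda>k. X u k - X t k) e'"
      by (rule besov_imp_bes) (use d(2)[OF u(1)] u(2) in \<open>auto simp: dist_real_def\<close>)
    from C(2)[OF this] e'(2) show ?thesis by (simp add: dist_norm)
  qed
  then show "\<exists>d>0. \<forall>u\<in>S. dist u t < d \<longrightarrow> dist (X u k) (X t k) < e" using d(1) by blast
qed

lemma cmeas_besov_cont:
  assumes "\<And>t. t \<in> S \<Longrightarrow> besov_member chi \<rho> s (X t)" "besov_cont chi \<rho> s S X"
  shows "cmeas S X"
  unfolding cmeas_def
  using besov_cont_coeff[OF assms] borel_measurable_continuous_on_restrict by blast

text \<open>Continuity in \<open>C\<^sup>s\<close> follows from continuity of the coefficients and boundedness in a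
  smaller space: the latter makes the high frequency blocks uniformly small.\<close>

lemma besov_cont_of_coeff:
  assumes c: "\<And>k. continuous_on S (\<lambda>t. X t k)" and s: "s < s''"
    and b: "\<And>t. t \<in> S \<Longrightarrow> \<exists>\<eta>>0. \<exists>M. \<forall>u\<in>S. \<bar>u - t\<bar> < \<eta> \<longrightarrow> bes s'' (X u) M"
  shows "besov_cont chi \<rho> s S X"
  unfolding besov_cont_def
proof (intro ballI allI impI)
  fix t \<epsilon> :: real assume t: "t \<in> S" and \<epsilon>: "\<epsilon> > 0"
  obtain \<eta> M where \<eta>: "\<eta> > 0" and M: "\<And>u. u \<in> S \<Longrightarrow> \<bar>u - t\<bar> < \<eta> \<Longrightarrow> bes s'' (X u) M"
    using b[OF t] by blast
  have M0: "M \<ge> 0" using bes_nonneg[OF M[OF t]] \<eta> by simp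
  define r where "r = 2 powr (- (s'' - s))"
  have r: "0 < r" "r < 1" using s by (auto simp: r_def powr_less_one)
  obtain N where N: "(M + M) * r ^ N \<le> \<epsilon> / 2"
  proof -
    have "(\<lambda>N. (M + M) * r ^ N) \<longlonglongrightarrow> (M + M) * 0"
      using r by (intro tendsto_intros LIMSEQ_realpow_zero) auto
    then have "eventually (\<lambda>N. (M + M) * r ^ N < \<epsilon> / 2) sequentially"
      using \<epsilon> by (intro order_tendstoD(2)) auto
    then show ?thesis using that by (auto simp: eventually_sequentially intro: less_imp_le)
  qed
  define U where "U = (\<Union>n\<le>N. Ring n)"
  have "finite (Ring n)" for n by (rule finite_subset[OF Ring_subset_fbox]) simp
  then have U: "finite U" by (simp add: U_def)
  \<comment> \<open>A lower bound for the threshold \<epsilon>/2 * \<open>blk s n\<close> over all n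
    \<le> N, as |s (n - 1)| \<le> |s| (N + 1).\<close>
  define c where "c = \<epsilon> / 2 * 2 powr (- \<bar>s\<bar> * (real N + 1))"
  have c0: "c > 0" using \<epsilon> by (simp add: c_def)
  have "continuous_on S (\<lambda>u. \<Sum>k\<in>U. cmod (X u k - X t k))"
    by (intro continuous_intros assms(1))
  then obtain d where d: "d > 0" "\<And>u. u \<in> S \<Longrightarrow> \<bar>u - t\<bar> < d \<Longrightarrow> (\<Sum>k\<in>U. cmod (X u k - X t k)) < c"
    unfolding continuous_on_iff using t c0 by (force simp: dist_real_def)
  show "\<exists>\<delta>>0. \<forall>u\<in>S. \<bar>u - t\<bar> < \<delta> \<longrightarrow> besov_norm chi \<rho> s (\<lambda>k. X u k - X t k) < \<epsilon>"
  proof (intro exI[of _ "min d \<eta>"] conjI ballI impI)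
    show "0 < min d \<eta>" using d \<eta> by simp
    fix u assume u: "u \<in> S" "\<bar>u - t\<bar> < min d \<eta>"
    have diff: "bes s'' (\<lambda>k. X u k - X t k) (M + M)"
      by (rule bes_diff[OF M M]) (use u t \<eta> in auto)
    have "bes s (\<lambda>k. X u k - X t k) (\<epsilon> / 2)"
      unfolding bes_def
    proof (intro allI)
      fix n x
      show "cmod (tp (Bl n (\<lambda>k. X u k - X t k)) x) \<le> \<epsilon> / 2 * blk s n"
      proof (cases "n \<le> N")
        case True
        have "cmod (tp (Bl n (\<lambda>k. X u k - X t k)) x) \<le> (\<Sum>k\<in>Ring n. cmod (X u k - X t k))"
          unfolding tp_Bl_Ring
          by (rule sum_norm_le) (use wt_le_1 wt_nonneg in \<open>auto simp: norm_mult intro!: mult_left_le_one_le\<close>)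
        also have "\<dots> \<le> (\<Sum>k\<in>U. cmod (X u k - X t k))"
          by (rule sum_mono2[OF U]) (use True in \<open>auto simp: U_def\<close>)
        also have "\<dots> \<le> c" using d(2)[OF u(1)] u(2) by simp
        also have "c \<le> \<epsilon> / 2 * blk s n"
        proof -
          have "s * (real n - 1) \<le> \<bar>s\<bar> * \<bar>real n - 1\<bar>" unfolding abs_mult[symmetric] by simp
          also have "\<dots> \<le> \<bar>s\<bar> * (real N + 1)" using True by (intro mult_left_mono) auto
          finally show ?thesis unfolding c_def using \<epsilon> by (intro mult_left_mono) auto
        qed
        finally show ?thesis .
      next
        case False
        have "cmod (tp (Bl n (\<lambda>k. X u k - X t k)) x) \<le> (M + M) * blk s'' n"
          by (rule besD[OF diff])
        also have "blk s'' n = r powr (real n - 1) * blk s n"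
          by (simp add: r_def powr_powr powr_add[symmetric] algebra_simps)
        also have "(M + M) * (r powr (real n - 1) * blk s n) \<le> (M + M) * (r ^ N * blk s n)"
        proof -
          \<comment> \<open>From n > N one has n - 1 \<ge> N, which matches the shift by one in the
            block weights.\<close>
          have "r powr (real n - 1) \<le> r powr real N" using False r by (intro powr_mono') auto
          then show ?thesis using M0 r by (intro mult_left_mono mult_right_mono) (auto simp: powr_realpow)
        qed
        also have "\<dots> \<le> \<epsilon> / 2 * blk s n"
          unfolding mult.assoc[symmetric] by (intro mult_right_mono N) auto
        finally show ?thesis .
      qed
    qed
    from bes_imp_besov(2)[OF this] \<epsilon> show "besov_norm chi \<rho> s (\<lambda>k. X u k - X t k) < \<epsilon>" by simp
  qed
qed

end

section \<open>The fixed point argument\<close>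

lemma duh_diff:
  assumes "\<And>k. set_integrable lborel {0..t} (integrand \<mu> \<psi> t k)"
    "\<And>k. set_integrable lborel {0..t} (integrand \<mu> \<psi>' t k)"
  shows "duh \<mu> (\<lambda>s k. \<psi> s k - \<psi>' s k) t = (\<lambda>k. duh \<mu> \<psi> t k - duh \<mu> \<psi>' t k)"
  unfolding duh_def right_diff_distrib using set_integral_diff(2)[OF assms] by (auto simp: fun_eq_iff)

text \<open>The analytic estimates for one fixed equation on \<open>{0<..T}\<close>; \<open>N\<close> is the nonlinearity, \<open>e\<close> the
  power of time gained by the Duhamel integral, and the factor \<open>L powr (- \<kappa>)\<close> is what a weight
  \<open>exp (L * t)\<close> gains.\<close>

locale mild_setup = lp chi \<rho> B for chi \<rho> B +
  fixes \<mu> \<alpha> \<beta> \<beta>' \<gamma> \<kappa> b e q q' D C C' H T :: real and p :: nat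
    and N :: "real \<Rightarrow> distr \<Rightarrow> distr" and u0 :: distr
  assumes T: "0 < T" "T \<le> 1" and \<beta>': "\<beta> < \<beta>'" and \<kappa>: "0 < \<kappa>" and e: "0 \<le> e" and D: "0 \<le> D" and C: "0 \<le> C"
    and N_bd: "\<And>t v r. 0 < t \<Longrightarrow> t \<le> T \<Longrightarrow> 1 \<le> r \<Longrightarrow> bes \<beta> v (r * t powr (- \<gamma>)) \<Longrightarrow>
      bes (- \<alpha>) (N t v) (D * r ^ p * t powr (- b))"
    and N_lip: "\<And>t v w r \<delta>. 0 < t \<Longrightarrow> t \<le> T \<Longrightarrow> 1 \<le> r \<Longrightarrow> 0 \<le> \<delta> \<Longrightarrow> bes \<beta> v (r * t powr (- \<gamma>)) \<Longrightarrow>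
      bes \<beta> w (r * t powr (- \<gamma>)) \<Longrightarrow> bes \<beta> (\<lambda>k. v k - w k) (\<delta> * t powr (- \<gamma>)) \<Longrightarrow>
      bes (- \<alpha>) (\<lambda>k. N t v k - N t w k) (D * r ^ p * \<delta> * t powr (- b))"
    and N_meas: "\<And>v. cmeas {0<..T} v \<Longrightarrow> cmeas {0<..T} (\<lambda>s. N s (v s))"
    and dC: "duhamel_bound \<mu> \<alpha> b \<kappa> \<beta> C" and dC': "duhamel_bound \<mu> \<alpha> b \<kappa> \<beta>' C'"
    and e_eq: "e = \<gamma> + 1 - ((\<beta> + \<alpha>) / 2 + \<kappa>) - b" and q_eq: "q = 1 - ((\<beta>' + \<alpha>) / 2 + \<kappa>) - b"
    and heat_small: "\<And>t. 0 < t \<Longrightarrow> t \<le> T \<Longrightarrow> bes \<beta> (heat \<mu> t u0) (1 / 2 * t powr (- \<gamma>))"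
    and heat_reg: "\<And>t. 0 < t \<Longrightarrow> t \<le> T \<Longrightarrow> bes \<beta>' (heat \<mu> t u0) (H * t powr q')"
    and small: "C * D * exp 1 * T powr e \<le> 1 / 2"
    and H: "0 \<le> H" and C': "0 \<le> C'"
begin

abbreviation W :: "real \<Rightarrow> real" where "W t \<equiv> t powr (- \<gamma>)"

lemma time_gain: "t powr (1 - ((\<beta> + \<alpha>) / 2 + \<kappa>) - b) = t powr e * W t"
  by (simp add: powr_add[symmetric] e_eq algebra_simps)

lemmas duh_bes = duhamel_boundD(2)[OF dC, unfolded time_gain]

text \<open>The shape of \<open>mild_solution\<close> with an abstract nonlinearity, so that the two
  coincide by unfolding once N is instantiated.\<close>

definition mild :: "(real \<Rightarrow> distr) \<Rightarrow> bool" where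
  "mild v \<longleftrightarrow> (\<forall>t\<in>{0<..T}. besov_member chi \<rho> \<beta> (v t)) \<and> besov_cont chi \<rho> \<beta> {0<..T} v \<and>
     (\<exists>C. \<forall>t\<in>{0<..T}. t powr \<gamma> * besov_norm chi \<rho> \<beta> (v t) \<le> C) \<and>
     (\<forall>t\<in>{0<..T}. \<forall>k. set_integrable lborel {0..t} (integrand \<mu> (\<lambda>s. N s (v s)) t k) \<and>
        v t k = exp (of_real t * heat_symbol \<mu> k) * u0 k +
          (LINT s:{0..t}|lborel. exp (of_real (t - s) * heat_symbol \<mu> k) * N s (v s) k))"

definition \<Phi> :: "(real \<Rightarrow> distr) \<Rightarrow> real \<Rightarrow> distr" where
  "\<Phi> v t k = heat \<mu> t u0 k + duh \<mu> (\<lambda>s. N s (v s)) t k"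

definition bdd :: "real \<Rightarrow> (real \<Rightarrow> distr) \<Rightarrow> bool" where
  "bdd r v \<longleftrightarrow> cmeas {0<..T} v \<and> (\<forall>t. 0 < t \<longrightarrow> t \<le> T \<longrightarrow> bes \<beta> (v t) (r * W t))"

lemma N_bd_exp:
  assumes "bdd r v" "1 \<le> r" "0 < L" "0 < s" "s \<le> T"
  shows "bes (- \<alpha>) (N s (v s)) (D * r ^ p * s powr (- b) * exp (L * s))"
proof (rule bes_mono[OF N_bd[OF assms(4,5,2)]])
  show "bes \<beta> (v s) (r * W s)" using assms by (auto simp: bdd_def)
  have "1 \<le> exp (L * s)" using assms by simp
  from mult_left_mono[OF this, of "D * r ^ p * s powr (- b)"]
  show "D * r ^ p * s powr (- b) \<le> D * r ^ p * s powr (- b) * exp (L * s)"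
    using D assms by simp
qed

lemma N_cmeas: "bdd r v \<Longrightarrow> t \<le> T \<Longrightarrow> cmeas {0<..t} (\<lambda>s. N s (v s))"
  by (rule cmeas_subset[OF N_meas]) (auto simp: bdd_def)

lemma N_int:
  assumes "bdd r v" "1 \<le> r" "0 < t" "t \<le> T"
  shows "set_integrable lborel {0..t} (integrand \<mu> (\<lambda>s. N s (v s)) t k)"
  by (rule duhamel_boundD(1)[OF dC assms(3) _ zero_less_one _ N_cmeas[OF assms(1,4)], of "D * r ^ p"])
     (use N_bd_exp[OF assms(1,2) zero_less_one] assms D T in auto)

text \<open>The common source of contraction and uniqueness: L = 1 is used on a short interval, a
  large L for solutions of arbitrary size r.\<close>

lemma \<Phi>_diff:
  assumes v: "bdd r v" and w: "bdd r w" and r: "1 \<le> r" and L: "0 < L" and \<delta>: "0 \<le> \<delta>"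
    and d: "\<And>s. 0 < s \<Longrightarrow> s \<le> T \<Longrightarrow> bes \<beta> (\<lambda>k. v s k - w s k) (\<delta> * exp (L * s) * W s)"
    and t: "0 < t" "t \<le> T"
  shows "bes \<beta> (\<lambda>k. \<Phi> v t k - \<Phi> w t k)
    (C * (D * r ^ p * \<delta>) * L powr (- \<kappa>) * exp (L * t) * (t powr e * W t))"
proof -
  let ?\<psi> = "\<lambda>s k. N s (v s) k - N s (w s) k"
  have "(\<lambda>k. \<Phi> v t k - \<Phi> w t k) = duh \<mu> ?\<psi> t"
    unfolding duh_diff[OF N_int[OF v r t] N_int[OF w r t]] by (simp add: \<Phi>_def)
  moreover have "bes \<beta> (duh \<mu> ?\<psi> t) (C * (D * r ^ p * \<delta>) * L powr (- \<kappa>) * exp (L * t) * (t powr e * W t))"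
  proof (rule duh_bes[OF t(1) order_trans[OF t(2) T(2)] L])
    show "0 \<le> D * r ^ p * \<delta>" using D r \<delta> by simp
    show "cmeas {0<..t} ?\<psi>"
      using N_cmeas[OF v t(2)] N_cmeas[OF w t(2)] unfolding cmeas_def by (intro allI borel_measurable_diff) auto
    fix s assume s: "0 < s" "s < t"
    have "bes (- \<alpha>) (?\<psi> s) (D * r ^ p * (\<delta> * exp (L * s)) * s powr (- b))"
      by (rule N_lip) (use v w s t r d \<delta> in \<open>auto simp: bdd_def\<close>)
    then show "bes (- \<alpha>) (?\<psi> s) (D * r ^ p * \<delta> * s powr (- b) * exp (L * s))" by (simp add: mult_ac)
  qed
  ultimately show ?thesis by simp
qed

lemma small': "0 < t \<Longrightarrow> t \<le> T \<Longrightarrow> C * D * exp t * t powr e \<le> 1 / 2"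
proof -
  assume t: "0 < t" "t \<le> T"
  have "C * D * exp t * t powr e \<le> C * D * exp 1 * T powr e"
    using t T C D e by (intro mult_mono powr_mono2) auto
  then show ?thesis using small by simp
qed

lemma coeff_continuous:
  assumes "bdd r v" "1 \<le> r"
  shows "continuous_on {0..T} (\<lambda>t. \<Phi> v t k)"
proof -
  have "continuous_on {0..T} (\<lambda>t. duh \<mu> (\<lambda>s. N s (v s)) t k)"
    by (rule duh_continuous[OF T(1)]) (rule N_int[OF assms T(1) order_refl])
  then show ?thesis unfolding \<Phi>_def heat_def by (intro continuous_intros)
qed

lemma \<Phi>_bdd:
  assumes v: "bdd 1 v" shows "bdd 1 (\<Phi> v)"
  unfolding bdd_def
proof (intro conjI allI impI)
  have "continuous_on {0<..T} (\<lambda>t. \<Phi> v t k)" for k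
    by (rule continuous_on_subset[OF coeff_continuous[OF v]]) auto
  then show "cmeas {0<..T} (\<Phi> v)"
    unfolding cmeas_def using borel_measurable_continuous_on_restrict by blast
  fix t assume t: "0 < t" "t \<le> T"
  have "bes \<beta> (duh \<mu> (\<lambda>s. N s (v s)) t) (C * D * 1 powr (- \<kappa>) * exp (1 * t) * (t powr e * W t))"
    by (rule duh_bes[OF t(1) _ _ D N_cmeas[OF v t(2)]])
       (use N_bd_exp[OF v order_refl zero_less_one] t T in auto)
  then have "bes \<beta> (duh \<mu> (\<lambda>s. N s (v s)) t) (1 / 2 * W t)"
    by (rule bes_mono) (use small'[OF t] mult_right_mono[OF small'[OF t], of "W t"] in \<open>simp add: mult_ac\<close>)
  from bes_add[OF heat_small[OF t] this] show "bes \<beta> (\<Phi> v t) (1 * W t)"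
    unfolding \<Phi>_def[abs_def] by simp
qed

text \<open>With L = 1 the weight costs at most exp 1, which the assumption \<open>small\<close>
  already contains; the factor 1/2 comes from t^e.\<close>

lemma \<Phi>_contraction:
  assumes v: "bdd 1 v" and w: "bdd 1 w" and \<delta>: "0 \<le> \<delta>"
    and d: "\<And>s. 0 < s \<Longrightarrow> s \<le> T \<Longrightarrow> bes \<beta> (\<lambda>k. v s k - w s k) (\<delta> * W s)"
    and t: "0 < t" "t \<le> T"
  shows "bes \<beta> (\<lambda>k. \<Phi> v t k - \<Phi> w t k) (\<delta> / 2 * W t)"
proof -
  have main: "bes \<beta> (\<lambda>k. \<Phi> v t k - \<Phi> w t k)
    (C * (D * 1 ^ p * \<delta>) * 1 powr (- \<kappa>) * exp (1 * t) * (t powr e * W t))"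
  proof (rule \<Phi>_diff[OF v w order_refl zero_less_one \<delta> _ t])
    fix s assume s: "0 < s" "s \<le> T"
    have "1 \<le> exp s" using s by simp
    then show "bes \<beta> (\<lambda>k. v s k - w s k) (\<delta> * exp (1 * s) * W s)"
      using \<delta> by (intro bes_mono[OF d[OF s]] mult_right_mono) (auto simp: mult_le_cancel_left1)
  qed
  have "C * (D * 1 ^ p * \<delta>) * 1 powr (- \<kappa>) * exp (1 * t) * (t powr e * W t) =
     (C * D * exp t * t powr e) * (\<delta> * W t)" by simp
  also have "\<dots> \<le> 1 / 2 * (\<delta> * W t)"
    using \<delta> by (intro mult_right_mono small' t) auto
  finally show ?thesis using bes_mono[OF main] by simp
qed

fun picard :: "nat \<Rightarrow> real \<Rightarrow> distr" where
  "picard 0 = (\<lambda>_ _. 0)"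
| "picard (Suc n) = \<Phi> (picard n)"

lemma picard_bdd: "bdd 1 (picard n)"
proof (induction n)
  case 0
  have "bes \<beta> (\<lambda>k. 0) (1 * W t)" for t by (rule bes_mono[OF bes_zero]) simp
  then show ?case by (simp add: bdd_def cmeas_const)
qed (simp add: \<Phi>_bdd)

lemma picard_step:
  "0 < t \<Longrightarrow> t \<le> T \<Longrightarrow> bes \<beta> (\<lambda>k. picard (Suc n) t k - picard n t k) ((1 / 2) ^ n * W t)"
proof (induction n arbitrary: t)
  case 0
  then show ?case using \<Phi>_bdd[OF picard_bdd[of 0]] by (simp add: bdd_def)
next
  case (Suc n)
  have "bes \<beta> (\<lambda>k. \<Phi> (picard (Suc n)) t k - \<Phi> (picard n) t k) ((1 / 2) ^ n / 2 * W t)"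
    by (rule \<Phi>_contraction[OF picard_bdd picard_bdd _ Suc.IH]) (use Suc.prems in auto)
  then show ?case by simp
qed

text \<open>The exact geometric difference, rather than its upper bound 2 (1/2)^n, makes the
  induction on j close.\<close>

lemma picard_tail:
  assumes t: "0 < t" "t \<le> T"
  shows "bes \<beta> (\<lambda>k. picard (n + j) t k - picard n t k) ((2 * (1 / 2) ^ n - 2 * (1 / 2) ^ (n + j)) * W t)"
proof (induction j)
  case (Suc j)
  from bes_add[OF picard_step[OF t, of "n + j"] Suc.IH] show ?case by (simp add: algebra_simps)
qed (simp add: bes_zero)

text \<open>The limit is taken coefficient by coefficient in place of an appeal to completeness of
  C^\<beta>; bounds are recovered through \<open>bes_lim\<close>.\<close>

definition sol :: "real \<Rightarrow> distr" where "sol t k = lim (\<lambda>n. picard n t k)"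

lemma picard_tendsto:
  assumes t: "0 < t" "t \<le> T"
  shows "(\<lambda>n. picard n t k) \<longlonglongrightarrow> sol t k"
proof -
  obtain Ck where Ck: "Ck \<ge> 0" "\<And>f F. bes \<beta> f F \<Longrightarrow> cmod (f k) \<le> Ck * F" using coeff_le by blast
  have "summable (\<lambda>n. picard (Suc n) t k - picard n t k)"
  proof (rule summable_comparison_test')
    show "summable (\<lambda>n. Ck * ((1 / 2) ^ n * W t))"
      by (intro summable_mult summable_mult2 summable_geometric) simp
    show "cmod (picard (Suc n) t k - picard n t k) \<le> Ck * ((1 / 2) ^ n * W t)" for n
      by (rule Ck(2)[OF picard_step[OF t]])
  qed
  then obtain l where "(\<lambda>n. \<Sum>i<n. picard (Suc i) t k - picard i t k) \<longlonglongrightarrow> l"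
    by (auto simp: summable_def sums_def)
  then have "(\<lambda>n. picard n t k) \<longlonglongrightarrow> l"
    using sum_lessThan_telescope[of "\<lambda>n. picard n t k"] by simp
  then show ?thesis unfolding sol_def by (simp add: limI)
qed

lemma sol_bdd: "bdd 1 sol"
  unfolding bdd_def
proof (intro conjI allI impI)
  show "cmeas {0<..T} sol"
    using picard_bdd unfolding cmeas_def bdd_def sol_def[abs_def]
    by (intro allI borel_measurable_lim_metric) blast
  show "bes \<beta> (sol t) (1 * W t)" if t: "0 < t" "t \<le> T" for t
    using picard_bdd by (intro bes_lim[OF _ picard_tendsto[OF t]]) (use t in \<open>auto simp: bdd_def\<close>)
qed

lemma sol_picard:
  assumes t: "0 < t" "t \<le> T"
  shows "bes \<beta> (\<lambda>k. sol t k - picard n t k) (2 * (1 / 2) ^ n * W t)"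
proof (rule bes_lim[where g = "\<lambda>j k. picard (n + j) t k - picard n t k"])
  show "bes \<beta> (\<lambda>k. picard (n + j) t k - picard n t k) (2 * (1 / 2) ^ n * W t)" for j
    by (rule bes_mono[OF picard_tail[OF t]]) (intro mult_right_mono; simp)
  show "(\<lambda>j. picard (n + j) t k - picard n t k) \<longlonglongrightarrow> sol t k - picard n t k" for k
    using LIMSEQ_ignore_initial_segment[OF picard_tendsto[OF t], of n k]
    by (intro tendsto_diff tendsto_const) (simp add: add.commute)
qed

text \<open>Both sides are compared with \<open>picard (Suc n)\<close>; the distance tends to 0
  geometrically, so all coefficients agree.\<close>

lemma sol_fixed:
  assumes t: "0 < t" "t \<le> T" shows "sol t k = \<Phi> sol t k"
proof -
  have "bes \<beta> (\<lambda>k. \<Phi> sol t k - sol t k) (2 * W t * (1 / 2) ^ n)" for n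
  proof -
    have 1: "bes \<beta> (\<lambda>k. \<Phi> sol t k - \<Phi> (picard n) t k) (2 * (1 / 2) ^ n / 2 * W t)"
      by (rule \<Phi>_contraction[OF sol_bdd picard_bdd _ sol_picard t]) auto
    have 2: "bes \<beta> (\<lambda>k. sol t k - \<Phi> (picard n) t k) ((1 / 2) ^ n * W t)"
      using sol_picard[OF t, of "Suc n"] by simp
    show ?thesis using bes_diff[OF 1 2] by (simp add: mult_ac)
  qed
  from bes_small_imp_zero[OF this, of k] show ?thesis by simp
qed

text \<open>Boundedness in a space smaller than C^\<beta>, locally in time, as
  \<open>besov_cont_of_coeff\<close> requires for continuity in C^\<beta>.\<close>

lemma \<Phi>_reg:
  assumes v: "bdd 1 v" and t: "0 < t" "t \<le> T"
  shows "bes \<beta>' (\<Phi> v t) (H * t powr q' + C' * D * exp t * t powr q)"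
proof -
  have "bes \<beta>' (duh \<mu> (\<lambda>s. N s (v s)) t) (C' * D * 1 powr (- \<kappa>) * exp (1 * t) * t powr q)"
    unfolding q_eq by (rule duhamel_boundD(2)[OF dC' t(1) _ _ D N_cmeas[OF v t(2)]])
       (use N_bd_exp[OF v order_refl zero_less_one] t T in auto)
  from bes_add[OF heat_reg[OF t] this] show ?thesis unfolding \<Phi>_def[abs_def] by simp
qed

theorem mild_exists: "mild sol"
  unfolding mild_def
proof (intro conjI ballI allI)
  have sb: "bes \<beta> (sol t) (W t)" if "t \<in> {0<..T}" for t
    using sol_bdd that by (simp add: bdd_def)
  show "besov_member chi \<rho> \<beta> (sol t)" if "t \<in> {0<..T}" for t
    using bes_imp_besov(1)[OF sb[OF that]] .
  have "t powr \<gamma> * besov_norm chi \<rho> \<beta> (sol t) \<le> 1" if t: "t \<in> {0<..T}" for t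
  proof -
    have "t powr \<gamma> * besov_norm chi \<rho> \<beta> (sol t) \<le> t powr \<gamma> * W t"
      by (intro mult_left_mono bes_imp_besov(2)[OF sb[OF t]]) auto
    also have "\<dots> = 1" using t by (simp add: powr_minus)
    finally show ?thesis .
  qed
  then show "\<exists>C. \<forall>t\<in>{0<..T}. t powr \<gamma> * besov_norm chi \<rho> \<beta> (sol t) \<le> C" by blast
  show "set_integrable lborel {0..t} (integrand \<mu> (\<lambda>s. N s (sol s)) t k)"
    if "t \<in> {0<..T}" for t k
    using N_int[OF sol_bdd] that by auto
  show "sol t k = exp (of_real t * heat_symbol \<mu> k) * u0 k +
      (LINT s:{0..t}|lborel. exp (of_real (t - s) * heat_symbol \<mu> k) * N s (sol s) k)" if "t \<in> {0<..T}" for t k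
    using sol_fixed[of t k] that by (simp add: \<Phi>_def heat_def duh_def)
  show "besov_cont chi \<rho> \<beta> {0<..T} sol"
  proof (rule besov_cont_of_coeff[OF _ \<beta>'])
    show "continuous_on {0<..T} (\<lambda>t. sol t k)" for k
    proof -
      have "continuous_on {0<..T} (\<lambda>t. \<Phi> sol t k)"
        by (rule continuous_on_subset[OF coeff_continuous[OF sol_bdd order_refl]]) auto
      then show ?thesis by (subst continuous_on_cong[OF refl sol_fixed]) auto
    qed
    fix t assume t: "t \<in> {0<..T}"
    show "\<exists>\<eta>>0. \<exists>M. \<forall>u\<in>{0<..T}. \<bar>u - t\<bar> < \<eta> \<longrightarrow> bes \<beta>' (sol u) M"
    \<comment> \<open>The window keeps u above t/2. Negative absolute exponents bound the two powers
      of u whatever the signs of q and q'.\<close>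
    proof (rule exI[of _ "t / 2"], rule conjI[rotated],
        rule exI[of _ "H * (t / 2) powr (- \<bar>q'\<bar>) + C' * D * exp 1 * (t / 2) powr (- \<bar>q\<bar>)"], intro ballI impI)
      show "0 < t / 2" using t by simp
      fix u assume u: "u \<in> {0<..T}" "\<bar>u - t\<bar> < t / 2"
      then have u2: "t / 2 \<le> u" "u \<le> 1" using T unfolding greaterThanAtMost_iff by linarith+
      have "sol u = \<Phi> sol u" using sol_fixed u by auto
      moreover have "bes \<beta>' (\<Phi> sol u) (H * (t / 2) powr (- \<bar>q'\<bar>) + C' * D * exp 1 * (t / 2) powr (- \<bar>q\<bar>))"
        by (rule bes_mono[OF \<Phi>_reg[OF sol_bdd]])
           (use u u2 t H C' D powr_le_powr_neg_abs[of "t / 2" u] in \<open>auto intro!: add_mono mult_mono mult_left_mono\<close>)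
      ultimately show "bes \<beta>' (sol u) (H * (t / 2) powr (- \<bar>q'\<bar>) + C' * D * exp 1 * (t / 2) powr (- \<bar>q\<bar>))" by simp
    qed
  qed
qed

lemma mild_bdd:
  assumes "mild v" obtains r where "1 \<le> r" "\<And>r'. r \<le> r' \<Longrightarrow> bdd r' v"
proof -
  obtain C where C: "\<And>t. t \<in> {0<..T} \<Longrightarrow> t powr \<gamma> * besov_norm chi \<rho> \<beta> (v t) \<le> C"
    using assms unfolding mild_def by blast
  have m: "besov_member chi \<rho> \<beta> (v t)" if "t \<in> {0<..T}" for t using assms that unfolding mild_def by blast
  show ?thesis
  proof
    show "1 \<le> max 1 C" by simp
    fix r' assume r': "max 1 C \<le> r'"
    show "bdd r' v"
      unfolding bdd_def
    proof (intro conjI allI impI)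
      show "cmeas {0<..T} v"
        by (rule cmeas_besov_cont[OF m]) (use assms in \<open>auto simp: mild_def\<close>)
      fix t assume t: "0 < t" "t \<le> T"
      have "t powr \<gamma> * besov_norm chi \<rho> \<beta> (v t) \<le> r'" using C[of t] r' t by simp
      then have "W t * (t powr \<gamma> * besov_norm chi \<rho> \<beta> (v t)) \<le> W t * r'"
        by (intro mult_left_mono) auto
      then have "besov_norm chi \<rho> \<beta> (v t) \<le> r' * W t"
        using t by (simp add: powr_minus field_simps)
      then show "bes \<beta> (v t) (r' * W t)" by (intro besov_imp_bes m) (use t in auto)
    qed
  qed
qed

lemma mild_fixed: "mild v \<Longrightarrow> 0 < t \<Longrightarrow> t \<le> T \<Longrightarrow> v t = \<Phi> v t"
  unfolding mild_def \<Phi>_def[abs_def] heat_def duh_def by auto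

text \<open>No smallness of the time interval is needed here: a large exponential weight makes the
  fixed point map contract.\<close>

theorem mild_unique:
  assumes v: "mild v" and w: "mild w" and t: "t \<in> {0<..T}"
  shows "v t = w t"
proof -
  obtain rv where rv: "1 \<le> rv" "\<And>r'. rv \<le> r' \<Longrightarrow> bdd r' v" using mild_bdd[OF v] by metis
  obtain rw where rw: "1 \<le> rw" "\<And>r'. rw \<le> r' \<Longrightarrow> bdd r' w" using mild_bdd[OF w] by metis
  define r where "r = max rv rw"
  have r: "1 \<le> r" "bdd r v" "bdd r w" using rv rw by (auto simp: r_def)
  define X where "X = C * (D * r ^ p)"
  \<comment> \<open>With L = A^(1/\<kappa>) the factor X L^(-\<kappa>) equals X/(2X + 1), which is
    below 1/2.\<close>
  define A where "A = 2 * X + 1"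
  have "X \<ge> 0" using C D r by (simp add: X_def)
  then have A: "A \<ge> 1" by (simp add: A_def)
  define L where "L = A powr (1 / \<kappa>)"
  have L: "L > 0" using A by (simp add: L_def)
  have LA: "C * (D * r ^ p) * L powr (- \<kappa>) \<le> 1 / 2"
  proof -
    have "L powr (- \<kappa>) = inverse A" using \<kappa> A by (simp add: L_def powr_powr powr_minus)
    moreover have "X * inverse A \<le> 1 / 2" using A by (simp add: A_def field_simps)
    ultimately show ?thesis by (simp add: X_def)
  qed
  \<comment> \<open>The difference starts below 2r in the weighted norm, and each further use of the
    fixed point equation halves it.\<close>
  have main: "0 < s \<Longrightarrow> s \<le> T \<Longrightarrow> bes \<beta> (\<lambda>k. v s k - w s k) (2 * r * (1 / 2) ^ n * exp (L * s) * W s)" for n s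
  proof (induction n arbitrary: s)
    case 0
    have "bes \<beta> (\<lambda>k. v s k - w s k) (r * W s + r * W s)"
      by (rule bes_diff) (use r 0 in \<open>auto simp: bdd_def\<close>)
    moreover have "r * W s + r * W s \<le> 2 * r * 1 * exp (L * s) * W s"
    proof -
      have "1 \<le> exp (L * s)" using L 0 by simp
      then have "2 * r * W s * 1 \<le> 2 * r * W s * exp (L * s)"
        using r by (intro mult_left_mono) auto
      then show ?thesis by (simp add: mult_ac)
    qed
    ultimately show ?case by (simp add: bes_mono)
  next
    case (Suc n)
    let ?\<delta> = "2 * r * (1 / 2) ^ n"
    have "bes \<beta> (\<lambda>k. \<Phi> v s k - \<Phi> w s k) (C * (D * r ^ p * ?\<delta>) * L powr (- \<kappa>) * exp (L * s) * (s powr e * W s))"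
      by (rule \<Phi>_diff[OF r(2,3,1) L _ Suc.IH Suc.prems]) (use r in auto)
    moreover have "C * (D * r ^ p * ?\<delta>) * L powr (- \<kappa>) * exp (L * s) * (s powr e * W s) =
        (C * (D * r ^ p) * L powr (- \<kappa>)) * s powr e * (?\<delta> * exp (L * s) * W s)" by simp
    moreover have "\<dots> \<le> 1 / 2 * 1 * (?\<delta> * exp (L * s) * W s)"
      using Suc.prems T e r by (intro mult_right_mono mult_mono LA powr_le1) auto
    ultimately have "bes \<beta> (\<lambda>k. \<Phi> v s k - \<Phi> w s k) (1 / 2 * 1 * (?\<delta> * exp (L * s) * W s))"
      by (auto intro: bes_mono)
    then show ?case using mild_fixed[OF v Suc.prems] mild_fixed[OF w Suc.prems] by (simp add: mult_ac)
  qed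
  have "v t k - w t k = 0" for k
  proof (rule bes_small_imp_zero[of \<beta> _ "2 * r * exp (L * t) * W t"])
    show "bes \<beta> (\<lambda>k. v t k - w t k) (2 * r * exp (L * t) * W t * (1 / 2) ^ n)" for n
      using main[of t n] t by (simp add: mult_ac)
  qed
  then show ?thesis by (simp add: fun_eq_iff)
qed

end

section \<open>Noise bounds, choice of exponents and conclusion\<close>

lemma small_power_le:
  fixes A p :: real
  assumes "0 \<le> A" "0 < p"
  shows "\<exists>\<tau>>0. \<forall>t. 0 < t \<and> t \<le> \<tau> \<longrightarrow> A * t powr p \<le> 1 / 2"
\<comment> \<open>The threshold solves (A + 1) t^p = 1/2; the summand 1 covers A = 0.\<close>
proof (intro exI[of _ "(1 / (2 * (A + 1))) powr (1 / p)"] conjI allI impI)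
  show "0 < (1 / (2 * (A + 1))) powr (1 / p)" using assms by simp
  fix t assume t: "0 < t \<and> t \<le> (1 / (2 * (A + 1))) powr (1 / p)"
  then have "t powr p \<le> ((1 / (2 * (A + 1))) powr (1 / p)) powr p" using assms by (intro powr_mono2) auto
  also have "\<dots> = 1 / (2 * (A + 1))" using assms by (simp add: powr_powr)
  finally have "A * t powr p \<le> A * (1 / (2 * (A + 1)))" using assms by (intro mult_left_mono) auto
  also have "\<dots> \<le> 1 / 2" using assms by (simp add: field_simps)
  finally show "A * t powr p \<le> 1 / 2" .
qed

lemma Zx_cases:
  assumes "a \<le> m + 1" "b \<le> m"
  obtains "a = 0" "b = 0" "Zx Z Zh a b = (\<lambda>_. dunit)"
  | "a = 1" "b = 0" "Zx Z Zh a b = Z"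
  | "a = 0" "b = 1" "Zx Z Zh a b = (\<lambda>t. dconj (Z t))"
  | i j where "(i, j) \<in> Lset m" "i + j = a + b" "Zx Z Zh a b = Zh i j"
  | i j where "(i, j) \<in> Lset m" "i + j = a + b" "Zx Z Zh a b = (\<lambda>t. dconj (Zh i j t))"
proof -
  consider "a = 0 \<and> b = 0" | "a = 1 \<and> b = 0" | "a = 0 \<and> b = 1" | "a + b > 1 \<and> b \<le> a" | "a + b > 1 \<and> a < b"
    by linarith
  then show ?thesis
  proof cases
    case 4
    show ?thesis by (rule that(4)[of a b]) (use assms 4 in \<open>auto simp: Zx_def Lset_def fun_eq_iff\<close>)
  next
    case 5
    show ?thesis by (rule that(5)[of b a]) (use assms 5 in \<open>auto simp: Zx_def Lset_def fun_eq_iff\<close>)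
  qed (auto simp: Zx_def fun_eq_iff intro: that(1,2,3))
qed

context lp
begin

text \<open>Since t \<le> 1 and \<alpha>' \<le> \<gamma>, the weight t^(-(i+j-1)\<alpha>') is
  dominated by (t^(-\<gamma>))^(i+j). The maximum with 0 is taken because K is an arbitrary
  real.\<close>

lemma noise_bes:
  assumes n: "noise_bound chi \<rho> m \<alpha> \<alpha>' T Z Zh K" and t: "0 < t" "t \<le> T" "t \<le> 1"
    and p: "0 < \<alpha>'" "\<alpha>' \<le> \<gamma>" and ij: "(i, j) \<in> Lset m"
  shows "bes (- \<alpha>) (Zh i j t) (max K 0 * (t powr (- \<gamma>)) ^ (i + j))"
proof -
  have m: "besov_member chi \<rho> (- \<alpha>) (Zh i j t)"
    and le: "t powr ((real (i + j) - 1) * \<alpha>') * besov_norm chi \<rho> (- \<alpha>) (Zh i j t) \<le> K"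
    using n ij t unfolding noise_bound_def by auto
  have ij1: "1 \<le> real (i + j)" using ij by (auto simp: Lset_def)
  have "besov_norm chi \<rho> (- \<alpha>) (Zh i j t) =
     t powr (- ((real (i + j) - 1) * \<alpha>')) * (t powr ((real (i + j) - 1) * \<alpha>') * besov_norm chi \<rho> (- \<alpha>) (Zh i j t))"
    using t(1) by (simp add: mult.assoc[symmetric] powr_add[symmetric])
  also have "\<dots> \<le> t powr (- ((real (i + j) - 1) * \<alpha>')) * max K 0"
    using le by (intro mult_left_mono) auto
  also have "\<dots> \<le> t powr (- \<gamma> * real (i + j)) * max K 0"
  proof (intro mult_right_mono powr_mono')
    have "(real (i + j) - 1) * \<alpha>' \<le> real (i + j) * \<gamma>" using ij1 p by (intro mult_mono) auto
    then show "- \<gamma> * real (i + j) \<le> - ((real (i + j) - 1) * \<alpha>')" by (simp add: mult.commute)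
  qed (use t in auto)
  also have "t powr (- \<gamma> * real (i + j)) = (t powr (- \<gamma>)) ^ (i + j)"
    using t(1) by (simp add: powr_realpow[symmetric] powr_powr)
  finally show ?thesis by (intro besov_imp_bes[OF m]) (simp add: mult.commute)
qed

text \<open>The three lower bounds on K' cover the constant 1, the noise itself and its
  conjugates.\<close>

lemma Zx_bes:
  assumes n: "noise_bound chi \<rho> m \<alpha> \<alpha>' T Z Zh K" and t: "0 < t" "t \<le> T" "t \<le> 1"
    and p: "0 < \<alpha>'" "\<alpha>' \<le> \<gamma>" and ab: "a \<le> m + 1" "b \<le> m"
    and K': "2 powr \<bar>\<alpha>\<bar> \<le> K'" "max K 0 \<le> K'" "165 * 2 powr \<bar>\<alpha>\<bar> * (4 * B) * max K 0 \<le> K'"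
  shows "bes (- \<alpha>) (Zx Z Zh a b t) (K' * (t powr (- \<gamma>)) ^ (a + b))"
proof -
  let ?W = "t powr (- \<gamma>)"
  have W: "1 \<le> ?W" using t p by (simp add: powr_minus one_le_inverse powr_le1)
  have K0: "0 \<le> K'" using K'(2) by simp
  have c: "bes (- \<alpha>) (dconj f) (K' * X)" if "bes (- \<alpha>) f (max K 0 * X)" "0 \<le> X" for f X
    using bes_mono[OF bes_dconj[OF that(1)] ] mult_right_mono[OF K'(3) that(2)] by (simp add: mult.assoc)
  have Z: "bes (- \<alpha>) (Z t) (max K 0 * ?W ^ 1)"
  proof -
    have "bes (- \<alpha>) (Z t) K" using n t unfolding noise_bound_def by (auto intro: besov_imp_bes)
    moreover have "K * 1 \<le> max K 0 * ?W ^ 1" using W by (intro mult_mono) auto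
    ultimately show ?thesis by (auto intro: bes_mono)
  qed
  have X0: "0 \<le> ?W ^ i" for i by simp
  have Zh: "bes (- \<alpha>) (Zh i j t) (K' * ?W ^ (i + j))" "bes (- \<alpha>) (dconj (Zh i j t)) (K' * ?W ^ (i + j))"
    if "(i, j) \<in> Lset m" for i j
    using bes_mono[OF noise_bes[OF n t p that] mult_right_mono[OF K'(2) X0]] c[OF noise_bes[OF n t p that] X0] by auto
  from ab show ?thesis
  proof (cases rule: Zx_cases[where Z = Z and Zh = Zh])
    case 1
    then show ?thesis using bes_mono[OF bes_dunit[of "- \<alpha>"]] K'(1) by simp
  next
    case 2
    then show ?thesis using bes_mono[OF Z mult_right_mono[OF K'(2) X0]] by simp
  next
    case 3
    then show ?thesis using c[OF Z X0] by simp
  next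
    case (4 i j)
    then show ?thesis using Zh(1)[of i j] by simp
  next
    case (5 i j)
    then show ?thesis using Zh(2)[of i j] by simp
  qed
qed

lemma Zx_cmeas:
  assumes n: "noise_bound chi \<rho> m \<alpha> \<alpha>' T Z Zh K" and ab: "a \<le> m + 1" "b \<le> m"
  shows "cmeas {0<..T} (Zx Z Zh a b)"
proof -
  have "cmeas {0..T} Z"
    by (rule cmeas_besov_cont[where s = "- \<alpha>"]) (use n in \<open>auto simp: noise_bound_def\<close>)
  then have Z: "cmeas {0<..T} Z" by (rule cmeas_subset) auto
  have Zh: "cmeas {0<..T} (Zh i j)" if "(i, j) \<in> Lset m" for i j
    by (rule cmeas_besov_cont[where s = "- \<alpha>"]) (use n that in \<open>auto simp: noise_bound_def\<close>)
  from ab show ?thesis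
    by (cases rule: Zx_cases[where Z = Z and Zh = Zh]) (simp_all add: cmeas_const Z Zh cmeas_dconj)
qed

lemma local_well_posedness:
  fixes m :: nat and \<mu> \<alpha>0 \<alpha> \<alpha>' \<beta> \<gamma> T R K :: real
  assumes m: "m \<ge> 1" and \<beta>: "\<beta> > 0" and \<gamma>: "\<gamma> < 1 / (2 * real m + 1)" and \<mu>: "\<mu> > 0" and \<alpha>0: "\<alpha>0 > 0"
    and g: "(\<alpha>0 + \<beta>) / 2 < \<gamma>" and \<alpha>: "0 < \<alpha>" "\<alpha> < \<beta>" "\<alpha> < 2 * \<gamma> - \<beta>" and \<alpha>': "0 < \<alpha>'" "\<alpha>' < \<gamma>"
    and T: "T > 0" and R: "R > 0"
  shows "\<exists>Ts. 0 < Ts \<and> Ts \<le> T \<and>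
    (\<forall>Z Zh u0. noise_bound chi \<rho> m \<alpha> \<alpha>' T Z Zh K \<and>
        besov_member chi \<rho> (-\<alpha>0) u0 \<and> besov_norm chi \<rho> (-\<alpha>0) u0 \<le> R \<longrightarrow>
        (\<exists>v. mild_solution chi \<rho> m \<mu> \<nu> \<tau> \<beta> \<gamma> Z Zh u0 Ts v) \<and>
        (\<forall>v w. mild_solution chi \<rho> m \<mu> \<nu> \<tau> \<beta> \<gamma> Z Zh u0 Ts v \<and>
               mild_solution chi \<rho> m \<mu> \<nu> \<tau> \<beta> \<gamma> Z Zh u0 Ts w \<longrightarrow>
               (\<forall>t\<in>{0<..Ts}. v t = w t)))"
proof -
  define p where "p = 2 * m + 1"
  define b where "b = real p * \<gamma>"
  \<comment> \<open>Half of the room 1 - b. Then (\<beta>' + \<alpha>)/2 + \<kappa> = (\<beta> +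
    \<alpha>)/2 + 1 - b, which is below 1 because (\<beta> + \<alpha>)/2 < \<gamma> < b.\<close>
  define \<kappa> where "\<kappa> = (1 - b) / 2"
  define \<beta>' where "\<beta>' = \<beta> + 2 * \<kappa>"
  define e where "e = \<gamma> + 1 - ((\<beta> + \<alpha>) / 2 + \<kappa>) - b"
  have \<gamma>0: "\<gamma> > 0" using g \<beta> \<alpha>0 by simp
  have b: "b < 1" "3 * \<gamma> \<le> b"
  proof -
    show "b < 1" using \<gamma> by (simp add: b_def p_def field_simps)
    show "3 * \<gamma> \<le> b" unfolding b_def using m \<gamma>0 by (intro mult_right_mono) (auto simp: p_def)
  qed
  have a: "(\<beta> + \<alpha>) / 2 < \<gamma>" using \<alpha>(3) by simp
  have \<kappa>: "0 < \<kappa>" "\<kappa> \<le> 1" using b \<gamma>0 by (auto simp: \<kappa>_def)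
  \<comment> \<open>Here e = \<gamma> - (\<beta> + \<alpha>)/2 + (1 - b)/2, a sum of two positive
    margins.\<close>
  have e: "0 < e" using a b(1) unfolding e_def \<kappa>_def by argo
  have a1: "(\<beta> + \<alpha>) / 2 + \<kappa> < 1" "(\<beta>' + \<alpha>) / 2 + \<kappa> < 1"
    using a b \<gamma>0 by (auto simp: \<beta>'_def \<kappa>_def field_simps)
  have \<alpha>\<beta>: "- \<alpha> \<le> \<beta>" "- \<alpha> \<le> \<beta>'" using \<alpha> \<beta> \<kappa> by (auto simp: \<beta>'_def)
  obtain C where C: "0 \<le> C" "duhamel_bound \<mu> \<alpha> b \<kappa> \<beta> C"
    using duhamel_bes[OF \<mu> \<alpha>\<beta>(1) less_imp_le[OF \<kappa>(1)] \<kappa>(2) a1(1) b(1)] by blast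
  obtain C' where C': "0 \<le> C'" "duhamel_bound \<mu> \<alpha> b \<kappa> \<beta>' C'"
    using duhamel_bes[OF \<mu> \<alpha>\<beta>(2) less_imp_le[OF \<kappa>(1)] \<kappa>(2) a1(2) b(1)] by blast
  obtain G where G: "0 \<le> G" "\<And>f F t. bes (- \<alpha>0) f F \<Longrightarrow> 0 < t \<Longrightarrow> t \<le> 1 \<Longrightarrow>
      bes \<beta> (heat \<mu> t f) (G * t powr (- (\<beta> - - \<alpha>0) / 2) * F)"
    using bes_heat[OF \<mu>, of "- \<alpha>0" \<beta>] \<alpha>0 \<beta> by auto
  obtain G' where G': "0 \<le> G'" "\<And>f F t. bes (- \<alpha>0) f F \<Longrightarrow> 0 < t \<Longrightarrow> t \<le> 1 \<Longrightarrow>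
      bes \<beta>' (heat \<mu> t f) (G' * t powr (- (\<beta>' - - \<alpha>0) / 2) * F)"
    using bes_heat[OF \<mu>, of "- \<alpha>0" \<beta>'] \<alpha>0 \<beta> \<kappa> by (auto simp: \<beta>'_def)
  obtain C1 where C1: "0 \<le> C1" "Psi_bound m \<nu> \<tau> \<alpha> \<beta> C1"
    using Psi_bounds[OF \<alpha>(1,2), of m \<nu> \<tau>] by blast
  note P = Psi_boundD[OF C1(2), folded p_def]
  define K' where "K' = max (2 powr \<bar>\<alpha>\<bar>) (max (max K 0) (165 * 2 powr \<bar>\<alpha>\<bar> * (4 * B) * max K 0))"
  have K': "2 powr \<bar>\<alpha>\<bar> \<le> K'" "max K 0 \<le> K'" "165 * 2 powr \<bar>\<alpha>\<bar> * (4 * B) * max K 0 \<le> K'"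
    by (simp_all only: K'_def max.cobounded1 max.coboundedI2 max.cobounded2)
  have K'1: "1 \<le> K'" using K'(1) \<alpha>(1) by (auto intro: order_trans[rotated] simp: ge_one_powr_ge_zero)
  define D where "D = C1 * K'"
  have D: "0 \<le> D" using C1(1) K'1 by (simp add: D_def)
  \<comment> \<open>The surplus in (\<alpha>0 + \<beta>)/2 < \<gamma>, which makes the free
    evolution of u0 small in the weighted norm for short time.\<close>
  define e0 where "e0 = \<gamma> - (\<beta> + \<alpha>0) / 2"
  have e0: "0 < e0" using g by (simp add: e0_def)
  obtain \<tau>1 where \<tau>1: "\<tau>1 > 0" "\<And>t. 0 < t \<Longrightarrow> t \<le> \<tau>1 \<Longrightarrow> (G * R) * t powr e0 \<le> 1 / 2"
    using small_power_le[of "G * R" e0] G(1) R e0 by auto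
  obtain \<tau>2 where \<tau>2: "\<tau>2 > 0" "\<And>t. 0 < t \<Longrightarrow> t \<le> \<tau>2 \<Longrightarrow> (C * D * exp 1) * t powr e \<le> 1 / 2"
    using small_power_le[of "C * D * exp 1" e] C(1) D e by auto
  \<comment> \<open>All constants so far depend only on parameters, K and R; hence the time is fixed
    before the noise and the initial datum.\<close>
  define Ts where "Ts = min (min T 1) (min \<tau>1 \<tau>2)"
  have Ts: "0 < Ts" "Ts \<le> T" "Ts \<le> 1" "Ts \<le> \<tau>1" "Ts \<le> \<tau>2" using T \<tau>1 \<tau>2 by (auto simp: Ts_def)
  have Wp: "(r * t powr (- \<gamma>)) ^ p = r ^ p * t powr (- b)" if "0 < t" for r t
    using that by (simp add: power_mult_distrib powr_realpow[symmetric] powr_powr b_def mult.commute)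
  show ?thesis
  proof (intro exI[of _ Ts] conjI[OF Ts(1) conjI[OF Ts(2)]] allI impI, goal_cases)
    case (1 Z Zh u0)
    then have n: "noise_bound chi \<rho> m \<alpha> \<alpha>' T Z Zh K" and u0: "bes (- \<alpha>0) u0 R"
      by (auto intro: besov_imp_bes)
    let ?N = "Psi chi \<rho> m \<nu> \<tau> Z Zh"
    have W1: "1 \<le> t powr (- \<gamma>)" if "0 < t" "t \<le> Ts" for t
      using that Ts \<gamma>0 by (simp add: powr_minus one_le_inverse powr_le1)
    have rW: "1 \<le> r * t powr (- \<gamma>)" if "0 < t" "t \<le> Ts" "1 \<le> r" for t r
      using mult_mono[of 1 r 1 "t powr (- \<gamma>)"] W1[OF that(1,2)] that(3) by simp
    have z: "bes (- \<alpha>) (Zx Z Zh i j t) (K' * (r * t powr (- \<gamma>)) ^ (i + j))"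
      if "i \<le> m + 1" "j \<le> m" "0 < t" "t \<le> Ts" "1 \<le> r" for i j t r
    proof (rule bes_mono[OF Zx_bes[OF n _ _ _ \<alpha>'(1) less_imp_le[OF \<alpha>'(2)] that(1,2) K']])
      show "K' * (t powr (- \<gamma>)) ^ (i + j) \<le> K' * (r * t powr (- \<gamma>)) ^ (i + j)"
        using K'1 that by (intro mult_left_mono power_mono) (auto simp: mult_le_cancel_right1)
    qed (use that Ts in auto)
    interpret S: mild_setup chi \<rho> B \<mu> \<alpha> \<beta> \<beta>' \<gamma> \<kappa> b e "1 - ((\<beta>' + \<alpha>) / 2 + \<kappa>) - b" "- (\<beta>' + \<alpha>0) / 2"
      D C C' "G' * R" Ts p "?N" u0
    proof unfold_locales
      show "0 < Ts" "Ts \<le> 1" "\<beta> < \<beta>'" "0 < \<kappa>" "0 \<le> e" "0 \<le> D" "0 \<le> C" "0 \<le> G' * R" "0 \<le> C'"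
        using Ts \<kappa> e D C(1) G'(1) R C'(1) by (auto simp: \<beta>'_def)
      show "duhamel_bound \<mu> \<alpha> b \<kappa> \<beta> C" "duhamel_bound \<mu> \<alpha> b \<kappa> \<beta>' C'"
        "e = \<gamma> + 1 - ((\<beta> + \<alpha>) / 2 + \<kappa>) - b" using C(2) C'(2) e_def by auto
      show "bes (- \<alpha>) (?N t v) (D * r ^ p * t powr (- b))"
        if "0 < t" "t \<le> Ts" "1 \<le> r" "bes \<beta> v (r * t powr (- \<gamma>))" for t v r
        using P(1)[OF rW[OF that(1-3)] K'1 order_refl that(4) z[OF _ _ that(1-3)]]
        unfolding Wp[OF that(1)] by (simp add: D_def mult.assoc)
      show "bes (- \<alpha>) (\<lambda>k. ?N t v k - ?N t w k) (D * r ^ p * \<delta> * t powr (- b))"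
        if t: "0 < t" "t \<le> Ts" "1 \<le> r" and \<delta>: "0 \<le> \<delta>" and v: "bes \<beta> v (r * t powr (- \<gamma>))"
          and w: "bes \<beta> w (r * t powr (- \<gamma>))" and d: "bes \<beta> (\<lambda>k. v k - w k) (\<delta> * t powr (- \<gamma>))"
        for t v w r \<delta>
      proof -
        \<comment> \<open>\<open>Psi_bound\<close> measures the distance relative to W = r
          t^(-\<gamma>), a weaker demand since r \<ge> 1.\<close>
        have "\<delta> * t powr (- \<gamma>) \<le> \<delta> * (r * t powr (- \<gamma>))"
          using t \<delta> by (intro mult_left_mono) (auto simp: mult_le_cancel_right1)
        from bes_mono[OF d this] w
        have "bes (- \<alpha>) (\<lambda>k. ?N t v k - ?N t w k) (C1 * K' * \<delta> * (r * t powr (- \<gamma>)) ^ p)"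
          using P(2)[OF rW[OF t] K'1 \<delta> v z[OF _ _ t]] by blast
        then show ?thesis unfolding Wp[OF t(1)] by (simp add: D_def mult_ac)
      qed
      show "cmeas {0<..Ts} (\<lambda>s. ?N s (v s))" if "cmeas {0<..Ts} v" for v
        by (rule cmeas_Psi[OF that cmeas_subset[OF Zx_cmeas[OF n]]]) (use Ts in auto)
      show "bes \<beta> (heat \<mu> t u0) (1 / 2 * t powr (- \<gamma>))" if t: "0 < t" "t \<le> Ts" for t
      proof (rule bes_mono[OF G(2)[OF u0 t(1)]])
        have "G * t powr (- (\<beta> - - \<alpha>0) / 2) * R = ((G * R) * t powr e0) * t powr (- \<gamma>)"
          using powr_add[of t e0 "- \<gamma>"] by (simp add: e0_def minus_divide_left)
        also have "\<dots> \<le> 1 / 2 * t powr (- \<gamma>)" using t Ts by (intro mult_right_mono \<tau>1) auto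
        finally show "G * t powr (- (\<beta> - - \<alpha>0) / 2) * R \<le> 1 / 2 * t powr (- \<gamma>)" .
      qed (use t Ts in auto)
      show "bes \<beta>' (heat \<mu> t u0) (G' * R * t powr (- (\<beta>' + \<alpha>0) / 2))" if t: "0 < t" "t \<le> Ts" for t
        using G'(2)[OF u0 t(1)] t Ts by (simp add: mult_ac)
      show "C * D * exp 1 * Ts powr e \<le> 1 / 2" using \<tau>2(2) Ts by auto
    qed simp
    have ms: "mild_solution chi \<rho> m \<mu> \<nu> \<tau> \<beta> \<gamma> Z Zh u0 Ts v \<longleftrightarrow> S.mild v" for v
      unfolding mild_solution_def S.mild_def ..
    show ?case
      unfolding ms using S.mild_exists S.mild_unique by blast
  qed
qed

end

lemma dyadic_partition_imp_lp:
  assumes "dyadic_partition chi \<rho>"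
  shows "\<exists>B. lp chi \<rho> B"
proof -
  have s: "smooth2 chi" "smooth2 \<rho>" and z: "\<And>z. norm z > 4 / 3 \<Longrightarrow> chi z = 0" "\<And>z. norm z > 8 / 3 \<Longrightarrow> \<rho> z = 0"
    using assms unfolding dyadic_partition_def by blast+
  obtain B1 where B1: "diff_bdd B1 chi" using smooth2_diff_bdd[OF s(1) z(1)] by blast
  obtain B2 where B2: "diff_bdd B2 \<rho>" using smooth2_diff_bdd[OF s(2) z(2)] by blast
  have "lp chi \<rho> (max 1 (max B1 B2))"
    by unfold_locales (auto intro: assms diff_bdd_mono[OF B1] diff_bdd_mono[OF B2])
  then show ?thesis ..
qed

theorem mainTheorem4:
  fixes m :: nat and \<beta> \<gamma> :: real
  assumes "m \<ge> 1" and "\<beta> > 0" and "\<gamma> < 1 / (2 * real m + 1)"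
  shows "\<exists>\<epsilon>>0. \<forall>(chi :: real \<times> real \<Rightarrow> real) \<rho> (\<mu> :: real) (\<nu> :: complex) (\<tau> :: complex) (\<alpha>0 :: real) (\<alpha> :: real) (\<alpha>' :: real).
     dyadic_partition chi \<rho> \<and> \<mu> > 0 \<and> Re \<nu> > 0 \<and> \<alpha>0 > 0 \<and> (\<alpha>0 + \<beta>) / 2 < \<gamma> \<and>
     0 < \<alpha> \<and> \<alpha> < \<epsilon> \<and> 0 < \<alpha>' \<and> \<alpha>' < \<epsilon> \<longrightarrow>
     (\<forall>T>0. \<forall>R>0. \<forall>K. \<exists>Ts. 0 < Ts \<and> Ts \<le> T \<and>
        (\<forall>Z Zh u0. noise_bound chi \<rho> m \<alpha> \<alpha>' T Z Zh K \<and>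
            besov_member chi \<rho> (-\<alpha>0) u0 \<and> besov_norm chi \<rho> (-\<alpha>0) u0 \<le> R \<longrightarrow>
            (\<exists>v. mild_solution chi \<rho> m \<mu> \<nu> \<tau> \<beta> \<gamma> Z Zh u0 Ts v) \<and>
            (\<forall>v w. mild_solution chi \<rho> m \<mu> \<nu> \<tau> \<beta> \<gamma> Z Zh u0 Ts v \<and>
                   mild_solution chi \<rho> m \<mu> \<nu> \<tau> \<beta> \<gamma> Z Zh u0 Ts w \<longrightarrow>
                   (\<forall>t\<in>{0<..Ts}. v t = w t))))"
proof -
  \<comment> \<open>The bounds serve products (\<alpha> < \<beta>), the Duhamel term (\<alpha> <
    2\<gamma> - \<beta>) and the noise (\<alpha>' < \<gamma>). If \<beta>/2 \<ge> \<gamma>, no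
    \<alpha>0 > 0 meets the hypotheses and 1 is a dummy value.\<close>
  define \<epsilon> where "\<epsilon> = (if \<beta> / 2 < \<gamma> then min \<beta> (min (2 * \<gamma> - \<beta>) \<gamma>) else 1)"
  have \<epsilon>: "\<epsilon> > 0" using assms by (auto simp: \<epsilon>_def)
  show ?thesis
  proof (rule exI[of _ \<epsilon>], intro conjI allI impI \<epsilon>, goal_cases)
    case h: (1 chi \<rho> \<mu> \<nu> \<tau> \<alpha>0 \<alpha> \<alpha>' T R K)
    obtain B where "lp chi \<rho> B" using dyadic_partition_imp_lp h(1) by blast
    then interpret lp chi \<rho> B .
    have "\<beta> / 2 < \<gamma>" using h(1) by (simp add: add_divide_distrib)
    then have "\<alpha> < \<beta>" "\<alpha> < 2 * \<gamma> - \<beta>" "\<alpha>' < \<gamma>" using h(1) by (auto simp: \<epsilon>_def)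
    then show ?case using h assms by (intro local_well_posedness) auto
  qed
qed

end
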